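(* Let $K$ be the Sierpiński gasket, $\alpha=\log3/\log2$ and $\beta^*=\log5/\log2$. (a) For all $\beta\in(\alpha,+\infty)$ there are positive constants (independent of $u$) bounding the ratio from above and below in $$E_\beta(u,u)\asymp\mathcal{E}_\beta(u,u)\quad\text{for all }u\in C(K).$$ (b) For all $u\in L^2(K;\nu)$, $(1-5^{-1}\cdot2^\beta)E_\beta(u,u)\uparrow\mathfrak{E}_{\mathrm{loc}}(u,u)$ as $\beta\uparrow\beta^*$ (i.e. it is monotone increasing in $\beta\in(\alpha,\beta^* )$ and converges to $\mathfrak{E}_{\mathrm{loc}}(u,u)$). (c) For every sequence $\{\beta_n\}\subseteq(\alpha,\beta^* )$ with $\beta_n\uparrow\beta^*$, $(1-5^{-1}\cdot2^{\beta_n})E_{\beta_n}\to\mathfrak{E}_{\mathrm{loc}}$ in the sense of Mosco.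
   Context: Sierpiński gasket: $p_0=(0,0)$, $p_1=(1,0)$, $p_2=(\frac12,\frac{\sqrt3}{2})$, $f_i(x)=(x+p_i)/2$, $i=0,1,2$; $K$ is the unique non-empty compact set with $K=\bigcup_{i=0}^2f_i(K)$, with the Euclidean metric; $\nu$ is the normalized $\alpha$-dimensional Hausdorff measure on $K$. $V_0=\{p_0,p_1,p_2\}$, $W_n=\{0,1,2\}^n$, $V_w=f_{w_1}\circ\cdots\circ f_{w_n}(V_0)$ for $w=w_1\ldots w_n\in W_n$. Define $$\mathcal{E}_\beta(u,u)=\int_K\int_K\frac{(u(x)-u(y))^2}{|x-y|^{\alpha+\beta}}\nu(dx)\nu(dy),\qquad E_\beta(u,u)=\sum_{n=1}^\infty2^{(\beta-\alpha)n}\sum_{w\in W_n}\sum_{p,q\in V_w}(u(p)-u(q))^2,$$ $$\mathfrak{E}_{\mathrm{loc}}(u,u)=\lim_{n\to+\infty}\left(\tfrac53\right)^n\sum_{w\in W_n}\sum_{p,q\in V_w}(u(p)-u(q))^2,$$ where for $u\in C(K)$ the last limit exists in $[0,+\infty]$ because the sequence is monotone increasing (Kigami); $\mathfrak{E}_{\mathrm{loc}}$ with domain $\{u\in C(K):\mathfrak{E}_{\mathrm{loc}}(u,u)<+\infty\}$ is a local regular Dirichlet form on $L^2(K;\nu)$. Convention: $E_\beta$ and $\mathfrak{E}_{\mathrm{loc}}$ are extended to $L^2(K;\nu)$ by evaluating the formula at the (unique) continuous version of $u$ if it has one (the value may be $+\infty$), and by $+\infty$ if $u$ has no continuous version. Mosco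 convergence of closed forms $\mathcal{E}^n$ to $\mathcal{E}$ on $L^2(K;\nu)$ (extended by $+\infty$ outside their domains): (1) for every $\{u_n\}$ converging weakly to $u$ in $L^2(K;\nu)$, $\liminf_n\mathcal{E}^n(u_n,u_n)\ge\mathcal{E}(u,u)$; (2) for every $u\in L^2(K;\nu)$ there is $\{u_n\}$ converging strongly to $u$ in $L^2(K;\nu)$ with $\limsup_n\mathcal{E}^n(u_n,u_n)\le\mathcal{E}(u,u)$. *)

theory Defs
  imports "HOL-Analysis.Analysis"
begin

section \<open>Hausdorff measure\<close>

text \<open>
  Boundedness of the covering sets is required because \<^const>\<open>diameter\<close> is unspecified for unbounded
  sets. The usual dimensional constant is omitted: the measure is only used after normalization.
  For \<open>s > 0\<close> the convention \<open>0 powr s = 0\<close> makes empty and one-point covering sets contribute 0;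
  the definition is not meant for \<open>s = 0\<close>.
\<close>

definition hausdorff_content :: "real \<Rightarrow> real \<Rightarrow> 'a::metric_space set \<Rightarrow> ennreal" where
  "hausdorff_content s \<delta> A =
     (INF U \<in> {U :: nat \<Rightarrow> 'a set. A \<subseteq> (\<Union>i. U i) \<and> (\<forall>i. bounded (U i) \<and> diameter (U i) \<le> \<delta>)}.
        \<Sum>i. ennreal (diameter (U i) powr s))"

definition hausdorff_outer :: "real \<Rightarrow> 'a::metric_space set \<Rightarrow> ennreal" where
  "hausdorff_outer s A = (SUP \<delta> \<in> {0<..}. hausdorff_content s \<delta> A)"

definition hausdorff_measure :: "real \<Rightarrow> 'a::metric_space measure" where
  "hausdorff_measure s = measure_of UNIV (sets borel) (hausdorff_outer s)"


section \<open>The Sierpinski gasket\<close>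

text \<open>The metric of the product type \<^typ>\<open>real \<times> real\<close> is the Euclidean one.\<close>

definition corner :: "nat \<Rightarrow> real \<times> real" where
  "corner i = [(0, 0), (1, 0), (1 / 2, sqrt 3 / 2)] ! i"

definition gasket_map :: "nat \<Rightarrow> real \<times> real \<Rightarrow> real \<times> real" where
  "gasket_map i x = (1 / 2) *\<^sub>R (x + corner i)"

definition gasket :: "(real \<times> real) set" where
  "gasket = (THE K. K \<noteq> {} \<and> compact K \<and> K = (\<Union>i\<in>{0, 1, 2}. gasket_map i ` K))"

definition gasket_dim :: real where
  "gasket_dim = ln 3 / ln 2"

definition walk_dim :: real where
  "walk_dim = ln 5 / ln 2"

text \<open>The underlying space of this measure is \<^const>\<open>gasket\<close>, with its Borel sets.\<close>

definition gasket_measure :: "(real \<times> real) measure" where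
  "gasket_measure = uniform_measure (restrict_space (hausdorff_measure gasket_dim) gasket) gasket"

definition words :: "nat \<Rightarrow> nat list set" where
  "words n = {w. length w = n \<and> set w \<subseteq> {0, 1, 2}}"

text \<open>\<open>foldr gasket_map w\<close> applies the map of the last letter of \<open>w\<close> first.\<close>

definition cell_vertices :: "nat list \<Rightarrow> (real \<times> real) set" where
  "cell_vertices w = foldr gasket_map w ` (corner ` {0, 1, 2})"


section \<open>Energies\<close>

definition graph_energy :: "nat \<Rightarrow> (real \<times> real \<Rightarrow> real) \<Rightarrow> real" where
  "graph_energy n u =
     (\<Sum>w\<in>words n. \<Sum>p\<in>cell_vertices w. \<Sum>q\<in>cell_vertices w. (u p - u q)\<^sup>2)"

definition nonlocal_energy :: "real \<Rightarrow> (real \<times> real \<Rightarrow> real) \<Rightarrow> ennreal" where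
  "nonlocal_energy \<beta> u =
     (\<integral>\<^sup>+ x. \<integral>\<^sup>+ y. ennreal ((u x - u y)\<^sup>2 / dist x y powr (gasket_dim + \<beta>))
        \<partial>gasket_measure \<partial>gasket_measure)"

text \<open>The formulas for continuous \<open>u\<close>; the first series is indexed from 1, hence the \<^const>\<open>Suc\<close>.\<close>

definition discrete_energy :: "real \<Rightarrow> (real \<times> real \<Rightarrow> real) \<Rightarrow> ennreal" where
  "discrete_energy \<beta> u =
     (\<Sum>n. ennreal (2 powr ((\<beta> - gasket_dim) * real (Suc n)) * graph_energy (Suc n) u))"

definition local_energy :: "(real \<times> real \<Rightarrow> real) \<Rightarrow> ennreal" where
  "local_energy u = lim (\<lambda>n. ennreal ((5 / 3) ^ n * graph_energy n u))"

text \<open>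
  Continuous versions are unique on \<^const>\<open>gasket\<close>, and the energies above only depend on the
  values there, so the choice made below is immaterial.
\<close>

definition continuous_version :: "(real \<times> real \<Rightarrow> real) \<Rightarrow> (real \<times> real \<Rightarrow> real) \<Rightarrow> bool" where
  "continuous_version u v \<longleftrightarrow> continuous_on gasket v \<and> (AE x in gasket_measure. u x = v x)"

definition extend_L2 ::
  "((real \<times> real \<Rightarrow> real) \<Rightarrow> ennreal) \<Rightarrow> (real \<times> real \<Rightarrow> real) \<Rightarrow> ennreal" where
  "extend_L2 F u =
     (if \<exists>v. continuous_version u v then F (SOME v. continuous_version u v) else \<infinity>)"


section \<open>Mosco convergence\<close>

text \<open>Elements of \<open>L\<^sup>2\<close> are represented by functions; functionals take values in \<open>[0, \<infinity>]\<close>.\<close>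

definition L2 :: "'a measure \<Rightarrow> ('a \<Rightarrow> real) set" where
  "L2 M = {u \<in> borel_measurable M. integrable M (\<lambda>x. (u x)\<^sup>2)}"

definition L2_strong :: "'a measure \<Rightarrow> (nat \<Rightarrow> 'a \<Rightarrow> real) \<Rightarrow> ('a \<Rightarrow> real) \<Rightarrow> bool" where
  "L2_strong M us u \<longleftrightarrow>
     (\<forall>n. us n \<in> L2 M) \<and> u \<in> L2 M \<and> (\<lambda>n. \<integral>x. (us n x - u x)\<^sup>2 \<partial>M) \<longlonglongrightarrow> 0"

definition L2_weak :: "'a measure \<Rightarrow> (nat \<Rightarrow> 'a \<Rightarrow> real) \<Rightarrow> ('a \<Rightarrow> real) \<Rightarrow> bool" where
  "L2_weak M us u \<longleftrightarrow>
     (\<forall>n. us n \<in> L2 M) \<and> u \<in> L2 M \<and>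
     (\<forall>g\<in>L2 M. (\<lambda>n. \<integral>x. us n x * g x \<partial>M) \<longlonglongrightarrow> (\<integral>x. u x * g x \<partial>M))"

definition mosco_convergent ::
  "'a measure \<Rightarrow> (nat \<Rightarrow> ('a \<Rightarrow> real) \<Rightarrow> ennreal) \<Rightarrow> (('a \<Rightarrow> real) \<Rightarrow> ennreal) \<Rightarrow> bool" where
  "mosco_convergent M F G \<longleftrightarrow>
     (\<forall>us u. L2_weak M us u \<longrightarrow> G u \<le> liminf (\<lambda>n. F n (us n))) \<and>
     (\<forall>u\<in>L2 M. \<exists>us. L2_strong M us u \<and> limsup (\<lambda>n. F n (us n)) \<le> G u)"

end

theory Submission
  imports Defs "HOL-Complex_Analysis.Great_Picard"
begin

text \<open>
  By the inequality \<open>a\<^sub>n \<le> 5/3 a\<^sub>n\<^sub>+\<^sub>1\<close> for the graph energies, \<open>b\<^sub>n = (5/3)\<^sup>n a\<^sub>n\<close> increases. With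
  \<open>\<lambda> = 2\<^sup>\<beta> / 5 < 1\<close> and \<open>b\<^sub>0\<close> replaced by 0, summation by parts turns \<open>(1 - \<lambda>) \<Sum>\<^sub>n\<^sub>\<ge>\<^sub>1 \<lambda>\<^sup>n b\<^sub>n\<close> into
  \<open>\<Sum>\<^sub>n\<^sub>\<ge>\<^sub>1 \<lambda>\<^sup>n (b\<^sub>n - b\<^sub>n\<^sub>-\<^sub>1)\<close>, which increases in \<open>\<beta>\<close> to \<open>lim b\<^sub>n\<close>; this is (b).

  For (a), the double integral is split according to the last level at which \<open>x\<close> and \<open>y\<close> lie in
  adjacent cells, and \<open>u x\<close> is compared with a common corner of these cells by telescoping along
  corners of cells shrinking to \<open>x\<close>. Conversely the value at a corner is compared with the mean over
  a cell by telescoping along the means over the cells shrinking to that corner. Both geometric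
  series converge because \<open>2\<^sup>\<beta> > 3\<close>. The measure enters only through the mass \<open>3\<^sup>-\<^sup>n\<close> of the cells.

  For (c), the telescoping estimate makes sets of bounded energy equicontinuous, so by
  Arzela-Ascoli a weakly convergent sequence of bounded energy has a pointwise convergent
  subsequence, along which \<open>\<lambda>\<^sup>n b\<^sub>n \<le> (1 - \<lambda>) E\<^sub>\<beta>\<close> passes to the limit.
\<close>

section \<open>Hausdorff measures\<close>

text \<open>Two definitions have to be made effective before any estimate starts.
  \<open>gasket\<close> is a definite description, so existence and uniqueness of the compact fixed
  set are proved. \<open>hausdorff_measure\<close> is built by \<open>measure_of\<close>, which
  gives the zero measure unless the set function is a measure on the Borel sets; this is
  Caratheodory's criterion. The mass 3^-n then rests on the Hausdorff measure of the gasket being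
  finite and positive. The geometry of the cells is reduced to integers. A cell of level n is
  encoded by two binary numbers, and adjacency is a condition on their differences: adjacent cells
  share a corner, other pairs are at least 2^-n / 2 apart, and at most 7 cells are adjacent to a
  given one. This serves the positivity of the measure, both bounds in (a) and the equicontinuity in
  (c). Telescoping of squares uses Cauchy-Schwarz with weights r^k, where r > 1. After integration
  over cells, whose mass falls like 3^-k, r = 2 is admissible because 2 < 2^\<beta>; in the
  estimates at a point, r is placed between 1 and 2^\<beta> / 3.\<close>

lemma hausdorff_content_le:
  fixes U :: "nat \<Rightarrow> 'a::metric_space set"
  assumes "A \<subseteq> (\<Union>i. U i)" "\<And>i. bounded (U i)" "\<And>i. diameter (U i) \<le> \<delta>"
  shows "hausdorff_content s \<delta> A \<le> (\<Sum>i. ennreal (diameter (U i) powr s))"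
  unfolding hausdorff_content_def by (rule INF_lower) (use assms in auto)

lemma hausdorff_content_greatest:
  fixes A :: "'a::metric_space set"
  assumes "\<And>U :: nat \<Rightarrow> 'a set. \<lbrakk>A \<subseteq> (\<Union>i. U i); \<And>i. bounded (U i); \<And>i. diameter (U i) \<le> \<delta>\<rbrakk>
             \<Longrightarrow> c \<le> (\<Sum>i. ennreal (diameter (U i) powr s))"
  shows "c \<le> hausdorff_content s \<delta> A"
  unfolding hausdorff_content_def by (rule INF_greatest) (use assms in auto)

lemma hausdorff_content_less_cover:
  fixes A :: "'a::metric_space set"
  assumes "hausdorff_content s \<delta> A < c"
  obtains U :: "nat \<Rightarrow> 'a set" where "A \<subseteq> (\<Union>i. U i)" "\<And>i. bounded (U i)"
    "\<And>i. diameter (U i) \<le> \<delta>" "(\<Sum>i. ennreal (diameter (U i) powr s)) < c"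
  using assms unfolding hausdorff_content_def INF_less_iff by auto

lemma hausdorff_content_mono: "A \<subseteq> B \<Longrightarrow> hausdorff_content s \<delta> A \<le> hausdorff_content s \<delta> B"
  unfolding hausdorff_content_def by (rule INF_superset_mono) auto

lemma hausdorff_content_antimono:
  "\<delta> \<le> \<delta>' \<Longrightarrow> hausdorff_content s \<delta>' A \<le> hausdorff_content s \<delta> A"
  unfolding hausdorff_content_def by (rule INF_superset_mono) (auto intro: order_trans)

lemma hausdorff_content_bounded_le:
  fixes A :: "'a::metric_space set"
  assumes "bounded A" "diameter A \<le> \<delta>"
  shows "hausdorff_content s \<delta> A \<le> ennreal (diameter A powr s)"
proof -
  define U :: "nat \<Rightarrow> 'a set" where "U i = (if i = 0 then A else {})" for i
  have "0 \<le> \<delta>"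
    using assms diameter_ge_0 order_trans by blast
  then have "hausdorff_content s \<delta> A \<le> (\<Sum>i. ennreal (diameter (U i) powr s))"
    by (intro hausdorff_content_le) (use assms in \<open>auto simp: U_def split: if_splits\<close>)
  also have "\<dots> = (\<Sum>i\<in>{0}. ennreal (diameter (U i) powr s))"
    by (rule suminf_finite) (auto simp: U_def)
  finally show ?thesis
    by (simp add: U_def)
qed

lemma hausdorff_content_empty: "0 \<le> \<delta> \<Longrightarrow> hausdorff_content s \<delta> {} = 0"
  using hausdorff_content_bounded_le[of "{}" \<delta> s] by simp

text \<open>Near-optimal covers of the \<open>A n\<close>, with errors \<open>e / 2^(n+1)\<close>,
  are merged into a single sequence by \<open>prod_decode\<close>.\<close>

lemma hausdorff_content_UN_le:
  fixes A :: "nat \<Rightarrow> 'a::metric_space set"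
  shows "hausdorff_content s \<delta> (\<Union>n. A n) \<le> (\<Sum>n. hausdorff_content s \<delta> (A n))"
proof (rule ennreal_le_epsilon)
  let ?O = "hausdorff_content s \<delta>"
  fix e :: real assume "0 < e" and "(\<Sum>n. ?O (A n)) < top"
  then have *: "?O (A n) < ?O (A n) + e * (1/2)^Suc n" for n
    by (auto simp add: less_top dest!: ennreal_suminf_lessD)
  have "\<exists>U. A n \<subseteq> (\<Union>i. U i) \<and> (\<forall>i. bounded (U i)) \<and> (\<forall>i. diameter (U i) \<le> \<delta>) \<and>
          (\<Sum>i. ennreal (diameter (U i) powr s)) < ?O (A n) + e * (1/2)^Suc n" for n
    by (rule hausdorff_content_less_cover[OF *[of n]]) blast
  then obtain U where U: "\<And>n. A n \<subseteq> (\<Union>i. U n i)" "\<And>n i. bounded (U n i)"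
      "\<And>n i. diameter (U n i) \<le> \<delta>"
      "\<And>n. (\<Sum>i. ennreal (diameter (U n i) powr s)) < ?O (A n) + e * (1/2)^Suc n"
    by metis
  define C where "C = case_prod U o prod_decode"
  have "(\<Union>i. A i) \<subseteq> (\<Union>i. C i)"
    using U(1) by (auto simp add: C_def subset_eq) (metis prod.case prod_encode_inverse)
  then have "?O (\<Union>i. A i) \<le> (\<Sum>i. ennreal (diameter (C i) powr s))"
    by (rule hausdorff_content_le) (auto simp: C_def U split: prod.split)
  also have "\<dots> = (\<Sum>n. \<Sum>i. ennreal (diameter (U n i) powr s))"
    using suminf_ennreal_2dimen[of _ "\<lambda>p. ennreal (diameter (case_prod U p) powr s)"]
    by (simp add: C_def comp_def)
  also have "\<dots> \<le> (\<Sum>n. ?O (A n) + e * (1/2) ^ Suc n)"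
    by (intro suminf_le allI less_imp_le U(4)) auto
  also have "\<dots> = (\<Sum>n. ?O (A n)) + (\<Sum>n. ennreal e * ennreal ((1/2) ^ Suc n))"
    using \<open>0 < e\<close> by (subst suminf_add[symmetric])
                     (auto simp del: ennreal_suminf_cmult simp add: ennreal_mult[symmetric])
  also have "\<dots> = (\<Sum>n. ?O (A n)) + e"
    unfolding ennreal_suminf_cmult
    by (subst suminf_ennreal_eq[OF zero_le_power power_half_series]) auto
  finally show "?O (\<Union>i. A i) \<le> (\<Sum>n. ?O (A n)) + e" .
qed

lemma hausdorff_content_le_outer:
  "0 < \<delta> \<Longrightarrow> hausdorff_content s \<delta> A \<le> hausdorff_outer s A"
  unfolding hausdorff_outer_def by (rule SUP_upper) auto

lemma hausdorff_outer_least: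
  "(\<And>\<delta>. 0 < \<delta> \<Longrightarrow> hausdorff_content s \<delta> A \<le> c) \<Longrightarrow> hausdorff_outer s A \<le> c"
  unfolding hausdorff_outer_def by (rule SUP_least) auto

lemma outer_measure_space_hausdorff_outer:
  "outer_measure_space UNIV (hausdorff_outer s :: 'a::metric_space set \<Rightarrow> ennreal)"
  unfolding outer_measure_space_def
proof (intro conjI)
  show "positive UNIV (hausdorff_outer s :: 'a set \<Rightarrow> ennreal)"
    by (auto simp: positive_def hausdorff_outer_def hausdorff_content_empty)
  show "increasing UNIV (hausdorff_outer s :: 'a set \<Rightarrow> ennreal)"
    unfolding increasing_def hausdorff_outer_def
    by (intro ballI impI SUP_mono' hausdorff_content_mono)
  have "hausdorff_outer s (\<Union>n. A n) \<le> (\<Sum>n. hausdorff_outer s (A n))" for A :: "nat \<Rightarrow> 'a set"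
  proof (rule hausdorff_outer_least)
    fix \<delta> :: real assume "0 < \<delta>"
    have "hausdorff_content s \<delta> (\<Union>n. A n) \<le> (\<Sum>n. hausdorff_content s \<delta> (A n))"
      by (rule hausdorff_content_UN_le)
    also have "\<dots> \<le> (\<Sum>n. hausdorff_outer s (A n))"
      using \<open>0 < \<delta>\<close> by (intro suminf_le hausdorff_content_le_outer) auto
    finally show "hausdorff_content s \<delta> (\<Union>n. A n) \<le> (\<Sum>n. hausdorff_outer s (A n))" .
  qed
  then show "countably_subadditive UNIV (hausdorff_outer s :: 'a set \<Rightarrow> ennreal)"
    unfolding countably_subadditive_def by simp
qed

text \<open>A set of diameter at most \<open>\<delta>\<close> cannot meet both \<open>A\<close> and
  \<open>B\<close>, so a cover of the union splits into a cover of each. Sets assigned to the other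
  side become \<open>{}\<close>, which contributes 0, so the two sums add up to the original
  one.\<close>

lemma hausdorff_content_separated:
  fixes A B :: "'a::metric_space set"
  assumes sep: "\<And>x y. x \<in> A \<Longrightarrow> y \<in> B \<Longrightarrow> \<delta> < dist x y" and "0 \<le> \<delta>"
  shows "hausdorff_content s \<delta> A + hausdorff_content s \<delta> B \<le> hausdorff_content s \<delta> (A \<union> B)"
proof (rule hausdorff_content_greatest)
  fix U :: "nat \<Rightarrow> 'a set"
  assume cov: "A \<union> B \<subseteq> (\<Union>i. U i)" and bd: "\<And>i. bounded (U i)" and di: "\<And>i. diameter (U i) \<le> \<delta>"
  define V where "V i = (if U i \<inter> A = {} then {} else U i)" for i
  define W where "W i = (if U i \<inter> A = {} then U i else {})" for i
  have "A \<subseteq> (\<Union>i. V i)"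
  proof
    fix x assume "x \<in> A"
    with cov obtain i where "x \<in> U i"
      by blast
    with \<open>x \<in> A\<close> have "x \<in> V i"
      by (auto simp: V_def)
    then show "x \<in> (\<Union>i. V i)"
      by blast
  qed
  moreover have "B \<subseteq> (\<Union>i. W i)"
  proof
    fix y assume "y \<in> B"
    with cov obtain i where i: "y \<in> U i"
      by blast
    have "U i \<inter> A = {}"
    proof (rule ccontr)
      assume "U i \<inter> A \<noteq> {}"
      then obtain x where "x \<in> U i" "x \<in> A"
        by blast
      then have "dist x y \<le> \<delta>"
        using i diameter_bounded_bound[OF bd[of i], of x y] di[of i] by linarith
      with sep[OF \<open>x \<in> A\<close> \<open>y \<in> B\<close>] show False
        by simp
    qed
    with i have "y \<in> W i"
      by (auto simp: W_def)
    then show "y \<in> (\<Union>i. W i)"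
      by blast
  qed
  ultimately have "hausdorff_content s \<delta> A + hausdorff_content s \<delta> B
      \<le> (\<Sum>i. ennreal (diameter (V i) powr s)) + (\<Sum>i. ennreal (diameter (W i) powr s))"
    using bd di \<open>0 \<le> \<delta>\<close>
    by (intro add_mono hausdorff_content_le) (auto simp: V_def W_def)
  also have "\<dots> = (\<Sum>i. ennreal (diameter (V i) powr s) + ennreal (diameter (W i) powr s))"
    by (rule suminf_add) auto
  also have "\<dots> = (\<Sum>i. ennreal (diameter (U i) powr s))"
    by (rule arg_cong[where f = suminf]) (auto simp: V_def W_def)
  finally show "hausdorff_content s \<delta> A + hausdorff_content s \<delta> B
      \<le> (\<Sum>i. ennreal (diameter (U i) powr s))" .
qed

lemma hausdorff_outer_separated:
  fixes A B :: "'a::metric_space set"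
  assumes sep: "\<And>x y. x \<in> A \<Longrightarrow> y \<in> B \<Longrightarrow> d \<le> dist x y" and "0 < d"
  shows "hausdorff_outer s A + hausdorff_outer s B \<le> hausdorff_outer s (A \<union> B)"
proof -
  let ?c = "hausdorff_content s"
  have "hausdorff_outer s A + hausdorff_outer s B = (SUP \<delta>\<in>{0<..}. ?c \<delta> A + ?c \<delta> B)"
    unfolding hausdorff_outer_def
  \<comment> \<open>Contents grow as \<open>\<delta>\<close> shrinks, so the family is directed and
    the supremum of the sums is the sum of the suprema.\<close>
  proof (rule SUP_add_directed_ennreal[symmetric])
    fix i j :: real assume "i \<in> {0<..}" "j \<in> {0<..}"
    then have "min i j \<in> {0<..}" "?c i A + ?c j B \<le> ?c (min i j) A + ?c (min i j) B"
      by (auto intro!: add_mono hausdorff_content_antimono)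
    then show "\<exists>k\<in>{0<..}. ?c i A + ?c j B \<le> ?c k A + ?c k B"
      by blast
  qed
  also have "\<dots> \<le> hausdorff_outer s (A \<union> B)"
  proof (rule SUP_least)
    fix \<delta> :: real assume \<delta>: "\<delta> \<in> {0<..}"
    \<comment> \<open>Halving \<open>d\<close> gives \<open>\<eta> < d\<close>, because the
      separation of contents asks for a strict inequality.\<close>
    define \<eta> where "\<eta> = min \<delta> (d / 2)"
    have \<eta>: "0 < \<eta>" "\<eta> \<le> \<delta>" "\<eta> < d"
      using \<delta> \<open>0 < d\<close> by (auto simp: \<eta>_def)
    have "?c \<delta> A + ?c \<delta> B \<le> ?c \<eta> A + ?c \<eta> B"
      using \<eta> by (intro add_mono hausdorff_content_antimono) auto
    also have "\<dots> \<le> ?c \<eta> (A \<union> B)"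
      using \<eta> sep by (intro hausdorff_content_separated) force+
    also have "\<dots> \<le> hausdorff_outer s (A \<union> B)"
      using \<eta> by (intro hausdorff_content_le_outer)
    finally show "?c \<delta> A + ?c \<delta> B \<le> hausdorff_outer s (A \<union> B)" .
  qed
  finally show ?thesis .
qed

section \<open>Outer measures and Caratheodory's criterion\<close>

text \<open>\<open>outer_measure_space\<close> asks for subadditivity on disjoint families;
  \<open>disjointed A\<close> has the same union and smaller members.\<close>

lemma outer_measure_space_UN_le:
  assumes "outer_measure_space UNIV f"
  shows "f (\<Union>n. A n :: 'a set) \<le> (\<Sum>n. f (A n))"
proof -
  have "f (\<Union>n. disjointed A n) \<le> (\<Sum>n. f (disjointed A n))"
    using assms disjoint_family_disjointed[of A]
    by (simp add: outer_measure_space_def countably_subadditive_def)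
  also have "\<dots> \<le> (\<Sum>n. f (A n))"
    using assms disjointed_subset[of A]
    by (intro suminf_le) (auto simp: outer_measure_space_def increasing_def)
  finally show ?thesis
    by (simp add: UN_disjointed_eq)
qed

lemma outer_measure_space_subadditive:
  assumes "outer_measure_space UNIV f"
  shows "f (A \<union> B) \<le> f A + f B"
proof -
  have "f (\<Union>n. binaryset A B n) \<le> (\<Sum>n. f (binaryset A B n))"
    using assms by (rule outer_measure_space_UN_le)
  also have "\<dots> = f A + f B"
    using assms by (intro suminf_binaryset_eq) (auto simp: outer_measure_space_def positive_def)
  finally show ?thesis
    by (simp add: UN_binaryset_eq)
qed

lemma outer_measure_space_finite_subadditive:
  assumes "outer_measure_space UNIV f" "finite I"
  shows "f (\<Union>i\<in>I. A i) \<le> (\<Sum>i\<in>I. f (A i))"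
  using assms(2)
proof induction
  case empty
  then show ?case
    using assms(1) by (auto simp: outer_measure_space_def positive_def)
next
  case (insert i I)
  have "f (\<Union>i\<in>insert i I. A i) \<le> f (A i) + f (\<Union>i\<in>I. A i)"
    using outer_measure_space_subadditive[OF assms(1)] by simp
  also have "\<dots> \<le> f (A i) + (\<Sum>i\<in>I. f (A i))"
    using insert.IH by (intro add_left_mono)
  finally show ?case
    using insert by simp
qed

text \<open>The shells \<open>R n\<close> around the closed set \<open>F\<close> are pairwise separated once their indices differ
  by at least 2, so the even and the odd ones each have total measure at most \<open>f A\<close>.\<close>

lemma metric_outer_measure_closed:
  fixes f :: "'a::metric_space set \<Rightarrow> ennreal"
  assumes f: "outer_measure_space UNIV f"
    and sep: "\<And>A B d. \<lbrakk>0 < d; \<And>x y. x \<in> A \<Longrightarrow> y \<in> B \<Longrightarrow> d \<le> dist x y\<rbrakk> \<Longrightarrow> f A + f B \<le> f (A \<union> B)"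
    and "closed F"
  shows "f (A \<inter> F) + f (A - F) \<le> f A"
proof (cases "F = {} \<or> f A = \<infinity>")
  case True
  then show ?thesis
    using f by (auto simp: outer_measure_space_def positive_def)
next
  case False
  then have F: "F \<noteq> {}" and fin: "f A < \<infinity>"
    by (auto simp: top.not_eq_extremum)
  have mono: "f X \<le> f Y" if "X \<subseteq> Y" for X Y
    using f that by (auto simp: outer_measure_space_def increasing_def)
  note csub = outer_measure_space_UN_le[OF f]
  define B where "B n = {x\<in>A. 1 / (real n + 1) \<le> infdist x F}" for n
  define R where "R n = {x\<in>A. 1 / (real n + 2) \<le> infdist x F \<and> infdist x F < 1 / (real n + 1)}" for n
  have dist_ge: "infdist x F - infdist y F \<le> dist x y" for x y
    using infdist_triangle[of x F y] by simp
  have B_le: "f (A \<inter> F) + f (B n) \<le> f A" for n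
  proof -
    have "f (A \<inter> F) + f (B n) \<le> f (A \<inter> F \<union> B n)"
    proof (rule sep[of "1 / (real n + 1)"])
      fix x y assume "x \<in> A \<inter> F" "y \<in> B n"
      then show "1 / (real n + 1) \<le> dist x y"
        using infdist_le[of x F y] by (auto simp: B_def dist_commute)
    qed auto
    also have "\<dots> \<le> f A"
      by (rule mono) (auto simp: B_def)
    finally show ?thesis .
  qed
  \<comment> \<open>The skipped shell \<open>R m\<close> lies between: across it the distance to
    \<open>F\<close> falls from \<open>1 / (m + 1)\<close> to \<open>1 / (m + 2)\<close>, and
    \<open>infdist\<close> is 1-Lipschitz.\<close>
  have R_sep: "f (R (Suc m)) + f (\<Union>k\<in>I. R k) \<le> f (R (Suc m) \<union> (\<Union>k\<in>I. R k))"
    if "\<And>k. k \<in> I \<Longrightarrow> k + 1 \<le> m" for m I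
  proof (rule sep[of "1 / (real m + 1) - 1 / (real m + 2)"])
    show "0 < 1 / (real m + 1) - 1 / (real m + 2)"
      using divide_strict_left_mono[of "real m + 1" "real m + 2" 1] by simp
  next
    fix x y assume x: "x \<in> R (Suc m)" and "y \<in> (\<Union>k\<in>I. R k)"
    then obtain k where k: "k \<in> I" "y \<in> R k"
      by blast
    have "1 / (real m + 1) \<le> 1 / (real k + 2)"
      using that[OF k(1)] by (intro divide_left_mono) (auto simp flip: of_nat_Suc)
    also have "\<dots> \<le> infdist y F"
      using k by (simp add: R_def)
    finally have "1 / (real m + 1) \<le> infdist y F" .
    moreover have "infdist x F < 1 / (real m + 2)"
      using x by (simp add: R_def add.commute)
    ultimately show "1 / (real m + 1) - 1 / (real m + 2) \<le> dist x y"
      using dist_ge[of y x] by (simp add: dist_commute)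
  qed
  have sum_parity: "(\<Sum>k<n. f (R (2 * k + p))) \<le> f A" for p n
  proof -
    have "(\<Sum>k<n. f (R (2 * k + p))) \<le> f (\<Union>k<n. R (2 * k + p))"
    proof (induction n)
      case (Suc n)
      show ?case
      proof (cases n)
        case (Suc l)
        then have eq: "2 * n + p = Suc (2 * l + 1 + p)"
          by simp
        have "(\<Sum>k<Suc n. f (R (2 * k + p)))
            \<le> f (R (2 * n + p)) + f (\<Union>k\<in>(\<lambda>k. 2 * k + p) ` {..<n}. R k)"
          using Suc.IH by (simp add: add.commute add_left_mono image_image)
        also have "\<dots> \<le> f (R (2 * n + p) \<union> (\<Union>k\<in>(\<lambda>k. 2 * k + p) ` {..<n}. R k))"
          unfolding eq by (rule R_sep) (use Suc in auto)
        also have "R (2 * n + p) \<union> (\<Union>k\<in>(\<lambda>k. 2 * k + p) ` {..<n}. R k) = (\<Union>k<Suc n. R (2 * k + p))"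
          by (auto simp: lessThan_Suc)
        finally show ?thesis .
      qed (simp add: lessThan_Suc)
    qed simp
    also have "\<dots> \<le> f A"
      by (rule mono) (auto simp: R_def)
    finally show ?thesis .
  qed
  have "(\<Sum>k. f (R k)) \<le> f A + f A"
  proof (rule suminf_le_const)
    fix n
    have "(\<Sum>k<n. f (R k)) \<le> (\<Sum>k<2 * n. f (R k))"
      by (rule sum_mono2) auto
    also have "\<dots> = (\<Sum>k<n. f (R (2 * k + 0))) + (\<Sum>k<n. f (R (2 * k + 1)))"
      by (induction n) (auto simp: algebra_simps)
    also have "\<dots> \<le> f A + f A"
      by (intro add_mono sum_parity)
    finally show "(\<Sum>k<n. f (R k)) \<le> f A + f A" .
  qed auto
  also have "\<dots> < \<infinity>"
    using fin by simp
  finally have R_fin: "(\<Sum>k. f (R k)) \<noteq> \<infinity>"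
    by simp
  \<comment> \<open>Finiteness of \<open>f A\<close> makes the series over the shells converge, so
    the part of \<open>A - F\<close> outside \<open>B n\<close> becomes negligible as
    \<open>n\<close> grows.\<close>
  have tail: "(\<lambda>n. \<Sum>k. f (R (k + n))) \<longlonglongrightarrow> 0"
  proof -
    have "f (R k) \<noteq> \<infinity>" for k
      using R_fin ennreal_suminf_lessD[of "\<lambda>k. f (R k)" \<infinity> k] by (auto simp: less_top)
    define r where "r k = enn2real (f (R k))" for k
    have r: "f (R k) = ennreal (r k)" "0 \<le> r k" for k
      using \<open>\<And>k. f (R k) \<noteq> \<infinity>\<close> by (auto simp: r_def less_top)
    have "summable r"
      using R_fin r by (intro summable_suminf_not_top) auto
    have "(\<Sum>k. f (R (k + n))) = ennreal (\<Sum>k. r (k + n))" for n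
      using r summable_ignore_initial_segment[OF \<open>summable r\<close>, of n] by (simp add: suminf_ennreal2)
    moreover have "(\<lambda>n. \<Sum>k. r (k + n)) \<longlonglongrightarrow> 0"
      using \<open>summable r\<close> by (rule suminf_exist_split2)
    ultimately show ?thesis
      using tendsto_ennrealI by fastforce
  qed
  have "f (A \<inter> F) + f (A - F) \<le> f A + (\<Sum>k. f (R (k + n)))" for n
  proof -
    have "A - F \<subseteq> B n \<union> (\<Union>k. R (k + n))"
    proof
      fix x assume x: "x \<in> A - F"
      then have pos: "0 < infdist x F"
        using in_closed_iff_infdist_zero[OF \<open>closed F\<close> F] infdist_nonneg[of x F] by force
      show "x \<in> B n \<union> (\<Union>k. R (k + n))"
      proof (cases "1 / (real n + 1) \<le> infdist x F")
        case True
        then show ?thesis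
          using x by (simp add: B_def)
      next
        case False
        define t where "t = 1 / infdist x F"
        have t: "real n + 1 < t"
          using False pos by (simp add: t_def field_simps)
        \<comment> \<open>The index with \<open>m + 1 < t \<le> m + 2\<close>, that is, of the shell
          containing \<open>x\<close>.\<close>
        define m where "m = nat \<lceil>t\<rceil> - 2"
        have m: "int m = \<lceil>t\<rceil> - 2" "n \<le> m"
          using t unfolding m_def by linarith+
        have "real m + 1 < t" "t \<le> real m + 2"
          using m by linarith+
        then have "x \<in> R m"
          using x pos by (auto simp: R_def t_def field_simps)
        then show ?thesis
          using m(2) by (auto intro!: exI[of _ "m - n"])
      qed
    qed
    then have "f (A - F) \<le> f (B n \<union> (\<Union>k. R (k + n)))"
      by (rule mono)
    also have "\<dots> \<le> f (B n) + (\<Sum>k. f (R (k + n)))"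
      using outer_measure_space_subadditive[OF f] csub add_left_mono order_trans by blast
    finally have "f (A \<inter> F) + f (A - F) \<le> (f (A \<inter> F) + f (B n)) + (\<Sum>k. f (R (k + n)))"
      by (simp add: add.assoc add_left_mono)
    also have "\<dots> \<le> f A + (\<Sum>k. f (R (k + n)))"
      by (intro add_right_mono B_le)
    finally show ?thesis .
  qed
  moreover have "(\<lambda>n. f A + (\<Sum>k. f (R (k + n)))) \<longlonglongrightarrow> f A + 0"
    by (intro tendsto_add tendsto_const tail)
  ultimately show ?thesis
    by (intro LIMSEQ_le_const[of _ "f A" "f (A \<inter> F) + f (A - F)"]) auto
qed

text \<open>The sets that split every set additively form a sigma-algebra on which \<open>f\<close>
  is countably additive; it contains the closed sets, hence the Borel sets.\<close>

lemma metric_outer_measure_borel: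
  fixes f :: "'a::metric_space set \<Rightarrow> ennreal"
  assumes f: "outer_measure_space UNIV f"
    and sep: "\<And>A B d. \<lbrakk>0 < d; \<And>x y. x \<in> A \<Longrightarrow> y \<in> B \<Longrightarrow> d \<le> dist x y\<rbrakk> \<Longrightarrow> f A + f B \<le> f (A \<union> B)"
  shows "measure_space UNIV (sets borel) f"
proof -
  let ?L = "lambda_system UNIV UNIV f"
  interpret P: sigma_algebra UNIV "UNIV :: 'a set set"
    using sigma_algebra_Pow[of UNIV] by simp
  have L: "measure_space UNIV ?L f"
    using P.caratheodory_lemma[OF f] by simp
  then interpret L: sigma_algebra UNIV ?L
    by (simp add: measure_space_def)
  have "{S. closed S} \<subseteq> ?L"
  proof
    fix F :: "'a set" assume F: "F \<in> {S. closed S}"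
    have le: "f (A \<inter> F) + f (A - F) \<le> f A" for A
    proof (rule metric_outer_measure_closed[OF f])
      show "closed F"
        using F by simp
    qed (fact sep)
    have ge: "f A \<le> f (A \<inter> F) + f (A - F)" for A
      using outer_measure_space_subadditive[OF f, of "A \<inter> F" "A - F"] by (simp add: Int_Diff_Un)
    show "F \<in> ?L"
      unfolding P.lambda_system_eq using antisym[OF le ge] by auto
  qed
  then have "sets borel \<subseteq> ?L"
    unfolding borel_eq_closed by (simp add: L.sigma_sets_subset)
  have "countably_additive (sets borel) f"
    unfolding countably_additive_def
  proof (intro allI impI)
    fix A :: "nat \<Rightarrow> 'a set"
    assume A: "range A \<subseteq> sets borel" "disjoint_family A" "\<Union> (range A) \<in> sets borel"
    then have "range A \<subseteq> ?L" "\<Union> (range A) \<in> ?L"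
      using \<open>sets borel \<subseteq> ?L\<close> by auto
    with A(2) show "(\<Sum>i. f (A i)) = f (\<Union> (range A))"
      using L by (simp add: measure_space_def countably_additive_def)
  qed
  then show ?thesis
    using L sets.sigma_algebra_axioms[of "borel :: 'a measure"]
    by (simp add: measure_space_def positive_def)
qed

section \<open>The Hausdorff measure of Borel sets and its scaling\<close>

lemma space_hausdorff_measure [simp]: "space (hausdorff_measure s) = UNIV"
  by (simp add: hausdorff_measure_def)

lemma sets_hausdorff_measure [simp]: "sets (hausdorff_measure s) = sets borel"
  using sets.sigma_sets_eq[of borel] by (simp add: hausdorff_measure_def)

text \<open>\<open>measure_of\<close> would collapse to the zero measure if the outer measure were
  not countably additive on the Borel sets; additivity on separated sets rules this out.\<close>

lemma emeasure_hausdorff_measure: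
  fixes A :: "'a::metric_space set"
  assumes "A \<in> sets borel"
  shows "emeasure (hausdorff_measure s) A = hausdorff_outer s A"
proof -
  have "measure_space UNIV (sets borel) (hausdorff_outer s :: 'a set \<Rightarrow> ennreal)"
    by (rule metric_outer_measure_borel[OF outer_measure_space_hausdorff_outer])
       (rule hausdorff_outer_separated, auto)
  then show ?thesis
    using assms sets.sigma_sets_eq[of borel] unfolding hausdorff_measure_def
    by (intro emeasure_measure_of_sigma) (auto simp: measure_space_def)
qed

text \<open>The map carries covers of \<open>A\<close> to covers of the image with diameters shrunk
  by \<open>r\<close>; \<open>r \<le> 1\<close> keeps them below \<open>\<delta>\<close>.\<close>

lemma hausdorff_outer_image_le:
  fixes f :: "'a::metric_space \<Rightarrow> 'b::metric_space"
  assumes f: "\<And>x y. dist (f x) (f y) = r * dist x y" and r: "0 < r" "r \<le> 1" and "0 \<le> s"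
  shows "hausdorff_outer s (f ` A) \<le> ennreal (r powr s) * hausdorff_outer s A"
proof (rule hausdorff_outer_least)
  fix \<delta> :: real assume "0 < \<delta>"
  have "hausdorff_content s \<delta> (f ` A) \<le> ennreal (r powr s) * hausdorff_content s \<delta> A"
  proof -
    have le: "hausdorff_content s \<delta> (f ` A) \<le> ennreal (r powr s) * (\<Sum>i. ennreal (diameter (U i) powr s))"
      if U: "A \<subseteq> (\<Union>i. U i)" "\<And>i. bounded (U i)" "\<And>i. diameter (U i) \<le> \<delta>" for U :: "nat \<Rightarrow> 'a set"
    proof -
      have d0: "0 \<le> diameter (U i)" for i
        using U(2) diameter_ge_0 by blast
      have d: "diameter (f ` U i) \<le> r * diameter (U i)" for i
      proof (cases "U i = {}")
        case False
        have "dist x y \<le> r * diameter (U i)" if "x \<in> f ` U i" "y \<in> f ` U i" for x y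
          using f r U(2) that by (auto intro!: mult_left_mono diameter_bounded_bound)
        with False show ?thesis
          unfolding diameter_def[of "f ` U i"] by (auto intro!: cSUP_least)
      qed simp
      have b: "bounded (f ` U i)" for i
      proof -
        obtain x e where "\<And>y. y \<in> U i \<Longrightarrow> dist x y \<le> e"
          using U(2)[of i] by (auto simp: bounded_def)
        then have "\<And>y. y \<in> f ` U i \<Longrightarrow> dist (f x) y \<le> r * e"
          using f r by (auto intro: mult_left_mono)
        then show ?thesis
          by (auto simp: bounded_def)
      qed
      have "hausdorff_content s \<delta> (f ` A) \<le> (\<Sum>i. ennreal (diameter (f ` U i) powr s))"
      proof (rule hausdorff_content_le[OF _ b])
        show "f ` A \<subseteq> (\<Union>i. f ` U i)"
          using U(1) by blast
        show "diameter (f ` U i) \<le> \<delta>" for i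
          using d[of i] U(3)[of i] d0[of i] r mult_left_le_one_le[of "diameter (U i)" r] by linarith
      qed
      also have "\<dots> \<le> (\<Sum>i. ennreal (r powr s) * ennreal (diameter (U i) powr s))"
      proof (rule suminf_le)
        show "ennreal (diameter (f ` U i) powr s) \<le> ennreal (r powr s) * ennreal (diameter (U i) powr s)" for i
          using d[of i] d0[of i] r \<open>0 \<le> s\<close> diameter_ge_0[OF b[of i]]
          by (simp flip: ennreal_mult powr_mult add: powr_mono2 ennreal_leI)
      qed auto
      finally show ?thesis
        by simp
    qed
    let ?c = "r powr s" and ?X = "hausdorff_content s \<delta> (f ` A)"
    have c: "ennreal (1 / ?c) * ennreal ?c = 1"
      using r by (simp flip: ennreal_mult)
    \<comment> \<open>A quantity below the sum of every cover is below the content, so the factor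
      \<open>?c\<close> is moved to the left before the infimum is taken.\<close>
    have "ennreal (1 / ?c) * ?X \<le> hausdorff_content s \<delta> A"
    proof (rule hausdorff_content_greatest)
      fix U :: "nat \<Rightarrow> 'a set"
      assume U: "A \<subseteq> (\<Union>i. U i)" "\<And>i. bounded (U i)" "\<And>i. diameter (U i) \<le> \<delta>"
      have "ennreal (1 / ?c) * ?X
          \<le> ennreal (1 / ?c) * (ennreal ?c * (\<Sum>i. ennreal (diameter (U i) powr s)))"
        by (rule mult_left_mono[OF le[OF U]]) auto
      also have "\<dots> = ennreal (1 / ?c) * ennreal ?c * (\<Sum>i. ennreal (diameter (U i) powr s))"
        by (simp only: mult.assoc)
      finally show "ennreal (1 / ?c) * ?X \<le> (\<Sum>i. ennreal (diameter (U i) powr s))"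
        by (simp only: c mult_1)
    qed
    then have "ennreal ?c * (ennreal (1 / ?c) * ?X) \<le> ennreal ?c * hausdorff_content s \<delta> A"
      by (rule mult_left_mono) simp
    then show ?thesis
      by (simp only: mult.assoc[symmetric] mult.commute[of "ennreal ?c" "ennreal (1 / ?c)"] c mult_1)
  qed
  also have "\<dots> \<le> ennreal (r powr s) * hausdorff_outer s A"
    by (intro mult_left_mono hausdorff_content_le_outer \<open>0 < \<delta>\<close>) auto
  finally show "hausdorff_content s \<delta> (f ` A) \<le> ennreal (r powr s) * hausdorff_outer s A" .
qed

section \<open>The gasket and its cells\<close>

abbreviation word_map :: "nat list \<Rightarrow> real \<times> real \<Rightarrow> real \<times> real" where
  "word_map w \<equiv> foldr gasket_map w"

definition cell :: "nat list \<Rightarrow> (real \<times> real) set" where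
  "cell w = word_map w ` gasket"

definition hutchinson :: "(real \<times> real) set \<Rightarrow> (real \<times> real) set" where
  "hutchinson A = (\<Union>i\<in>{0, 1, 2}. gasket_map i ` A)"

lemma corner_simps [simp]:
  "corner 0 = (0, 0)" "corner (Suc 0) = (1, 0)" "corner 2 = (1 / 2, sqrt 3 / 2)"
  by (simp_all add: corner_def)

lemma dist_gasket_map: "dist (gasket_map i x) (gasket_map i y) = 1 / 2 * dist x y"
proof -
  have "gasket_map i x - gasket_map i y = (1 / 2) *\<^sub>R (x - y)"
    by (simp add: gasket_map_def algebra_simps)
  then show ?thesis
    by (simp add: dist_norm)
qed

lemma dist_word_map: "dist (word_map w x) (word_map w y) = (1 / 2) ^ length w * dist x y"
  by (induction w) (auto simp: dist_gasket_map)

lemma inj_word_map: "inj (word_map w)"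
proof (rule injI)
  fix x y assume "word_map w x = word_map w y"
  then show "x = y"
    using dist_word_map[of w x y] by simp
qed

lemma continuous_on_word_map: "continuous_on A (word_map w)"
proof (rule continuous_on_subset[OF _ subset_UNIV])
  have "continuous_on UNIV (gasket_map i)" for i
    unfolding gasket_map_def by (intro continuous_intros)
  then show "continuous_on UNIV (word_map w)"
    by (induction w) (auto simp: id_def comp_def intro: continuous_on_compose2)
qed

lemma words_0 [simp]: "words 0 = {[]}"
  by (auto simp: words_def)

lemma finite_words [simp]: "finite (words n)"
  and card_words: "card (words n) = 3 ^ n"
proof -
  have eq: "words n = {w. set w \<subseteq> {0, 1, 2} \<and> length w = n}"
    by (auto simp: words_def)
  show "finite (words n)" "card (words n) = 3 ^ n"
    unfolding eq by (auto simp: finite_lists_length_eq card_lists_length_eq eval_nat_numeral)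
qed

lemma length_words: "w \<in> words n \<Longrightarrow> length w = n"
  by (simp add: words_def)

lemma words_append: "w \<in> words n \<Longrightarrow> v \<in> words m \<Longrightarrow> w @ v \<in> words (n + m)"
  by (auto simp: words_def)

lemma words_Cons: "i \<in> {0, 1, 2} \<Longrightarrow> w \<in> words n \<Longrightarrow> i # w \<in> words (Suc n)"
  by (auto simp: words_def)

lemma words_replicate: "i \<in> {0, 1, 2} \<Longrightarrow> replicate k i \<in> words k"
  by (auto simp: words_def)

lemma take_words: "w \<in> words n \<Longrightarrow> k \<le> n \<Longrightarrow> take k w \<in> words k"
  using set_take_subset[of k w] by (auto simp: words_def)

lemma drop_words: "w \<in> words (n + k) \<Longrightarrow> drop n w \<in> words k"
  using set_drop_subset[of n w] by (auto simp: words_def)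

lemma bij_betw_words_append:
  "bij_betw (\<lambda>(w, v). w @ v) (words n \<times> words k) (words (n + k))"
proof (rule bij_betw_byWitness[where f' = "\<lambda>w. (take n w, drop n w)"])
  show "(\<lambda>w. (take n w, drop n w)) ` words (n + k) \<subseteq> words n \<times> words k"
    by (auto intro: take_words drop_words)
qed (auto simp: length_words words_append)

lemma sum_words_append:
  "(\<Sum>w\<in>words (n + k). f w) = (\<Sum>w\<in>words n. \<Sum>v\<in>words k. f (w @ v))"
  using sum.reindex_bij_betw[OF bij_betw_words_append, of f n k]
  by (simp add: sum.cartesian_product case_prod_unfold)

lemma words_1: "words (Suc 0) = {[0], [1], [2]}"
  by (auto simp: words_def length_Suc_conv)

lemma sum_words_Suc:
  "(\<Sum>w\<in>words (Suc n). f w) = (\<Sum>w\<in>words n. f (w @ [0]) + f (w @ [1]) + f (w @ [2]))"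
  using sum_words_append[of f n "Suc 0"] by (simp add: words_1 add.assoc)

section \<open>Existence and uniqueness of the attractor\<close>

lemma hutchinson_mono: "A \<subseteq> B \<Longrightarrow> hutchinson A \<subseteq> hutchinson B"
  by (auto simp: hutchinson_def)

lemma compact_hutchinson: "compact A \<Longrightarrow> compact (hutchinson A)"
proof -
  assume "compact A"
  then have "compact (gasket_map i ` A)" for i
    unfolding gasket_map_def by (intro compact_continuous_image continuous_intros)
  then show ?thesis
    by (auto simp: hutchinson_def)
qed

lemma word_map_mem_attractor:
  assumes "A = hutchinson A" "w \<in> words n" "x \<in> A"
  shows "word_map w x \<in> A"
proof -
  have "set w \<subseteq> {0, 1, 2}"
    using assms(2) by (simp add: words_def)
  then show ?thesis
  proof (induction w)
    case (Cons i w)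
    then have "gasket_map i (word_map w x) \<in> hutchinson A"
      by (auto simp: hutchinson_def)
    then show ?case
      using assms(1) by simp
  qed (simp add: assms(3))
qed

lemma attractor_word_map:
  assumes "A = hutchinson A" "x \<in> A"
  obtains w y where "w \<in> words n" "y \<in> A" "x = word_map w y"
proof -
  have "\<exists>w y. w \<in> words n \<and> y \<in> A \<and> x = word_map w y"
    using assms(2)
  proof (induction n arbitrary: x)
    case (Suc n)
    then have "x \<in> hutchinson A"
      using assms(1) by simp
    then obtain i y where "i \<in> {0, 1, 2}" "y \<in> A" "x = gasket_map i y"
      by (auto simp: hutchinson_def)
    moreover from Suc.IH[OF \<open>y \<in> A\<close>] obtain w z where "w \<in> words n" "z \<in> A" "y = word_map w z"
      by blast
    ultimately have "i # w \<in> words (Suc n) \<and> z \<in> A \<and> x = word_map (i # w) z"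
      using words_Cons by simp
    then show ?case
      by blast
  qed auto
  then show thesis
    using that by blast
qed

text \<open>A point of \<open>A\<close> is \<open>word_map w y\<close> with \<open>w\<close> of any
  length \<open>n\<close>; replacing \<open>y\<close> by a point of \<open>B\<close> moves it by at
  most a constant times 2^-n. Used in both directions this is the uniqueness of the gasket.\<close>

lemma attractor_subset:
  assumes A: "A = hutchinson A" "compact A" and B: "B = hutchinson B" "compact B" "B \<noteq> {}"
  shows "A \<subseteq> B"
proof
  fix x assume x: "x \<in> A"
  obtain b where b: "b \<in> B"
    using B(3) by blast
  obtain D where D: "\<And>y. y \<in> A \<Longrightarrow> dist b y \<le> D"
    using A(2) compact_imp_bounded bounded_any_center[of A b] by blast
  have "x \<in> closure B"
  proof (rule closure_approachable[THEN iffD2, rule_format])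
    fix e :: real assume "0 < e"
    have "0 \<le> D"
      using D[OF x] zero_le_dist order_trans by blast
    obtain n where n: "(1 / 2) ^ n < e / (D + 1)"
      using real_arch_pow_inv[of "e / (D + 1)" "1 / 2"] \<open>0 < e\<close> \<open>0 \<le> D\<close> by auto
    obtain w y where w: "w \<in> words n" "y \<in> A" "x = word_map w y"
      using attractor_word_map[OF A(1) x] .
    have "dist (word_map w b) x = (1 / 2) ^ n * dist b y"
      using w length_words by (simp add: dist_word_map)
    also have "\<dots> \<le> (1 / 2) ^ n * (D + 1)"
      using D[OF w(2)] by (intro mult_left_mono) auto
    also have "\<dots> < e"
      using n \<open>0 \<le> D\<close> by (simp add: pos_less_divide_eq)
    finally show "\<exists>y\<in>B. dist y x < e"
      using word_map_mem_attractor[OF B(1) w(1) b] by blast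
  qed
  then show "x \<in> B"
    using B(2) compact_imp_closed closure_closed by blast
qed

text \<open>\<open>(lattice_s z, lattice_t z)\<close> are the coordinates of \<open>z\<close> in the basis \<open>p\<^sub>1, p\<^sub>2\<close>, in
  which the corners of the cells of level \<open>n\<close> are the points with coordinates in \<open>2\<^sup>-\<^sup>n \<int>\<close>.\<close>

definition lattice_s :: "real \<times> real \<Rightarrow> real" where
  "lattice_s z = fst z - snd z / sqrt 3"

definition lattice_t :: "real \<times> real \<Rightarrow> real" where
  "lattice_t z = 2 * snd z / sqrt 3"

lemma lattice_corner [simp]:
  "lattice_s (corner 0) = 0" "lattice_s (corner (Suc 0)) = 1" "lattice_s (corner 2) = 0"
  "lattice_t (corner 0) = 0" "lattice_t (corner (Suc 0)) = 0" "lattice_t (corner 2) = 1"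
  by (simp_all add: lattice_s_def lattice_t_def)

lemma lattice_gasket_map:
  "lattice_s (gasket_map i z) = (lattice_s z + lattice_s (corner i)) / 2"
  "lattice_t (gasket_map i z) = (lattice_t z + lattice_t (corner i)) / 2"
  by (simp_all add: lattice_s_def lattice_t_def gasket_map_def add_divide_distrib diff_divide_distrib)

lemma lattice_eqI: "lattice_s x = lattice_s y \<Longrightarrow> lattice_t x = lattice_t y \<Longrightarrow> x = y"
  by (auto simp: lattice_s_def lattice_t_def prod_eq_iff)

text \<open>The sum of the two coordinates is 1 minus the barycentric coordinate at
  \<open>corner 0\<close>, so the three bounds control the three directions of the triangular
  lattice.\<close>

lemma lattice_lipschitz:
  "\<bar>lattice_s x - lattice_s y\<bar> \<le> 2 * dist x y"
  "\<bar>lattice_t x - lattice_t y\<bar> \<le> 2 * dist x y"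
  "\<bar>(lattice_s x + lattice_t x) - (lattice_s y + lattice_t y)\<bar> \<le> 2 * dist x y"
proof -
  define a b where "a = fst x - fst y" and "b = (snd x - snd y) / sqrt 3"
  have a: "\<bar>a\<bar> \<le> dist x y"
    using dist_fst_le[of x y] by (simp add: a_def dist_real_def)
  have "\<bar>b\<bar> \<le> \<bar>snd x - snd y\<bar>"
    by (simp add: b_def abs_divide divide_le_eq mult_le_cancel_left1)
  then have b: "\<bar>b\<bar> \<le> dist x y"
    using dist_snd_le[of x y] by (simp add: dist_real_def)
  have "lattice_s x - lattice_s y = a - b" "lattice_t x - lattice_t y = 2 * b"
    by (simp_all add: a_def b_def lattice_s_def lattice_t_def diff_divide_distrib)
  then show "\<bar>lattice_s x - lattice_s y\<bar> \<le> 2 * dist x y"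
    "\<bar>lattice_t x - lattice_t y\<bar> \<le> 2 * dist x y"
    "\<bar>(lattice_s x + lattice_t x) - (lattice_s y + lattice_t y)\<bar> \<le> 2 * dist x y"
    using a b by linarith+
qed

definition base_triangle :: "(real \<times> real) set" where
  "base_triangle = {z. 0 \<le> lattice_s z \<and> 0 \<le> lattice_t z \<and> lattice_s z + lattice_t z \<le> 1}"

lemma base_triangle_dist:
  assumes "x \<in> base_triangle" "y \<in> base_triangle"
  shows "dist x y \<le> 2"
proof -
  have z: "0 \<le> fst z \<and> fst z \<le> 1 \<and> 0 \<le> snd z \<and> snd z \<le> 1" if "z \<in> base_triangle" for z
  proof -
    have e: "snd z = lattice_t z * (sqrt 3 / 2)" "fst z = lattice_s z + lattice_t z / 2"
      by (simp_all add: lattice_s_def lattice_t_def)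
    have "sqrt 3 \<le> 2"
      by (rule real_le_lsqrt) auto
    then have "lattice_t z * (sqrt 3 / 2) \<le> 1 * 1"
      using that by (intro mult_mono) (auto simp: base_triangle_def)
    then show ?thesis
      unfolding e using that by (auto simp: base_triangle_def)
  qed
  have "dist x y \<le> \<bar>fst x - fst y\<bar> + \<bar>snd x - snd y\<bar>"
    unfolding dist_prod_def dist_real_def
    using sqrt_sum_squares_le_sum_abs[of "\<bar>fst x - fst y\<bar>" "\<bar>snd x - snd y\<bar>"] by simp
  then show ?thesis
    using z[OF assms(1)] z[OF assms(2)] by linarith
qed

lemma compact_base_triangle: "compact base_triangle"
proof -
  have "closed base_triangle"
    unfolding base_triangle_def lattice_s_def lattice_t_def
    by (intro closed_Collect_conj closed_Collect_le continuous_intros) auto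
  moreover have "bounded base_triangle"
    using base_triangle_dist unfolding bounded_def by (meson ex_in_conv)
  ultimately show ?thesis
    by (simp add: compact_eq_bounded_closed)
qed

lemma hutchinson_base_triangle: "hutchinson base_triangle \<subseteq> base_triangle"
  by (auto simp: hutchinson_def base_triangle_def lattice_gasket_map field_simps simp del: corner_simps)

lemma gasket_map_corner: "gasket_map i (corner i) = corner i"
  by (simp add: gasket_map_def flip: scaleR_2)

text \<open>Decreasing approximations starting from the filled triangle; their intersection is the
  existence half of the definite description \<open>gasket\<close>.\<close>

definition prefractal :: "nat \<Rightarrow> (real \<times> real) set" where
  "prefractal n = (hutchinson ^^ n) base_triangle"

lemma prefractal_Suc: "prefractal (Suc n) = hutchinson (prefractal n)"
  by (simp add: prefractal_def)

lemma compact_prefractal: "compact (prefractal n)"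
  by (induction n) (auto simp: prefractal_Suc compact_hutchinson compact_base_triangle prefractal_def[of 0])

lemma decseq_prefractal: "decseq prefractal"
proof (rule decseq_SucI)
  show "prefractal (Suc n) \<subseteq> prefractal n" for n
  proof (induction n)
    case 0
    then show ?case
      using hutchinson_base_triangle by (simp add: prefractal_def)
  next
    case (Suc n)
    then show ?case
      unfolding prefractal_Suc by (rule hutchinson_mono)
  qed
qed

lemma corner_mem_prefractal: "i \<in> {0, 1, 2} \<Longrightarrow> corner i \<in> prefractal n"
proof (induction n)
  case 0
  then show ?case
    by (auto simp: prefractal_def base_triangle_def simp del: corner_simps)
next
  case (Suc n)
  then have "gasket_map i (corner i) \<in> hutchinson (prefractal n)"
    unfolding hutchinson_def by blast
  then show ?case
    by (simp add: prefractal_Suc gasket_map_corner)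
qed

text \<open>For the inclusion into \<open>hutchinson\<close>, every level needs one of three maps;
  as the sets decrease, one map serves all levels. Its injectivity makes the preimages at different
  levels coincide.\<close>

lemma hutchinson_INT_prefractal: "(\<Inter>n. prefractal n) = hutchinson (\<Inter>n. prefractal n)"
proof
  show "hutchinson (\<Inter>n. prefractal n) \<subseteq> (\<Inter>n. prefractal n)"
  proof
    fix x assume x: "x \<in> hutchinson (\<Inter>n. prefractal n)"
    have "x \<in> prefractal n" for n
    proof -
      have "x \<in> prefractal (Suc n)"
        using x hutchinson_mono[of "\<Inter>n. prefractal n" "prefractal n"]
        unfolding prefractal_Suc by blast
      then show ?thesis
        using decseq_SucD[OF decseq_prefractal] by blast
    qed
    then show "x \<in> (\<Inter>n. prefractal n)"
      by blast
  qed
  show "(\<Inter>n. prefractal n) \<subseteq> hutchinson (\<Inter>n. prefractal n)"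
  proof
    fix x assume x: "x \<in> (\<Inter>n. prefractal n)"
    have "\<exists>i\<in>{0, 1, 2}. \<forall>n. x \<in> gasket_map i ` prefractal n"
    proof (rule ccontr)
      assume "\<not> ?thesis"
      then obtain m where m: "\<And>i. i \<in> {0, 1, 2} \<Longrightarrow> x \<notin> gasket_map i ` prefractal (m i)"
        by metis
      define N where "N = Max (m ` {0, 1, 2})"
      have "x \<in> prefractal (Suc N)"
        using x by blast
      then obtain i where i: "i \<in> {0, 1, 2}" "x \<in> gasket_map i ` prefractal N"
        by (auto simp: prefractal_Suc hutchinson_def)
      have "m i \<le> N"
        unfolding N_def using i(1) by (intro Max_ge) auto
      then have "prefractal N \<subseteq> prefractal (m i)"
        using decseq_prefractal by (simp add: decseq_def)
      then show False
        using m[OF i(1)] i(2) by blast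
    qed
    then obtain i where i: "i \<in> {0, 1, 2}" "\<And>n. x \<in> gasket_map i ` prefractal n"
      by blast
    obtain z where z: "x = gasket_map i z"
      using i(2) by blast
    have "z \<in> prefractal n" for n
    proof -
      obtain z' where "z' \<in> prefractal n" "x = gasket_map i z'"
        using i(2) by blast
      moreover have "z' = z"
        using z calculation(2) dist_gasket_map[of i z z'] by simp
      ultimately show ?thesis
        by simp
    qed
    then show "x \<in> hutchinson (\<Inter>n. prefractal n)"
      using i(1) z by (auto simp: hutchinson_def)
  qed
qed

lemma gasket_eq: "gasket = (\<Inter>n. prefractal n)"
proof -
  let ?K = "\<Inter>n. prefractal n"
  have K: "?K \<noteq> {}" "compact ?K"
    using corner_mem_prefractal[of 0] compact_prefractal by (auto intro: compact_Inter)
  have "K = ?K" if "K \<noteq> {} \<and> compact K \<and> K = (\<Union>i\<in>{0, 1, 2}. gasket_map i ` K)" for K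
  proof (rule subset_antisym)
    have h: "K = hutchinson K"
      using that unfolding hutchinson_def by blast
    show "K \<subseteq> ?K"
      using that K by (intro attractor_subset[OF h _ hutchinson_INT_prefractal]) auto
    show "?K \<subseteq> K"
      using that K by (intro attractor_subset[OF hutchinson_INT_prefractal _ h]) auto
  qed
  then show ?thesis
    unfolding gasket_def
    by (intro the_equality conjI K hutchinson_INT_prefractal[unfolded hutchinson_def])
qed

section \<open>Cells of the gasket\<close>

lemma gasket_hutchinson: "gasket = hutchinson gasket"
  unfolding gasket_eq by (rule hutchinson_INT_prefractal)

lemma compact_gasket: "compact gasket"
  unfolding gasket_eq using compact_prefractal by (auto intro: compact_Inter)

lemma corner_mem_gasket: "i \<in> {0, 1, 2} \<Longrightarrow> corner i \<in> gasket"
  unfolding gasket_eq using corner_mem_prefractal by blast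

lemma gasket_subset_base_triangle: "gasket \<subseteq> base_triangle"
  unfolding gasket_eq by (auto simp: prefractal_def dest!: spec[of _ 0])

lemma word_map_mem_gasket: "w \<in> words n \<Longrightarrow> x \<in> gasket \<Longrightarrow> word_map w x \<in> gasket"
  by (rule word_map_mem_attractor[OF gasket_hutchinson])

lemma cell_subset: "w \<in> words n \<Longrightarrow> cell w \<subseteq> gasket"
  unfolding cell_def using word_map_mem_gasket by blast

lemma cell_Nil [simp]: "cell [] = gasket"
  by (simp add: cell_def)

lemma compact_cell: "compact (cell w)"
  unfolding cell_def by (intro compact_continuous_image continuous_on_word_map compact_gasket)

lemma cell_append_subset: "v \<in> words k \<Longrightarrow> cell (w @ v) \<subseteq> cell w"
  unfolding cell_def using word_map_mem_gasket by auto

lemma cell_eq_UN: "cell w = (\<Union>v\<in>words k. cell (w @ v))"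
proof
  show "(\<Union>v\<in>words k. cell (w @ v)) \<subseteq> cell w"
    using cell_append_subset by blast
  show "cell w \<subseteq> (\<Union>v\<in>words k. cell (w @ v))"
  proof
    fix x assume "x \<in> cell w"
    then obtain y where y: "y \<in> gasket" "x = word_map w y"
      by (auto simp: cell_def)
    obtain v z where "v \<in> words k" "z \<in> gasket" "y = word_map v z"
      using attractor_word_map[OF gasket_hutchinson y(1)] .
    then show "x \<in> (\<Union>v\<in>words k. cell (w @ v))"
      using y(2) by (auto simp: cell_def)
  qed
qed

lemma gasket_eq_UN: "gasket = (\<Union>w\<in>words n. cell w)"
  using cell_eq_UN[of "[]" n] by simp

lemma mem_cell_extend:
  assumes "x \<in> cell w"
  obtains i where "i \<in> {0, 1, 2}" "x \<in> cell (w @ [i])"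
  using assms cell_eq_UN[of w "Suc 0"] by (auto simp: words_1)

lemma dist_cell:
  assumes "x \<in> cell w" "y \<in> cell w"
  shows "dist x y \<le> 2 * (1 / 2) ^ length w"
proof -
  obtain a b where "a \<in> gasket" "b \<in> gasket" "x = word_map w a" "y = word_map w b"
    using assms by (auto simp: cell_def)
  then show ?thesis
    using base_triangle_dist[of a b] gasket_subset_base_triangle by (auto simp: dist_word_map)
qed

lemma cell_vertices_eq: "cell_vertices w = {word_map w (corner 0), word_map w (corner 1), word_map w (corner 2)}"
  by (auto simp: cell_vertices_def simp del: corner_simps)

lemma finite_cell_vertices [simp]: "finite (cell_vertices w)"
  by (simp add: cell_vertices_def)

lemma cell_vertices_subset: "cell_vertices w \<subseteq> cell w"
  unfolding cell_vertices_def cell_def using corner_mem_gasket by blast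

text \<open>The cell of \<open>w\<close> is the cell of level 0 scaled by \<open>2\<^sup>-\<^sup>n\<close>, with its corner \<open>p\<^sub>0\<close> moved to the point
  with lattice coordinates \<open>2\<^sup>-\<^sup>n (digit_value 1 w, digit_value 2 w)\<close>.\<close>

fun digit_value :: "nat \<Rightarrow> nat list \<Rightarrow> int" where
  "digit_value c [] = 0"
| "digit_value c (i # w) = (if i = c then 2 ^ length w else 0) + digit_value c w"

lemma lattice_word_map:
  assumes "w \<in> words n"
  shows "lattice_s (word_map w z) = (digit_value 1 w + lattice_s z) / 2 ^ n"
    and "lattice_t (word_map w z) = (digit_value 2 w + lattice_t z) / 2 ^ n"
proof -
  have "lattice_s (word_map w z) = (digit_value 1 w + lattice_s z) / 2 ^ length w \<and>
        lattice_t (word_map w z) = (digit_value 2 w + lattice_t z) / 2 ^ length w"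
    if "set w \<subseteq> {0, 1, 2}"
    using that by (induction w) (auto simp: lattice_gasket_map field_simps simp del: corner_simps)
  then show "lattice_s (word_map w z) = (digit_value 1 w + lattice_s z) / 2 ^ n"
    "lattice_t (word_map w z) = (digit_value 2 w + lattice_t z) / 2 ^ n"
    using assms by (auto simp: words_def)
qed

lemma digit_value_bounds: "0 \<le> digit_value c w" "digit_value c w < 2 ^ length w"
  by (induction w) auto

text \<open>The two values are binary numbers whose digits mark the letters 1 and 2. The remaining
  digits stay below \<open>2 ^ length w\<close> and cannot compensate for a leading digit, so the
  letters are recovered one by one.\<close>

lemma digit_value_inj:
  assumes "w \<in> words n" "v \<in> words n"
    and "digit_value 1 w = digit_value 1 v" "digit_value 2 w = digit_value 2 v"
  shows "w = v"
proof -
  have "w = v" if "length w = length v" "set w \<subseteq> {0, 1, 2}" "set v \<subseteq> {0, 1, 2}"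
      "digit_value 1 w = digit_value 1 v" "digit_value 2 w = digit_value 2 v" for w v
    using that
  proof (induction w v rule: list_induct2)
    case (Cons i w j v)
    note b = digit_value_bounds[of _ w] digit_value_bounds[of _ v]
    have eq: "i = c \<longleftrightarrow> j = c" if "c \<in> {1, 2}" for c
    proof -
      have less: "i = c \<longleftrightarrow> j = c"
        if "(if i = c then N else 0) + a = (if j = c then N else 0) + b"
          "0 \<le> a" "a < N" "0 \<le> b" "b < N" for a b N :: int
        using that by (auto split: if_splits)
      have "digit_value c (i # w) = digit_value c (j # v)"
        using that Cons.prems(3,4) by auto
      then show ?thesis
        using b[of c] Cons.hyps
        by (intro less[of "2 ^ length w" "digit_value c w" "digit_value c v"])
           (simp_all only: digit_value.simps)
    qed
    have "i \<in> {0, 1, 2}" "j \<in> {0, 1, 2}" "i = 1 \<longleftrightarrow> j = 1" "i = 2 \<longleftrightarrow> j = 2"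
      using Cons.prems(1,2) by (simp_all add: eq)
    then have "i = j"
      by blast
    moreover have "digit_value 1 w = digit_value 1 v" "digit_value 2 w = digit_value 2 v"
      using Cons.prems(3,4) Cons.hyps \<open>i = j\<close> by (auto split: if_splits)
    ultimately show ?case
      using Cons.IH Cons.prems(1,2) by simp
  qed auto
  then show ?thesis
    using assms by (simp add: words_def)
qed

section \<open>Adjacency of cells\<close>

text \<open>A condition on integers rather than on intersections of cells: the digit vectors are
  equal or neighbours in the triangular lattice. The third inequality excludes the differences (1,
  1) and (-1, -1).\<close>

definition adjacent :: "nat list \<Rightarrow> nat list \<Rightarrow> bool" where
  "adjacent w v \<longleftrightarrow> \<bar>digit_value 1 w - digit_value 1 v\<bar> \<le> 1 \<and> \<bar>digit_value 2 w - digit_value 2 v\<bar> \<le> 1 \<and>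
     \<bar>(digit_value 1 w + digit_value 2 w) - (digit_value 1 v + digit_value 2 v)\<bar> \<le> 1"

lemma adjacent_refl [simp]: "adjacent w w"
  by (simp add: adjacent_def)

lemma adjacent_sym: "adjacent w v \<longleftrightarrow> adjacent v w"
  by (auto simp: adjacent_def)

text \<open>After scaling by \<open>2 ^ n\<close> the local coordinates of both points lie in
  [0, 1]. If the points were closer, all three integer differences would be below 2 in absolute
  value, hence at most 1.\<close>

lemma not_adjacent_dist:
  assumes wv: "w \<in> words n" "v \<in> words n" and na: "\<not> adjacent w v"
    and x: "x \<in> cell w" and y: "y \<in> cell v"
  shows "(1 / 2) ^ n / 2 \<le> dist x y"
proof -
  obtain a b where a: "a \<in> base_triangle" "x = word_map w a" and b: "b \<in> base_triangle" "y = word_map v b"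
    using x y gasket_subset_base_triangle unfolding cell_def by blast
  let ?D = "2 ^ n * (2 * dist x y)"
  have sc: "\<bar>p - q\<bar> \<le> ?D" if "\<bar>p / 2 ^ n - q / 2 ^ n\<bar> \<le> 2 * dist x y" for p q :: real
    using that by (simp add: abs_divide divide_le_eq mult.commute flip: diff_divide_distrib)
  have 1: "\<bar>(digit_value 1 w + lattice_s a) - (digit_value 1 v + lattice_s b)\<bar> \<le> ?D"
    using lattice_lipschitz(1)[of x y] a b wv by (intro sc) (simp add: lattice_word_map)
  have 2: "\<bar>(digit_value 2 w + lattice_t a) - (digit_value 2 v + lattice_t b)\<bar> \<le> ?D"
    using lattice_lipschitz(2)[of x y] a b wv by (intro sc) (simp add: lattice_word_map)
  have 3: "\<bar>((digit_value 1 w + lattice_s a) + (digit_value 2 w + lattice_t a)) -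
      ((digit_value 1 v + lattice_s b) + (digit_value 2 v + lattice_t b))\<bar> \<le> ?D"
    using lattice_lipschitz(3)[of x y] a b wv
    by (intro sc) (simp add: lattice_word_map add_divide_distrib)
  have "1 \<le> ?D"
  proof (rule ccontr)
    assume "\<not> 1 \<le> ?D"
    with 1 2 3 a(1) b(1)
    have "\<bar>real_of_int (digit_value 1 w - digit_value 1 v)\<bar> < 2"
      "\<bar>real_of_int (digit_value 2 w - digit_value 2 v)\<bar> < 2"
      "\<bar>real_of_int ((digit_value 1 w + digit_value 2 w) - (digit_value 1 v + digit_value 2 v))\<bar> < 2"
      unfolding base_triangle_def by auto
    then have "adjacent w v"
      unfolding adjacent_def by linarith
    with na show False
      by simp
  qed
  then show ?thesis
    by (simp add: power_divide field_simps)
qed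

definition lattice_steps :: "(int \<times> int) set" where
  "lattice_steps = {(0, 0), (1, 0), (-1, 0), (0, 1), (0, -1), (1, -1), (-1, 1)}"

lemma lattice_stepsI:
  assumes "\<bar>d\<bar> \<le> 1" "\<bar>e\<bar> \<le> 1" "\<bar>d + e\<bar> \<le> 1"
  shows "(d, e) \<in> lattice_steps"
proof -
  have "d \<in> {-1, 0, 1}" "e \<in> {-1, 0, 1}"
    using assms(1,2) by auto
  then show ?thesis
    using assms(3) by (auto simp: lattice_steps_def)
qed

text \<open>In lattice coordinates the differences of two corners are exactly the seven elements of
  \<open>lattice_steps\<close>, so the offset of the two cells is compensated by a suitable choice
  of corners.\<close>

lemma adjacent_common_vertex:
  assumes wv: "w \<in> words n" "v \<in> words n" and ad: "adjacent w v"
  obtains p where "p \<in> cell_vertices w" "p \<in> cell_vertices v"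
proof -
  have "\<exists>i\<in>{0, 1, 2}. \<exists>j\<in>{0, 1, 2}. lattice_s (corner i) - lattice_s (corner j) = digit_value 1 v - digit_value 1 w \<and>
      lattice_t (corner i) - lattice_t (corner j) = digit_value 2 v - digit_value 2 w"
  proof -
    define d e where "d = digit_value 1 v - digit_value 1 w" and "e = digit_value 2 v - digit_value 2 w"
    have "\<bar>d\<bar> \<le> 1 \<and> \<bar>e\<bar> \<le> 1 \<and> \<bar>d + e\<bar> \<le> 1"
      using ad unfolding adjacent_def d_def e_def by linarith
    then have "(d, e) \<in> lattice_steps"
      by (intro lattice_stepsI) auto
    then show ?thesis
      unfolding d_def[symmetric] e_def[symmetric] lattice_steps_def
      by (elim insertE emptyE Pair_inject) (simp_all del: corner_simps)
  qed
  then obtain i j where ij: "i \<in> {0, 1, 2}" "j \<in> {0, 1, 2}"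
      "lattice_s (corner i) - lattice_s (corner j) = digit_value 1 v - digit_value 1 w"
      "lattice_t (corner i) - lattice_t (corner j) = digit_value 2 v - digit_value 2 w"
    by blast
  have "word_map w (corner i) = word_map v (corner j)"
    by (rule lattice_eqI; unfold lattice_word_map[OF wv(1)] lattice_word_map[OF wv(2)])
       (use ij in \<open>auto simp: field_simps simp del: corner_simps\<close>)
  then show thesis
    using ij that[of "word_map w (corner i)"] unfolding cell_vertices_def by blast
qed

lemma card_adjacent:
  assumes "w \<in> words n"
  shows "card {v \<in> words n. adjacent w v} \<le> 7"
proof -
  let ?f = "\<lambda>v. (digit_value 1 v - digit_value 1 w, digit_value 2 v - digit_value 2 w)"
  have "inj_on ?f {v \<in> words n. adjacent w v}"
    by (auto intro!: inj_onI digit_value_inj)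
  moreover have "?f ` {v \<in> words n. adjacent w v} \<subseteq> lattice_steps"
  proof
    fix z assume "z \<in> ?f ` {v \<in> words n. adjacent w v}"
    then obtain v where v: "adjacent w v" "z = ?f v"
      by blast
    then show "z \<in> lattice_steps"
      unfolding v(2) adjacent_def by (intro lattice_stepsI) linarith+
  qed
  ultimately have "card {v \<in> words n. adjacent w v} \<le> card lattice_steps"
    by (intro card_inj_on_le) (auto simp: lattice_steps_def)
  then show ?thesis
    by (simp add: lattice_steps_def)
qed

text \<open>All cells meeting \<open>A\<close> are adjacent to any fixed one of them, and there is
  at most one adjacent cell per lattice step.\<close>

lemma card_cells_near:
  assumes near: "\<And>x y. x \<in> A \<Longrightarrow> y \<in> A \<Longrightarrow> dist x y < (1 / 2) ^ n / 2"
  shows "card {w \<in> words n. cell w \<inter> A \<noteq> {}} \<le> 7"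
proof (cases "{w \<in> words n. cell w \<inter> A \<noteq> {}} = {}")
  case True
  then show ?thesis
    by (simp only: card.empty)
next
  case False
  then obtain w x where w: "w \<in> words n" "x \<in> cell w" "x \<in> A"
    by blast
  have "{w \<in> words n. cell w \<inter> A \<noteq> {}} \<subseteq> {v \<in> words n. adjacent w v}"
  proof safe
    fix v y assume v: "v \<in> words n" "y \<in> cell v" "y \<in> A"
    then show "adjacent w v"
      using near[OF w(3) v(3)] not_adjacent_dist[OF w(1) v(1) _ w(2) v(2)] by linarith
  qed
  then have "card {w \<in> words n. cell w \<inter> A \<noteq> {}} \<le> card {v \<in> words n. adjacent w v}"
    by (intro card_mono) auto
  then show ?thesis
    using card_adjacent[OF w(1)] by simp
qed

section \<open>The self-similar measure\<close>

lemma gasket_dim_pos: "0 < gasket_dim"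
  by (simp add: gasket_dim_def)

lemma two_powr_gasket_dim: "2 powr gasket_dim = 3"
  by (simp add: gasket_dim_def powr_def)

lemma half_power_powr:
  fixes s :: real
  shows "((1 / 2) ^ n) powr s = (1 / (2 powr s)) ^ n"
proof -
  have "((1 / 2 :: real) ^ Suc n) powr s = (1 / 2) powr s * ((1 / 2) ^ n) powr s" for n
    unfolding power_Suc by (rule powr_mult)
  moreover have "(1 / 2 :: real) powr s = 1 / (2 powr s)"
    by (simp add: powr_divide)
  ultimately show ?thesis
    by (induction n) (simp_all del: power_Suc add: power_Suc[of "1 / (2 powr s)"])
qed

lemma half_power_powr_gasket_dim: "((1 / 2) ^ n) powr gasket_dim = (1 / 3) ^ n"
  by (simp only: half_power_powr two_powr_gasket_dim)

section \<open>The Hausdorff measure of the gasket is finite and positive\<close>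

lemma outer_measure_space_hausdorff_content:
  fixes s :: real
  assumes "0 \<le> \<delta>"
  shows "outer_measure_space UNIV (hausdorff_content s \<delta> :: 'a::metric_space set \<Rightarrow> ennreal)"
  using assms unfolding outer_measure_space_def
  by (auto simp: positive_def increasing_def countably_subadditive_def hausdorff_content_empty
      intro: hausdorff_content_mono hausdorff_content_UN_le)

text \<open>The \<open>3 ^ n\<close> cells of level \<open>n\<close> form a cover, and each
  contributes at most \<open>(2 / 2 ^ n) powr gasket_dim = 3 / 3 ^ n\<close>.\<close>

lemma hausdorff_outer_gasket_le: "hausdorff_outer gasket_dim gasket \<le> 3"
proof (rule hausdorff_outer_least)
  fix \<delta> :: real assume \<delta>: "0 < \<delta>"
  obtain n where n: "(1 / 2) ^ n < \<delta> / 2"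
    using real_arch_pow_inv[of "\<delta> / 2" "1 / 2"] \<delta> by auto
  have cell: "hausdorff_content gasket_dim \<delta> (cell w) \<le> ennreal (3 * (1 / 3) ^ n)"
    if "w \<in> words n" for w
  proof -
    have b: "bounded (cell w)"
      by (rule compact_imp_bounded[OF compact_cell])
    have ne: "cell w \<noteq> {}"
      using cell_vertices_subset[of w] by (auto simp: cell_vertices_def)
    have d: "diameter (cell w) \<le> 2 * (1 / 2) ^ n"
      using dist_cell[of _ w] ne length_words[OF that]
      unfolding diameter_def by (auto intro!: cSUP_least)
    have "hausdorff_content gasket_dim \<delta> (cell w) \<le> ennreal (diameter (cell w) powr gasket_dim)"
      using d n by (intro hausdorff_content_bounded_le b) auto
    also have "\<dots> \<le> ennreal ((2 * (1 / 2) ^ n) powr gasket_dim)"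
      using d gasket_dim_pos diameter_ge_0[OF b] by (intro ennreal_leI powr_mono2) auto
    also have "(2 * (1 / 2) ^ n) powr gasket_dim = 3 * (1 / 3) ^ n"
      by (simp add: powr_mult two_powr_gasket_dim half_power_powr_gasket_dim)
    finally show ?thesis .
  qed
  have "hausdorff_content gasket_dim \<delta> gasket \<le> (\<Sum>w\<in>words n. hausdorff_content gasket_dim \<delta> (cell w))"
    unfolding gasket_eq_UN[of n] using \<delta>
    by (intro outer_measure_space_finite_subadditive outer_measure_space_hausdorff_content) auto
  also have "\<dots> \<le> (\<Sum>w\<in>words n. ennreal (3 * (1 / 3) ^ n))"
    by (intro sum_mono cell)
  also have "\<dots> = ennreal (\<Sum>w\<in>words n. 3 * (1 / 3) ^ n)"
    by (rule sum_ennreal) auto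
  also have "(\<Sum>w\<in>words n. 3 * (1 / 3) ^ n) = (3 :: real)"
    by (simp add: card_words power_divide)
  finally show "hausdorff_content gasket_dim \<delta> gasket \<le> 3"
    by simp
qed

text \<open>The counting argument: a set of diameter below \<open>2\<^sup>-\<^sup>k / 2\<close> meets at most 7 of the \<open>3\<^sup>k\<close> cells of
  level \<open>k\<close>, so a cover by such sets needs \<open>\<Sum> 3\<^sup>-\<^sup>k \<ge> 1 / 7\<close>. Replacing each set by the open complement
  of the cells it misses reduces to finite covers.\<close>

lemma gasket_cover_count:
  fixes U :: "nat \<Rightarrow> (real \<times> real) set" and k :: "nat \<Rightarrow> nat"
  assumes cov: "gasket \<subseteq> (\<Union>i. U i)"
    and small: "\<And>i x y. x \<in> U i \<Longrightarrow> y \<in> U i \<Longrightarrow> dist x y < (1 / 2) ^ k i / 2"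
  obtains I where "finite I" "1 \<le> 7 * (\<Sum>i\<in>I. (1 / 3 :: real) ^ k i)"
proof -
  define H where "H i = {w \<in> words (k i). cell w \<inter> U i \<noteq> {}}" for i
  define V where "V i = - (\<Union>w\<in>words (k i) - H i. cell w)" for i
  have "open (V i)" for i
    unfolding V_def
    by (intro open_Compl closed_UN ballI compact_imp_closed compact_cell) auto
  moreover have UV: "U i \<subseteq> V i" for i
    unfolding V_def H_def by blast
  have "gasket \<subseteq> (\<Union>i\<in>UNIV. V i)"
  proof
    fix x assume "x \<in> gasket"
    then obtain i where "x \<in> U i"
      using cov by blast
    then show "x \<in> (\<Union>i\<in>UNIV. V i)"
      using UV[of i] by blast
  qed
  ultimately obtain I where I: "finite I" "gasket \<subseteq> (\<Union>i\<in>I. V i)"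
    using compactE_image[OF compact_gasket, of UNIV V] by auto
  \<comment> \<open>A common level deep enough for the finite cover; the sum is merely a convenient
    upper bound of the \<open>k i\<close>.\<close>
  define N where "N = (\<Sum>i\<in>I. k i)"
  have kN: "k i \<le> N" if "i \<in> I" for i
    unfolding N_def using I(1) that by (intro member_le_sum) auto
  have "words N \<subseteq> (\<Union>i\<in>I. (\<lambda>(u, v). u @ v) ` (H i \<times> words (N - k i)))"
  proof
    fix w assume w: "w \<in> words N"
    \<comment> \<open>A single point of the cell suffices: if it lies in \<open>V i\<close>, then
      the cell of the prefix of length \<open>k i\<close> is not among those removed, so
      \<open>U i\<close> meets it.\<close>
    define x where "x = word_map w (corner 0)"
    have "x \<in> gasket"
      unfolding x_def using w corner_mem_gasket[of 0] by (intro word_map_mem_gasket) auto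
    then obtain i where i: "i \<in> I" "x \<in> V i"
      using I(2) by blast
    have t: "take (k i) w \<in> words (k i)" "drop (k i) w \<in> words (N - k i)"
      using w kN[OF i(1)] by (auto intro: take_words drop_words)
    have "x \<in> cell w"
      unfolding x_def cell_def using corner_mem_gasket[of 0] by blast
    also have "\<dots> \<subseteq> cell (take (k i) w)"
      using cell_append_subset[OF t(2), of "take (k i) w"] by simp
    finally have "take (k i) w \<in> H i"
      using i(2) t(1) by (auto simp: V_def)
    then have "(take (k i) w, drop (k i) w) \<in> H i \<times> words (N - k i)"
      using t(2) by simp
    then have "take (k i) w @ drop (k i) w \<in> (\<lambda>(u, v). u @ v) ` (H i \<times> words (N - k i))"
      by (rule image_eqI[rotated]) simp
    with i(1) show "w \<in> (\<Union>i\<in>I. (\<lambda>(u, v). u @ v) ` (H i \<times> words (N - k i)))"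
      by auto
  qed
  moreover have finH: "finite (H i)" for i
    by (simp add: H_def)
  ultimately have "card (words N) \<le> card (\<Union>i\<in>I. (\<lambda>(u, v). u @ v) ` (H i \<times> words (N - k i)))"
    using I(1) by (intro card_mono) auto
  also have "\<dots> \<le> (\<Sum>i\<in>I. card ((\<lambda>(u, v). u @ v) ` (H i \<times> words (N - k i))))"
    using I(1) by (rule card_UN_le)
  also have "\<dots> \<le> (\<Sum>i\<in>I. 7 * 3 ^ (N - k i))"
  proof (rule sum_mono)
    fix i
    have "card ((\<lambda>(u, v). u @ v) ` (H i \<times> words (N - k i))) \<le> card (H i \<times> words (N - k i))"
      using finH by (intro card_image_le) auto
    also have "\<dots> = card (H i) * 3 ^ (N - k i)"
      by (simp add: card_cartesian_product card_words)
    also have "card (H i) \<le> 7"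
      unfolding H_def using small by (rule card_cells_near)
    finally show "card ((\<lambda>(u, v). u @ v) ` (H i \<times> words (N - k i))) \<le> 7 * 3 ^ (N - k i)"
      by simp
  qed
  finally have "(3 :: nat) ^ N \<le> (\<Sum>i\<in>I. 7 * 3 ^ (N - k i))"
    by (simp add: card_words)
  then have "real (3 ^ N) \<le> real (\<Sum>i\<in>I. 7 * 3 ^ (N - k i))"
    by (rule of_nat_mono)
  also have "\<dots> = (\<Sum>i\<in>I. 7 * 3 ^ (N - k i))"
    by simp
  also have "\<dots> = (\<Sum>i\<in>I. 3 ^ N * (7 * (1 / 3) ^ k i))"
  proof (rule sum.cong[OF refl])
    fix i assume "i \<in> I"
    have "(3 :: real) ^ N = 3 ^ (N - k i) * 3 ^ k i"
      unfolding power_add[symmetric] using kN[OF \<open>i \<in> I\<close>] by simp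
    then show "7 * 3 ^ (N - k i) = (3 ^ N * (7 * (1 / 3) ^ k i) :: real)"
      by (simp add: power_divide)
  qed
  also have "\<dots> = 3 ^ N * (7 * (\<Sum>i\<in>I. (1 / 3) ^ k i))"
    by (simp add: sum_distrib_left)
  finally have "1 \<le> 7 * (\<Sum>i\<in>I. (1 / 3 :: real) ^ k i)"
    by simp
  with I(1) show thesis
    by (rule that)
qed

text \<open>\<open>k\<close> is the deepest level with \<open>d < (1 / 2) ^ k / 2\<close>;
  \<open>d < 1 / 2\<close> makes level 0 qualify.\<close>

lemma dyadic_scale:
  fixes d :: real
  assumes "0 < d" "d < 1 / 2"
  obtains k where "d < (1 / 2) ^ k / 2" "(1 / 2) ^ k \<le> 4 * d"
proof -
  define P where "P k \<longleftrightarrow> (1 / 2) ^ Suc k / 2 \<le> d" for k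
  obtain n where "(1 / 2) ^ n < d"
    using real_arch_pow_inv[of d "1 / 2"] assms by auto
  then have "P n"
    using assms(1) unfolding P_def by simp
  define l where "l = (LEAST k. P k)"
  have 1: "P l"
    unfolding l_def using \<open>P n\<close> by (rule LeastI)
  have "d < (1 / 2) ^ l / 2"
  proof (cases l)
    case (Suc j)
    then have "\<not> P j"
      using not_less_Least[of j P] by (simp add: l_def)
    then show ?thesis
      by (simp add: Suc P_def)
  qed (use assms in simp)
  moreover have "(1 / 2) ^ l \<le> 4 * d"
    using 1 unfolding P_def by simp
  ultimately show thesis
    by (rule that)
qed

lemma hausdorff_outer_gasket_pos: "0 < hausdorff_outer gasket_dim gasket"
proof -
  have "ennreal (1 / 126) \<le> hausdorff_content gasket_dim (1 / 4) gasket"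
  proof (rule hausdorff_content_greatest)
    fix U :: "nat \<Rightarrow> (real \<times> real) set"
    assume cov: "gasket \<subseteq> (\<Union>i. U i)" and bd: "\<And>i. bounded (U i)" and di: "\<And>i. diameter (U i) \<le> 1 / 4"
    let ?d = "\<lambda>i. diameter (U i) powr gasket_dim"
    \<comment> \<open>Half of \<open>1 / 7\<close> is spent on the error terms, which leaves
      \<open>(1 / 7 - 1 / 14) / 9 = 1 / 126\<close>.\<close>
    define e :: real where "e = 1 / 14"
    \<comment> \<open>The last term pays for sets of diameter 0, which cost nothing in the Hausdorff
      sum but still need a finite level. The factor 9 is \<open>4 powr gasket_dim\<close>.\<close>
    have "\<exists>k. diameter (U i) < (1 / 2) ^ k / 2 \<and> (1 / 3) ^ k \<le> 9 * ?d i + e * (1 / 2) ^ Suc i" for i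
    proof (cases "diameter (U i) = 0")
      case True
      obtain k where "(1 / 3 :: real) ^ k < e * (1 / 2) ^ Suc i"
        using real_arch_pow_inv[of "e * (1 / 2) ^ Suc i" "1 / 3"] by (auto simp: e_def)
      then show ?thesis
        using True by (intro exI[of _ k]) auto
    next
      case False
      then have "0 < diameter (U i)" "diameter (U i) < 1 / 2"
        using diameter_ge_0[OF bd[of i]] di[of i] by auto
      then obtain k where k: "diameter (U i) < (1 / 2) ^ k / 2" "(1 / 2) ^ k \<le> 4 * diameter (U i)"
        by (rule dyadic_scale)
      have "(1 / 3) ^ k = ((1 / 2) ^ k) powr gasket_dim"
        by (simp add: half_power_powr_gasket_dim)
      also have "\<dots> \<le> (2 * (2 * diameter (U i))) powr gasket_dim"
        using k(2) gasket_dim_pos by (intro powr_mono2) auto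
      also have "\<dots> = 2 powr gasket_dim * (2 powr gasket_dim * ?d i)"
        using diameter_ge_0[OF bd[of i]] by (subst powr_mult; simp; subst powr_mult; simp)
      also have "\<dots> = 9 * ?d i"
        by (simp add: two_powr_gasket_dim)
      also have "\<dots> \<le> 9 * ?d i + e * (1 / 2) ^ Suc i"
        by (simp add: e_def)
      finally show ?thesis
        using k(1) by blast
    qed
    then obtain k where k: "\<And>i. diameter (U i) < (1 / 2) ^ k i / 2"
        "\<And>i. (1 / 3) ^ k i \<le> 9 * ?d i + e * (1 / 2) ^ Suc i"
      by metis
    have "dist x y < (1 / 2) ^ k i / 2" if "x \<in> U i" "y \<in> U i" for i x y
      using k(1)[of i] diameter_bounded_bound[OF bd that] by simp
    then obtain I where I: "finite I" "1 \<le> 7 * (\<Sum>i\<in>I. (1 / 3 :: real) ^ k i)"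
      using gasket_cover_count[OF cov] by metis
    have half: "(\<Sum>i\<in>I. (1 / 2 :: real) ^ Suc i) \<le> 1"
      using sum_le_suminf[of "\<lambda>i. (1 / 2 :: real) ^ Suc i" I] power_half_series I(1)
      by (auto simp: sums_iff)
    have "(\<Sum>i\<in>I. (1 / 3 :: real) ^ k i) \<le> (\<Sum>i\<in>I. 9 * ?d i + e * (1 / 2) ^ Suc i)"
      by (intro sum_mono k(2))
    also have "\<dots> = 9 * (\<Sum>i\<in>I. ?d i) + e * (\<Sum>i\<in>I. (1 / 2) ^ Suc i)"
      by (simp only: sum.distrib sum_distrib_left)
    also have "\<dots> \<le> 9 * (\<Sum>i\<in>I. ?d i) + e * 1"
      using half by (intro add_left_mono mult_left_mono) (auto simp: e_def)
    finally have "1 / 126 \<le> (\<Sum>i\<in>I. ?d i)"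
      using I(2) by (simp add: e_def)
    then have "ennreal (1 / 126) \<le> ennreal (\<Sum>i\<in>I. ?d i)"
      by (rule ennreal_leI)
    also have "\<dots> = (\<Sum>i\<in>I. ennreal (?d i))"
      by (rule sum_ennreal[symmetric]) auto
    also have "\<dots> \<le> (\<Sum>i. ennreal (?d i))"
      using I(1) by (intro sum_le_suminf) auto
    finally show "ennreal (1 / 126) \<le> (\<Sum>i. ennreal (?d i))" .
  qed
  also have "\<dots> \<le> hausdorff_outer gasket_dim gasket"
    by (rule hausdorff_content_le_outer) simp
  finally show ?thesis
    by (rule less_le_trans[rotated]) simp
qed

section \<open>The normalized measure and the mass of the cells\<close>

lemma gasket_borel [measurable]: "gasket \<in> sets borel"
  using compact_gasket by (simp add: borel_compact)

lemma space_gasket_measure [simp]: "space gasket_measure = gasket"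
  by (simp add: gasket_measure_def space_restrict_space)

lemma sets_gasket_measure: "sets gasket_measure = sets (restrict_space borel gasket)"
  by (simp add: gasket_measure_def sets_restrict_space)

lemma sets_gasket_measureI: "A \<in> sets borel \<Longrightarrow> A \<subseteq> gasket \<Longrightarrow> A \<in> sets gasket_measure"
  by (auto simp: sets_gasket_measure sets_restrict_space_iff)

lemma emeasure_gasket_measure:
  assumes "A \<in> sets borel" "A \<subseteq> gasket"
  shows "emeasure gasket_measure A = hausdorff_outer gasket_dim A / hausdorff_outer gasket_dim gasket"
proof -
  let ?R = "restrict_space (hausdorff_measure gasket_dim) gasket :: (real \<times> real) measure"
  have s: "A \<in> sets ?R" "gasket \<in> sets ?R"
    using assms by (auto simp: sets_restrict_space_iff)
  have e: "emeasure ?R B = hausdorff_outer gasket_dim B" if "B \<in> sets borel" "B \<subseteq> gasket" for B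
    using that by (simp add: emeasure_restrict_space emeasure_hausdorff_measure)
  show ?thesis
    unfolding gasket_measure_def using s e assms by (simp add: Int_absorb1)
qed

lemma finite_measure_gasket_measure: "finite_measure gasket_measure"
  and measure_gasket: "measure gasket_measure gasket = 1"
proof -
  let ?h = "hausdorff_outer gasket_dim gasket"
  have "?h < top"
    using hausdorff_outer_gasket_le by (rule le_less_trans) simp
  then have "emeasure gasket_measure gasket = 1"
    using hausdorff_outer_gasket_pos by (simp add: emeasure_gasket_measure ennreal_divide_self)
  then show "finite_measure gasket_measure" "measure gasket_measure gasket = 1"
    by (auto intro!: finite_measureI simp: measure_def)
qed

interpretation gasket_measure: finite_measure gasket_measure
  by (rule finite_measure_gasket_measure)

lemma cell_sets [measurable]: "w \<in> words n \<Longrightarrow> cell w \<in> sets gasket_measure"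
  using cell_subset compact_cell by (intro sets_gasket_measureI borel_compact)

text \<open>Scaling yields the upper bound for every cell. The \<open>3 ^ n\<close> cells cover a
  total mass of 1, so none of them can fall strictly below it.\<close>

lemma measure_cell:
  assumes "w \<in> words n"
  shows "measure gasket_measure (cell w) = (1 / 3) ^ n"
proof (rule ccontr)
  let ?h = "hausdorff_outer gasket_dim gasket"
  have le: "measure gasket_measure (cell v) \<le> (1 / 3) ^ n" if "v \<in> words n" for v
  proof -
    have "hausdorff_outer gasket_dim (cell v) \<le> ennreal (((1 / 2) ^ n) powr gasket_dim) * ?h"
      unfolding cell_def
    proof (rule hausdorff_outer_image_le)
      show "dist (word_map v x) (word_map v y) = (1 / 2) ^ n * dist x y" for x y
        using that by (simp add: dist_word_map length_words)
    qed (use gasket_dim_pos in \<open>auto simp: power_le_one\<close>)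
    then have "emeasure gasket_measure (cell v) \<le> ennreal ((1 / 3) ^ n) * ?h / ?h"
      using that compact_cell cell_subset
      by (simp add: emeasure_gasket_measure borel_compact half_power_powr_gasket_dim divide_right_mono_ennreal)
    also have "\<dots> = ennreal ((1 / 3) ^ n)"
      using hausdorff_outer_gasket_pos le_less_trans[OF hausdorff_outer_gasket_le, of top]
      by (simp add: ennreal_mult_divide_eq)
    finally show ?thesis
      by (simp add: gasket_measure.emeasure_eq_measure)
  qed
  assume "measure gasket_measure (cell w) \<noteq> (1 / 3) ^ n"
  then have "measure gasket_measure (cell w) < (1 / 3) ^ n"
    using le[OF assms] by simp
  then have "(\<Sum>v\<in>words n. measure gasket_measure (cell v)) < (\<Sum>v\<in>words n. (1 / 3) ^ n)"
    using assms le by (intro sum_strict_mono_ex1) auto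
  also have "\<dots> = 1"
    by (simp add: card_words power_divide)
  also have "1 = measure gasket_measure (\<Union>v\<in>words n. cell v)"
    using measure_gasket gasket_eq_UN[of n] by simp
  also have "\<dots> \<le> (\<Sum>v\<in>words n. measure gasket_measure (cell v))"
    by (intro gasket_measure.finite_measure_subadditive_finite) auto
  finally show False
    by simp
qed

lemma emeasure_cell:
  "w \<in> words n \<Longrightarrow> emeasure gasket_measure (cell w) = ennreal ((1 / 3) ^ n)"
  by (simp add: gasket_measure.emeasure_eq_measure measure_cell)

lemma borel_measurable_gasket_measure:
  fixes u :: "real \<times> real \<Rightarrow> 'b::topological_space"
  assumes "continuous_on gasket u"
  shows "u \<in> borel_measurable gasket_measure"
  using borel_measurable_continuous_on_restrict[OF assms]
  by (simp add: measurable_cong_sets[OF sets_gasket_measure refl])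

lemma small_cell:
  assumes "x \<in> gasket" "0 < d"
  obtains n w where "w \<in> words n" "x \<in> cell w" "\<And>y. y \<in> cell w \<Longrightarrow> dist y x < d"
proof -
  obtain n where n: "(1 / 2) ^ n < d / 2"
    using real_arch_pow_inv[of "d / 2" "1 / 2"] assms(2) by auto
  obtain w where w: "w \<in> words n" "x \<in> cell w"
    using assms(1) gasket_eq_UN[of n] by blast
  moreover have "dist y x < d" if "y \<in> cell w" for y
    using dist_cell[OF that w(2)] n length_words[OF w(1)] by simp
  ultimately show thesis
    by (rule that)
qed

text \<open>If the functions differ at \<open>x\<close>, they differ on a whole cell around
  \<open>x\<close>, and cells have positive mass.\<close>

lemma continuous_AE_eq_on_gasket:
  fixes u v :: "real \<times> real \<Rightarrow> real"
  assumes u: "continuous_on gasket u" and v: "continuous_on gasket v"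
    and ae: "AE x in gasket_measure. u x = v x" and x: "x \<in> gasket"
  shows "u x = v x"
proof (rule ccontr)
  assume "u x \<noteq> v x"
  then have pos: "0 < \<bar>u x - v x\<bar>"
    by simp
  have "continuous_on gasket (\<lambda>y. u y - v y)"
    using u v by (intro continuous_intros)
  then obtain d where d: "0 < d" "\<And>y. y \<in> gasket \<Longrightarrow> dist y x < d \<Longrightarrow>
      dist (u y - v y) (u x - v x) < \<bar>u x - v x\<bar>"
    using x pos unfolding continuous_on_iff by blast
  obtain n w where w: "w \<in> words n" "x \<in> cell w" "\<And>y. y \<in> cell w \<Longrightarrow> dist y x < d"
    by (rule small_cell[OF x d(1)]) blast
  obtain N where N: "{y \<in> space gasket_measure. \<not> u y = v y} \<subseteq> N" "emeasure gasket_measure N = 0"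
      "N \<in> sets gasket_measure"
    using AE_E[OF ae] .
  have "u y \<noteq> v y" if "y \<in> cell w" for y
    using d(2)[of y] w(3)[OF that] cell_subset[OF w(1)] that by (auto simp: dist_real_def)
  then have "cell w \<subseteq> N"
    using N(1) cell_subset[OF w(1)] by auto
  then have "emeasure gasket_measure (cell w) \<le> 0"
    using N emeasure_mono[of "cell w" N gasket_measure] by simp
  then show False
    using emeasure_cell[OF w(1)] by simp
qed

section \<open>Graph energies\<close>

definition cell_energy :: "(real \<times> real \<Rightarrow> real) \<Rightarrow> nat list \<Rightarrow> real" where
  "cell_energy u w = (\<Sum>p\<in>cell_vertices w. \<Sum>q\<in>cell_vertices w. (u p - u q)\<^sup>2)"

lemma graph_energy_eq: "graph_energy n u = (\<Sum>w\<in>words n. cell_energy u w)"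
  by (simp add: graph_energy_def cell_energy_def)

lemma cell_energy_nonneg: "0 \<le> cell_energy u w"
  by (simp add: cell_energy_def sum_nonneg)

lemma graph_energy_nonneg: "0 \<le> graph_energy n u"
  by (simp add: graph_energy_eq sum_nonneg cell_energy_nonneg)

lemma cell_energy_le_graph_energy: "w \<in> words n \<Longrightarrow> cell_energy u w \<le> graph_energy n u"
  unfolding graph_energy_eq by (intro member_le_sum cell_energy_nonneg) auto

lemma square_diff_le_cell_energy:
  assumes "p \<in> cell_vertices w" "q \<in> cell_vertices w"
  shows "(u p - u q)\<^sup>2 \<le> cell_energy u w"
proof -
  have "(u p - u q)\<^sup>2 \<le> (\<Sum>q\<in>cell_vertices w. (u p - u q)\<^sup>2)"
    using assms(2) by (intro member_le_sum) auto
  also have "\<dots> \<le> cell_energy u w"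
    unfolding cell_energy_def using assms(1)
    by (intro member_le_sum[of p _ "\<lambda>p. \<Sum>q\<in>cell_vertices w. (u p - u q)\<^sup>2"] sum_nonneg) auto
  finally show ?thesis .
qed

text \<open>Ordered pairs count each side twice. The sum runs over a set of points, so injectivity
  of \<open>word_map w\<close> is used to keep the three corners distinct.\<close>

lemma cell_energy_corners:
  "cell_energy u w = 2 * ((u (word_map w (corner 0)) - u (word_map w (corner 1)))\<^sup>2 +
     (u (word_map w (corner 1)) - u (word_map w (corner 2)))\<^sup>2 +
     (u (word_map w (corner 2)) - u (word_map w (corner 0)))\<^sup>2)"
proof -
  have "word_map w x \<noteq> word_map w y" if "x \<noteq> y" for x y
    using that inj_word_map[of w] by (simp add: inj_eq)
  then have "distinct [word_map w (corner 0), word_map w (corner 1), word_map w (corner 2)]"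
    by simp
  then show ?thesis
    unfolding cell_energy_def cell_vertices_eq by (simp del: corner_simps add: power2_commute)
qed

text \<open>The difference of both sides is a nonnegative quadratic form in the distances of \<open>p, q, r\<close> from
  the harmonic extension \<open>(2x + 2y + z)/5, (x + 2y + 2z)/5, (2x + y + 2z)/5\<close>.\<close>

lemma harmonic_extension_inequality:
  fixes x y z p q r :: real
  shows "(x - y)\<^sup>2 + (y - z)\<^sup>2 + (z - x)\<^sup>2 \<le> 5 / 3 *
    (((x - p)\<^sup>2 + (p - r)\<^sup>2 + (r - x)\<^sup>2) + ((p - y)\<^sup>2 + (y - q)\<^sup>2 + (q - p)\<^sup>2) +
     ((r - q)\<^sup>2 + (q - z)\<^sup>2 + (z - r)\<^sup>2))"
proof -
  define a b c where "a = p - (2 * x + 2 * y + z) / 5" and "b = q - (x + 2 * y + 2 * z) / 5"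
    and "c = r - (2 * x + y + 2 * z) / 5"
  have p: "p = a + (2 * x + 2 * y + z) / 5" and q: "q = b + (x + 2 * y + 2 * z) / 5"
    and r: "r = c + (2 * x + y + 2 * z) / 5"
    by (simp_all add: a_def b_def c_def)
  have "5 / 3 * (((x - p)\<^sup>2 + (p - r)\<^sup>2 + (r - x)\<^sup>2) + ((p - y)\<^sup>2 + (y - q)\<^sup>2 + (q - p)\<^sup>2) +
     ((r - q)\<^sup>2 + (q - z)\<^sup>2 + (z - r)\<^sup>2)) - ((x - y)\<^sup>2 + (y - z)\<^sup>2 + (z - x)\<^sup>2) =
     5 / 3 * (2 * a\<^sup>2 + 2 * b\<^sup>2 + 2 * c\<^sup>2 + (a - b)\<^sup>2 + (b - c)\<^sup>2 + (a - c)\<^sup>2)"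
    unfolding p q r by (simp add: power2_eq_square field_simps)
  also have "\<dots> \<ge> 0"
    by (intro mult_nonneg_nonneg add_nonneg_nonneg) auto
  finally show ?thesis
    by simp
qed

text \<open>Both sides are the midpoint of corners \<open>i\<close> and \<open>j\<close>, the point
  shared by two subcells.\<close>

lemma gasket_map_corner_commute: "gasket_map i (corner j) = gasket_map j (corner i)"
  by (simp add: gasket_map_def add.commute)

lemma cell_energy_le_subcells:
  "cell_energy u w \<le> 5 / 3 * (cell_energy u (w @ [0]) + cell_energy u (w @ [1]) + cell_energy u (w @ [2]))"
proof -
  \<comment> \<open>\<open>g i i\<close> are the values at the corners of the cell,
    \<open>g i j\<close> with \<open>i \<noteq> j\<close> those at the midpoints of its
    sides.\<close>
  define g where "g i j = u (word_map w (gasket_map i (corner j)))" for i j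
  have s: "g i j = g j i" for i j
    by (simp add: g_def gasket_map_corner_commute[of i])
  have e: "cell_energy u (w @ [i]) = 2 * ((g i 0 - g i 1)\<^sup>2 + (g i 1 - g i 2)\<^sup>2 + (g i 2 - g i 0)\<^sup>2)" for i
    unfolding cell_energy_corners g_def by simp
  have "cell_energy u w = 2 * ((g 0 0 - g 1 1)\<^sup>2 + (g 1 1 - g 2 2)\<^sup>2 + (g 2 2 - g 0 0)\<^sup>2)"
    unfolding cell_energy_corners g_def gasket_map_corner by simp
  also have "\<dots> \<le> 2 * (5 / 3 * (((g 0 0 - g 0 1)\<^sup>2 + (g 0 1 - g 0 2)\<^sup>2 + (g 0 2 - g 0 0)\<^sup>2) +
      ((g 0 1 - g 1 1)\<^sup>2 + (g 1 1 - g 1 2)\<^sup>2 + (g 1 2 - g 0 1)\<^sup>2) +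
      ((g 0 2 - g 1 2)\<^sup>2 + (g 1 2 - g 2 2)\<^sup>2 + (g 2 2 - g 0 2)\<^sup>2)))"
    by (intro mult_left_mono harmonic_extension_inequality) simp
  also have "\<dots> = 5 / 3 * (cell_energy u (w @ [0]) + cell_energy u (w @ [1]) + cell_energy u (w @ [2]))"
    unfolding e s[of 1 0] s[of 2 0] s[of 2 1] by (simp only: algebra_simps)
  finally show ?thesis .
qed

lemma graph_energy_le_Suc: "graph_energy n u \<le> 5 / 3 * graph_energy (Suc n) u"
proof -
  have "graph_energy n u \<le> (\<Sum>w\<in>words n. 5 / 3 *
      (cell_energy u (w @ [0]) + cell_energy u (w @ [1]) + cell_energy u (w @ [2])))"
    unfolding graph_energy_eq by (intro sum_mono cell_energy_le_subcells)
  also have "\<dots> = 5 / 3 * graph_energy (Suc n) u"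
    by (simp add: graph_energy_eq sum_words_Suc sum_distrib_left)
  finally show ?thesis .
qed

definition scaled_energy :: "nat \<Rightarrow> (real \<times> real \<Rightarrow> real) \<Rightarrow> real" where
  "scaled_energy n u = (5 / 3) ^ n * graph_energy n u"

lemma scaled_energy_nonneg: "0 \<le> scaled_energy n u"
  by (simp add: scaled_energy_def graph_energy_nonneg)

lemma incseq_scaled_energy: "incseq (\<lambda>n. scaled_energy n u)"
proof (rule incseq_SucI)
  fix n
  have "(5 / 3) ^ n * graph_energy n u \<le> (5 / 3) ^ n * (5 / 3 * graph_energy (Suc n) u)"
    by (intro mult_left_mono graph_energy_le_Suc) auto
  then show "scaled_energy n u \<le> scaled_energy (Suc n) u"
    by (simp add: scaled_energy_def mult.commute mult.left_commute)
qed

text \<open>By monotonicity the \<open>lim\<close> in the definition is a genuine limit, possibly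
  infinite.\<close>

lemma local_energy_eq_SUP: "local_energy u = (SUP n. ennreal (scaled_energy n u))"
proof -
  have "incseq (\<lambda>n. ennreal (scaled_energy n u))"
    using incseq_scaled_energy[of u] by (auto simp: incseq_def ennreal_leI)
  then show ?thesis
    unfolding local_energy_def scaled_energy_def[symmetric] by (intro limI LIMSEQ_SUP)
qed

section \<open>Rearrangement of series with nonnegative terms\<close>

lemma suminf_swap_ennreal:
  fixes f :: "nat \<Rightarrow> nat \<Rightarrow> ennreal"
  shows "(\<Sum>i. \<Sum>j. f i j) = (\<Sum>j. \<Sum>i. f i j)"
  using nn_integral_suminf[of f "count_space UNIV"] by (simp add: nn_integral_count_space_nat)

lemma suminf_shift_ennreal:
  fixes f :: "nat \<Rightarrow> ennreal"
  shows "(\<Sum>k. f (n + k)) = (\<Sum>m. if n \<le> m then f m else 0)"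
proof -
  have "(\<Sum>m. if n \<le> m then f m else 0) =
      (\<Sum>k. if n \<le> k + n then f (k + n) else 0) + (\<Sum>m<n. if n \<le> m then f m else 0)"
    by (rule suminf_offset) simp
  then show ?thesis
    by (simp add: add.commute)
qed

lemma suminf_diagonal_ennreal:
  fixes f :: "nat \<Rightarrow> nat \<Rightarrow> ennreal"
  shows "(\<Sum>n. \<Sum>k. f n (n + k)) = (\<Sum>m. \<Sum>n\<le>m. f n m)"
proof -
  have "(\<Sum>n. \<Sum>k. f n (n + k)) = (\<Sum>n. \<Sum>m. if n \<le> m then f n m else 0)"
    by (simp add: suminf_shift_ennreal)
  also have "\<dots> = (\<Sum>m. \<Sum>n. if n \<le> m then f n m else 0)"
    by (rule suminf_swap_ennreal)
  also have "\<dots> = (\<Sum>m. \<Sum>n\<le>m. f n m)"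
  proof (rule suminf_cong)
    show "(\<Sum>n. if n \<le> m then f n m else 0) = (\<Sum>n\<le>m. f n m)" for m
      by (subst suminf_finite[of "{..m}"]) auto
  qed
  finally show ?thesis .
qed

lemma suminf_geometric_ennreal:
  fixes c r :: real
  assumes "0 \<le> c" "0 \<le> r" "r < 1"
  shows "(\<Sum>k. ennreal (c * r ^ k)) = ennreal (c / (1 - r))"
proof (rule suminf_ennreal_eq)
  show "(\<lambda>k. c * r ^ k) sums (c / (1 - r))"
    using sums_mult[OF geometric_sums[of r], of c] assms by simp
qed (use assms in auto)

section \<open>Renormalized energies and their limit\<close>

text \<open>The increment from level \<open>n\<close> to level \<open>n + 1\<close>, with level 0
  counted as 0 because \<open>discrete_energy\<close> starts at level 1.\<close>

definition energy_increment :: "(real \<times> real \<Rightarrow> real) \<Rightarrow> nat \<Rightarrow> real" where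
  "energy_increment u n = scaled_energy (Suc n) u - (if n = 0 then 0 else scaled_energy n u)"

lemma energy_increment_nonneg: "0 \<le> energy_increment u n"
  using incseq_SucD[OF incseq_scaled_energy[of u], of n] scaled_energy_nonneg[of "Suc 0" u]
  by (auto simp: energy_increment_def)

lemma sum_energy_increment: "(\<Sum>n\<le>m. energy_increment u n) = scaled_energy (Suc m) u"
  by (induction m) (auto simp: energy_increment_def)

lemma powr_dim_eq: "2 powr ((\<beta> - gasket_dim) * real n) = (2 powr \<beta> / 3) ^ n"
proof -
  have "2 powr ((\<beta> - gasket_dim) * real n) = (2 powr (\<beta> - gasket_dim)) ^ n"
    by (simp add: powr_realpow flip: powr_powr)
  then show ?thesis
    by (simp add: powr_diff two_powr_gasket_dim)
qed

lemma discrete_energy_eq: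
  "discrete_energy \<beta> u = (\<Sum>n. ennreal ((2 powr \<beta> / 3) ^ Suc n * graph_energy (Suc n) u))"
  unfolding discrete_energy_def powr_dim_eq ..

lemma discrete_energy_scaled:
  "discrete_energy \<beta> u = (\<Sum>n. ennreal ((2 powr \<beta> / 5) ^ Suc n * scaled_energy (Suc n) u))"
proof -
  have "(2 powr \<beta> / 3) ^ n * graph_energy n u = (2 powr \<beta> / 5) ^ n * scaled_energy n u" for n
    unfolding scaled_energy_def by (simp flip: power_mult_distrib mult.assoc)
  then show ?thesis
    by (simp only: discrete_energy_eq)
qed

text \<open>Each scaled energy is the sum of its increments; exchanging the nonnegative sums leaves
  a geometric series that cancels \<open>1 - l\<close>. Computed in [0, \<infinity>], the identity
  includes the case of infinite energy.\<close>

lemma renormalized_energy_eq: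
  assumes "2 powr \<beta> < 5"
  shows "ennreal (1 - 2 powr \<beta> / 5) * discrete_energy \<beta> u =
    (\<Sum>n. ennreal ((2 powr \<beta> / 5) ^ Suc n * energy_increment u n))"
proof -
  define l where "l = 2 powr \<beta> / 5"
  have l: "0 < l" "l < 1"
    using assms by (auto simp: l_def)
  note d = energy_increment_nonneg[of u]
  have "discrete_energy \<beta> u = (\<Sum>m. \<Sum>n\<le>m. ennreal (l ^ Suc m * energy_increment u n))"
    unfolding discrete_energy_scaled l_def[symmetric]
    using l d by (simp add: sum_ennreal flip: sum_energy_increment sum_distrib_left del: power_Suc)
  also have "\<dots> = (\<Sum>n. \<Sum>k. ennreal (l ^ Suc (n + k) * energy_increment u n))"
    by (rule suminf_diagonal_ennreal[symmetric])
  also have "\<dots> = (\<Sum>n. \<Sum>k. ennreal ((l ^ Suc n * energy_increment u n) * l ^ k))"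
    by (simp add: power_add mult_ac)
  also have "\<dots> = (\<Sum>n. ennreal (l ^ Suc n * energy_increment u n / (1 - l)))"
    using l d by (subst suminf_geometric_ennreal) auto
  finally have "ennreal (1 - l) * discrete_energy \<beta> u =
      (\<Sum>n. ennreal (1 - l) * ennreal (l ^ Suc n * energy_increment u n / (1 - l)))"
    by simp
  also have "\<dots> = (\<Sum>n. ennreal (l ^ Suc n * energy_increment u n))"
    using l d by (simp flip: ennreal_mult')
  finally show ?thesis
    by (simp only: l_def)
qed

lemma two_powr_walk_dim: "2 powr walk_dim = 5"
  by (simp add: walk_dim_def powr_def)

lemma two_powr_less_5: "\<beta> < walk_dim \<Longrightarrow> 2 powr \<beta> < 5"
  using powr_less_mono[of \<beta> walk_dim 2] by (simp add: two_powr_walk_dim)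

lemma three_less_two_powr: "gasket_dim < \<beta> \<Longrightarrow> 3 < 2 powr \<beta>"
  using powr_less_mono[of gasket_dim \<beta> 2] by (simp add: two_powr_gasket_dim)

lemma gasket_dim_less_walk_dim: "gasket_dim < walk_dim"
  by (simp add: gasket_dim_def walk_dim_def divide_strict_right_mono)

lemma renormalized_energy_mono:
  assumes "\<beta> \<le> \<gamma>" "\<gamma> < walk_dim"
  shows "ennreal (1 - 2 powr \<beta> / 5) * discrete_energy \<beta> u \<le> ennreal (1 - 2 powr \<gamma> / 5) * discrete_energy \<gamma> u"
proof -
  have "2 powr \<beta> \<le> 2 powr \<gamma>"
    using assms by simp
  then have "(2 powr \<beta> / 5) ^ Suc n * energy_increment u n \<le> (2 powr \<gamma> / 5) ^ Suc n * energy_increment u n" for n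
    by (intro mult_right_mono power_mono energy_increment_nonneg) auto
  then show ?thesis
    using assms two_powr_less_5[of \<beta>] two_powr_less_5[of \<gamma>]
    by (simp only: renormalized_energy_eq less_le_trans le_less_trans) (intro suminf_le ennreal_leI; simp)
qed

lemma local_energy_eq_suminf: "local_energy u = (\<Sum>n. ennreal (energy_increment u n))"
proof -
  have "(\<Sum>n. ennreal (energy_increment u n)) = (SUP m. \<Sum>n<m. ennreal (energy_increment u n))"
    by (rule suminf_eq_SUP)
  also have "\<dots> = (SUP m. ennreal (scaled_energy m u))"
  proof (rule SUP_eq)
    fix m :: nat
    have "(\<Sum>n<m. ennreal (energy_increment u n)) = ennreal (\<Sum>n<m. energy_increment u n)"
      by (rule sum_ennreal) (rule energy_increment_nonneg)
    also have "(\<Sum>n<m. energy_increment u n) \<le> (\<Sum>n\<le>m. energy_increment u n)"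
      by (intro sum_mono2 energy_increment_nonneg) auto
    finally show "\<exists>i\<in>UNIV. (\<Sum>n<m. ennreal (energy_increment u n)) \<le> ennreal (scaled_energy i u)"
      unfolding sum_energy_increment by (auto simp: ennreal_leI)
  next
    fix m :: nat
    have "scaled_energy m u \<le> (\<Sum>n<Suc m. energy_increment u n)"
      unfolding lessThan_Suc_atMost sum_energy_increment by (rule incseq_SucD[OF incseq_scaled_energy])
    then show "\<exists>i\<in>UNIV. ennreal (scaled_energy m u) \<le> (\<Sum>n<i. ennreal (energy_increment u n))"
      by (intro bexI[of _ "Suc m"]) (auto simp: sum_ennreal energy_increment_nonneg ennreal_leI simp del: sum.lessThan_Suc)
  qed
  finally show ?thesis
    by (simp add: local_energy_eq_SUP)
qed

lemma renormalized_energy_le_local_energy: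
  assumes "\<beta> < walk_dim"
  shows "ennreal (1 - 2 powr \<beta> / 5) * discrete_energy \<beta> u \<le> local_energy u"
proof -
  have "(2 powr \<beta> / 5) ^ Suc n * energy_increment u n \<le> energy_increment u n" for n
    using two_powr_less_5[OF assms] energy_increment_nonneg[of u n]
    by (intro mult_left_le_one_le power_le_one) auto
  then show ?thesis
    unfolding local_energy_eq_suminf using two_powr_less_5[OF assms]
    by (simp only: renormalized_energy_eq) (intro suminf_le ennreal_leI; simp)
qed

text \<open>The increments up to \<open>m\<close> are kept and their weights lowered to the common
  value \<open>l ^ Suc m\<close>. The left side depends on finitely many values of \<open>u\<close>,
  so it passes to limits in \<open>\<beta>\<close> and in \<open>u\<close>.\<close>

lemma scaled_energy_le_renormalized_energy:
  assumes "\<beta> < walk_dim"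
  shows "ennreal ((2 powr \<beta> / 5) ^ Suc m * scaled_energy (Suc m) u) \<le>
    ennreal (1 - 2 powr \<beta> / 5) * discrete_energy \<beta> u"
proof -
  define l where "l = 2 powr \<beta> / 5"
  have l: "0 \<le> l" "l \<le> 1"
    using two_powr_less_5[OF assms] by (auto simp: l_def)
  have "l ^ Suc m * scaled_energy (Suc m) u = (\<Sum>n\<le>m. l ^ Suc m * energy_increment u n)"
    by (simp only: sum_energy_increment sum_distrib_left[symmetric])
  also have "\<dots> \<le> (\<Sum>n\<le>m. l ^ Suc n * energy_increment u n)"
    using l by (intro sum_mono mult_right_mono power_decreasing energy_increment_nonneg) auto
  finally have "ennreal (l ^ Suc m * scaled_energy (Suc m) u) \<le> ennreal (\<Sum>n\<le>m. l ^ Suc n * energy_increment u n)"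
    by (rule ennreal_leI)
  also have "\<dots> = (\<Sum>n\<le>m. ennreal (l ^ Suc n * energy_increment u n))"
    using l energy_increment_nonneg by (intro sum_ennreal[symmetric] mult_nonneg_nonneg) auto
  also have "\<dots> \<le> (\<Sum>n. ennreal (l ^ Suc n * energy_increment u n))"
    by (intro sum_le_suminf) auto
  finally show ?thesis
    using two_powr_less_5[OF assms] by (simp only: renormalized_energy_eq l_def)
qed

lemma renormalized_energy_tendsto:
  "((\<lambda>\<beta>. ennreal (1 - 2 powr \<beta> / 5) * discrete_energy \<beta> u) \<longlongrightarrow> local_energy u) (at_left walk_dim)"
proof (rule order_tendstoI)
  have ev: "\<forall>\<^sub>F \<beta> in at_left walk_dim. \<beta> < walk_dim"
    by (auto simp: eventually_at_filter)
  {
    fix a assume "local_energy u < a"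
    with ev show "\<forall>\<^sub>F \<beta> in at_left walk_dim. ennreal (1 - 2 powr \<beta> / 5) * discrete_energy \<beta> u < a"
      by (elim eventually_mono) (use renormalized_energy_le_local_energy le_less_trans in blast)
  next
    fix a assume "a < local_energy u"
    then obtain m where m: "a < ennreal (scaled_energy m u)"
      unfolding local_energy_eq_SUP by (auto simp: less_SUP_iff)
    also have "ennreal (scaled_energy m u) \<le> ennreal (scaled_energy (Suc m) u)"
      by (intro ennreal_leI incseq_SucD[OF incseq_scaled_energy])
    \<comment> \<open>At \<open>walk_dim\<close> the weight is 1, so the strict inequality persists
      for nearby \<open>\<beta>\<close> by continuity.\<close>
    finally have "a < ennreal ((2 powr walk_dim / 5) ^ Suc m * scaled_energy (Suc m) u)"
      by (simp add: two_powr_walk_dim)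
    moreover have "((\<lambda>\<beta>. ennreal ((2 powr \<beta> / 5) ^ Suc m * scaled_energy (Suc m) u)) \<longlongrightarrow>
        ennreal ((2 powr walk_dim / 5) ^ Suc m * scaled_energy (Suc m) u)) (at_left walk_dim)"
      by (intro tendsto_intros) auto
    ultimately have "\<forall>\<^sub>F \<beta> in at_left walk_dim. a < ennreal ((2 powr \<beta> / 5) ^ Suc m * scaled_energy (Suc m) u)"
      by (auto dest: order_tendstoD(1))
    with ev show "\<forall>\<^sub>F \<beta> in at_left walk_dim. a < ennreal (1 - 2 powr \<beta> / 5) * discrete_energy \<beta> u"
      by eventually_elim (use scaled_energy_le_renormalized_energy less_le_trans in blast)
  }
qed

text \<open>Level 0, absent from \<open>discrete_energy\<close>, costs at most twice the term of
  level 1 by \<open>graph_energy_le_Suc\<close>; hence 3 = 1 + 2.\<close>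

lemma suminf_graph_energy_le_discrete_energy:
  assumes "gasket_dim < \<beta>"
  shows "(\<Sum>n. ennreal ((2 powr \<beta> / 3) ^ n * graph_energy n u)) \<le> 3 * discrete_energy \<beta> u"
proof -
  let ?f = "\<lambda>n. ennreal ((2 powr \<beta> / 3) ^ n * graph_energy n u)"
  have b: "1 \<le> 2 powr \<beta> / 3"
    using three_less_two_powr[OF assms] by simp
  have "graph_energy 0 u \<le> 5 / 3 * (1 * graph_energy (Suc 0) u)"
    using graph_energy_le_Suc[of 0 u] by simp
  also have "\<dots> \<le> 2 * ((2 powr \<beta> / 3) * graph_energy (Suc 0) u)"
    using b graph_energy_nonneg[of "Suc 0" u] by (intro mult_mono) auto
  finally have "ennreal (graph_energy 0 u) \<le> ennreal (2 * ((2 powr \<beta> / 3) * graph_energy (Suc 0) u))"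
    by (rule ennreal_leI)
  also have "\<dots> = ennreal 2 * ?f (Suc 0)"
    by (subst ennreal_mult'[symmetric]) simp_all
  also have "?f (Suc 0) \<le> discrete_energy \<beta> u"
    unfolding discrete_energy_eq using sum_le_suminf[of "\<lambda>n. ?f (Suc n)" "{0}"] by simp
  finally have 0: "?f 0 \<le> 2 * discrete_energy \<beta> u"
    by (simp add: mult_left_mono)
  have "(\<Sum>n. ?f n) = discrete_energy \<beta> u + ?f 0"
    using suminf_offset[of ?f "Suc 0"] by (simp add: discrete_energy_eq)
  also have "\<dots> \<le> discrete_energy \<beta> u + 2 * discrete_energy \<beta> u"
    using 0 by (rule add_left_mono)
  also have "\<dots> = (1 + 2) * discrete_energy \<beta> u"
    by (simp only: distrib_right mult_1)
  finally show ?thesis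
    by simp
qed

section \<open>Comparison of the two energies\<close>

subsection \<open>Weighted telescoping\<close>

text \<open>Cauchy-Schwarz with weights \<open>r ^ k\<close>, whose inverses sum to
  \<open>r / (r - 1)\<close>. The ratio stays free so that it can be adapted to the decay of the
  squared steps.\<close>

lemma square_telescope_le:
  fixes a :: "nat \<Rightarrow> real"
  assumes "1 < r"
  shows "(a 0 - a n)\<^sup>2 \<le> (\<Sum>k<n. r / (r - 1) * r ^ k * (a k - a (Suc k))\<^sup>2)"
proof (induction n arbitrary: a)
  case (Suc n)
  define p q where "p = a 0 - a 1" and "q = a 1 - a (Suc n)"
  \<comment> \<open>Completing the square gives the weighted bound on \<open>(p + q)\<^sup>2\<close>
    that drives the induction.\<close>
  have "r / (r - 1) * p\<^sup>2 + r * q\<^sup>2 - (p + q)\<^sup>2 = (p - (r - 1) * q)\<^sup>2 / (r - 1)"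
    using assms by (simp add: power2_eq_square field_simps)
  also have "\<dots> \<ge> 0"
    using assms by simp
  finally have "(a 0 - a (Suc n))\<^sup>2 \<le> r / (r - 1) * p\<^sup>2 + r * q\<^sup>2"
    by (simp add: p_def q_def)
  also have "\<dots> \<le> r / (r - 1) * p\<^sup>2 + r * (\<Sum>k<n. r / (r - 1) * r ^ k * (a (Suc k) - a (Suc (Suc k)))\<^sup>2)"
    unfolding q_def using assms Suc[of "\<lambda>k. a (Suc k)"] by simp
  also have "\<dots> = (\<Sum>k<Suc n. r / (r - 1) * r ^ k * (a k - a (Suc k))\<^sup>2)"
    unfolding sum.lessThan_Suc_shift by (simp add: p_def sum_distrib_left mult_ac)
  finally show ?case .
qed simp

lemma square_telescope_limit_le:
  fixes a :: "nat \<Rightarrow> real"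
  assumes r: "1 < r" and "a \<longlonglongrightarrow> l"
  shows "ennreal ((a 0 - l)\<^sup>2) \<le> ennreal (r / (r - 1)) * (\<Sum>k. ennreal (r ^ k) * ennreal ((a k - a (Suc k))\<^sup>2))"
proof (rule LIMSEQ_le_const2)
  show "(\<lambda>n. ennreal ((a 0 - a n)\<^sup>2)) \<longlonglongrightarrow> ennreal ((a 0 - l)\<^sup>2)"
    using assms by (intro tendsto_intros)
  have "ennreal ((a 0 - a n)\<^sup>2) \<le> ennreal (r / (r - 1)) * (\<Sum>k. ennreal (r ^ k) * ennreal ((a k - a (Suc k))\<^sup>2))" for n
  proof -
    have m: "ennreal (c * r ^ k * s) = ennreal c * (ennreal (r ^ k) * ennreal s)" if "0 \<le> c" "0 \<le> s" for c s k
      using r that by (simp add: ennreal_mult' mult.assoc)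
    have "ennreal ((a 0 - a n)\<^sup>2) \<le> ennreal (\<Sum>k<n. r / (r - 1) * r ^ k * (a k - a (Suc k))\<^sup>2)"
      using r by (intro ennreal_leI square_telescope_le)
    also have "\<dots> = (\<Sum>k<n. ennreal (r / (r - 1) * r ^ k * (a k - a (Suc k))\<^sup>2))"
      using r by (intro sum_ennreal[symmetric]) auto
    also have "\<dots> = (\<Sum>k<n. ennreal (r / (r - 1)) * (ennreal (r ^ k) * ennreal ((a k - a (Suc k))\<^sup>2)))"
      using r by (intro sum.cong refl m) auto
    also have "\<dots> \<le> (\<Sum>k. ennreal (r / (r - 1)) * (ennreal (r ^ k) * ennreal ((a k - a (Suc k))\<^sup>2)))"
      by (intro sum_le_suminf) auto
    finally show ?thesis
      by simp
  qed
  then show "\<exists>N. \<forall>n\<ge>N. ennreal ((a 0 - a n)\<^sup>2) \<le>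
      ennreal (r / (r - 1)) * (\<Sum>k. ennreal (r ^ k) * ennreal ((a k - a (Suc k))\<^sup>2))"
    by blast
qed

lemma square_add_le:
  fixes a b c :: real
  shows "(a - b)\<^sup>2 \<le> 2 * (a - c)\<^sup>2 + 2 * (b - c)\<^sup>2"
proof -
  have "2 * (a - c)\<^sup>2 + 2 * (b - c)\<^sup>2 - (a - b)\<^sup>2 = (a + b - 2 * c)\<^sup>2"
    by (simp add: power2_eq_square algebra_simps)
  then show ?thesis
    by (metis diff_ge_0_iff_ge zero_le_power2)
qed

lemma ennreal_square_add_le:
  fixes a b c :: real
  shows "ennreal ((a - b)\<^sup>2) \<le> 2 * ennreal ((a - c)\<^sup>2) + 2 * ennreal ((b - c)\<^sup>2)"
proof -
  have "ennreal ((a - b)\<^sup>2) \<le> ennreal (2 * (a - c)\<^sup>2 + 2 * (b - c)\<^sup>2)"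
    by (intro ennreal_leI square_add_le)
  also have "\<dots> = ennreal 2 * ennreal ((a - c)\<^sup>2) + ennreal 2 * ennreal ((b - c)\<^sup>2)"
    by (simp add: ennreal_plus ennreal_mult')
  finally show ?thesis
    by simp
qed

lemma nn_integral_suminf_sum:
  fixes f :: "nat \<Rightarrow> 'i \<Rightarrow> 'a \<Rightarrow> ennreal"
  assumes "\<And>n i. i \<in> I n \<Longrightarrow> f n i \<in> borel_measurable M"
  shows "(\<integral>\<^sup>+x. (\<Sum>n. \<Sum>i\<in>I n. f n i x) \<partial>M) = (\<Sum>n. \<Sum>i\<in>I n. \<integral>\<^sup>+x. f n i x \<partial>M)"
proof -
  have "(\<integral>\<^sup>+x. (\<Sum>n. \<Sum>i\<in>I n. f n i x) \<partial>M) = (\<Sum>n. \<integral>\<^sup>+x. (\<Sum>i\<in>I n. f n i x) \<partial>M)"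
    by (intro nn_integral_suminf borel_measurable_sum assms)
  also have "\<dots> = (\<Sum>n. \<Sum>i\<in>I n. \<integral>\<^sup>+x. f n i x \<partial>M)"
    by (intro suminf_cong nn_integral_sum assms)
  finally show ?thesis .
qed

text \<open>\<open>T m\<close> is collected from all starting levels \<open>n \<le> m\<close> with
  weight \<open>b ^ n * r ^ (m - n)\<close>. As \<open>r < b\<close>, these weights form a geometric
  sum dominated by \<open>b ^ m\<close>.\<close>

lemma suminf_convolution_le:
  fixes b r :: real and T :: "nat \<Rightarrow> ennreal"
  assumes "0 < r" "r < b"
  shows "(\<Sum>n. \<Sum>k. ennreal (b ^ n) * (ennreal (r ^ k) * T (n + k))) \<le>
    ennreal (b / (b - r)) * (\<Sum>m. ennreal (b ^ m) * T m)"
proof -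
  have s: "(\<Sum>n\<le>m. b ^ n * r ^ (m - n)) \<le> b / (b - r) * b ^ m" for m
  proof (induction m)
    case 0
    then show ?case
      using assms by (simp add: le_divide_eq)
  next
    case (Suc m)
    have "(\<Sum>n\<le>Suc m. b ^ n * r ^ (Suc m - n)) = r * (\<Sum>n\<le>m. b ^ n * r ^ (m - n)) + b ^ Suc m"
      by (simp add: sum_distrib_left Suc_diff_le mult_ac)
    also have "\<dots> \<le> r * (b / (b - r) * b ^ m) + b ^ Suc m"
      using Suc assms by (intro add_right_mono mult_left_mono) auto
    also have "\<dots> = b / (b - r) * b ^ Suc m"
      using assms by (simp add: field_simps)
    finally show ?case .
  qed
  have "(\<Sum>n. \<Sum>k. ennreal (b ^ n) * (ennreal (r ^ k) * T (n + k))) =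
      (\<Sum>n. \<Sum>k. (\<lambda>n m. ennreal (b ^ n * r ^ (m - n)) * T m) n (n + k))"
    using assms by (simp add: ennreal_mult' mult.assoc)
  also have "\<dots> = (\<Sum>m. \<Sum>n\<le>m. ennreal (b ^ n * r ^ (m - n)) * T m)"
    by (rule suminf_diagonal_ennreal)
  also have "\<dots> = (\<Sum>m. ennreal (\<Sum>n\<le>m. b ^ n * r ^ (m - n)) * T m)"
    using assms by (simp add: sum_ennreal flip: sum_distrib_right)
  also have "\<dots> \<le> (\<Sum>m. ennreal (b / (b - r) * b ^ m) * T m)"
    by (intro suminf_le mult_right_mono ennreal_leI s) auto
  also have "\<dots> = (\<Sum>m. ennreal (b / (b - r)) * (ennreal (b ^ m) * T m))"
  proof (rule suminf_cong)
    have "ennreal (c * b ^ m) * T m = ennreal c * (ennreal (b ^ m) * T m)" if "0 \<le> c" for c m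
      using that by (simp add: ennreal_mult' mult.assoc)
    then show "ennreal (b / (b - r) * b ^ m) * T m = ennreal (b / (b - r)) * (ennreal (b ^ m) * T m)" for m
      by this (use assms in simp)
  qed
  also have "\<dots> = ennreal (b / (b - r)) * (\<Sum>m. ennreal (b ^ m) * T m)"
    by simp
  finally show ?thesis .
qed

subsection \<open>The pointwise estimate along a chain of cells\<close>

text \<open>An address of \<open>x\<close> within the cell. Points common to several cells have more
  than one, hence the dependent choice.\<close>

lemma word_chain:
  assumes "x \<in> cell w"
  obtains v i where "v 0 = []" "\<And>k. v k \<in> words k" "\<And>k. i k \<in> {0, 1, 2}" "\<And>k. v (Suc k) = v k @ [i k]"
    "\<And>k. x \<in> cell (w @ v k)"
proof -
  have "\<exists>v. \<forall>k. (v k \<in> words k \<and> x \<in> cell (w @ v k) \<and> (k = 0 \<longrightarrow> v k = [])) \<and>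
      (\<exists>i\<in>{0, 1, 2}. v (Suc k) = v k @ [i])"
  proof (rule dependent_nat_choice)
    fix v k assume v: "v \<in> words k \<and> x \<in> cell (w @ v) \<and> (k = 0 \<longrightarrow> v = [])"
    then obtain i where "i \<in> {0, 1, 2}" "x \<in> cell ((w @ v) @ [i])"
      using mem_cell_extend[of x "w @ v"] by blast
    moreover have "v @ [i] \<in> words (Suc k)"
      using v \<open>i \<in> {0, 1, 2}\<close> by (auto simp: words_def)
    ultimately show "\<exists>v'. (v' \<in> words (Suc k) \<and> x \<in> cell (w @ v') \<and> (Suc k = 0 \<longrightarrow> v' = [])) \<and>
        (\<exists>i\<in>{0, 1, 2}. v' = v @ [i])"
      by (intro exI[of _ "v @ [i]"]) auto
  qed (use assms in auto)
  then obtain v where v: "\<And>k. v k \<in> words k \<and> x \<in> cell (w @ v k) \<and> (k = 0 \<longrightarrow> v k = [])"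
      "\<And>k. \<exists>i\<in>{0, 1, 2}. v (Suc k) = v k @ [i]"
    by blast
  then obtain i where "\<And>k. i k \<in> {0, 1, 2}" "\<And>k. v (Suc k) = v k @ [i k]"
    by metis
  moreover have "v 0 = []"
    using v(1)[of 0] by simp
  ultimately show thesis
    using v(1) by (intro that[of v i]) blast+
qed

lemma tendsto_gasket_cells:
  fixes u :: "real \<times> real \<Rightarrow> real"
  assumes u: "continuous_on gasket u" and w: "w \<in> words n"
    and v: "\<And>k. v k \<in> words k" and x: "\<And>k. x \<in> cell (w @ v k)" and z: "\<And>k. z k \<in> cell (w @ v k)"
  shows "(\<lambda>k. u (z k)) \<longlonglongrightarrow> u x"
proof -
  have g: "cell (w @ v k) \<subseteq> gasket" for k
    using w v by (intro cell_subset[of _ "n + k"] words_append)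
  have "(\<lambda>k. dist (z k) x) \<longlonglongrightarrow> 0"
  proof (rule tendsto_sandwich[of "\<lambda>k. 0" _ _ "\<lambda>k. 2 * (1 / 2) ^ n * (1 / 2) ^ k"])
    show "\<forall>\<^sub>F k in sequentially. dist (z k) x \<le> 2 * (1 / 2) ^ n * (1 / 2) ^ k"
    proof (rule always_eventually, rule allI)
      fix k
      show "dist (z k) x \<le> 2 * (1 / 2) ^ n * (1 / 2) ^ k"
        using dist_cell[OF z x, of k] length_words[OF w] length_words[OF v[of k]]
        by (simp add: power_add)
    qed
    show "(\<lambda>k. 2 * (1 / 2) ^ n * (1 / 2) ^ k) \<longlonglongrightarrow> (0 :: real)"
      by (intro tendsto_mult_right_zero LIMSEQ_power_zero) auto
  qed auto
  then have "z \<longlonglongrightarrow> x"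
    by (subst tendsto_dist_iff)
  moreover have "x \<in> gasket"
    by (rule subsetD[OF g[of 0] x])
  moreover have "z k \<in> gasket" for k
    by (rule subsetD[OF g z])
  ultimately show ?thesis
    by (intro continuous_on_tendsto_compose[OF u] always_eventually allI)
qed

text \<open>Follow the corners \<open>p\<^sub>0\<close> of the cells shrinking to \<open>x\<close>; two successive ones are both corners of the
  subcell with last letter 0.\<close>

lemma square_diff_vertex_chain:
  fixes u :: "real \<times> real \<Rightarrow> real"
  assumes u: "continuous_on gasket u" and w: "w \<in> words n" and x: "x \<in> cell w"
    and p: "p \<in> cell_vertices w" and r: "1 < r"
  obtains v where "\<And>k. v k \<in> words k" "\<And>k. x \<in> cell (w @ v k)"
    "ennreal ((u x - u p)\<^sup>2) \<le> 2 * ennreal (cell_energy u w) +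
       2 * (ennreal (r / (r - 1)) * (\<Sum>k. ennreal (r ^ k) * ennreal (cell_energy u (w @ v k @ [0]))))"
proof -
  obtain v i where v: "v 0 = []" "\<And>k. v k \<in> words k" "\<And>k. i k \<in> {0, 1, 2}" "\<And>k. v (Suc k) = v k @ [i k]"
    "\<And>k. x \<in> cell (w @ v k)"
    by (rule word_chain[OF x]) blast
  define z where "z k = word_map (w @ v k) (corner 0)" for k
  define a where "a k = u (z k)" for k
  have z: "z k \<in> cell (w @ v k)" for k
    unfolding z_def cell_def using corner_mem_gasket[of 0] by blast
  have lim: "a \<longlonglongrightarrow> u x"
    unfolding a_def using v(2,5) z by (intro tendsto_gasket_cells[OF u w])
  have step: "(a k - a (Suc k))\<^sup>2 \<le> cell_energy u (w @ v k @ [0])" for k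
  proof -
    have "z k = word_map (w @ v k @ [0]) (corner 0)"
      unfolding z_def by (simp add: gasket_map_corner del: corner_simps)
    moreover have "z (Suc k) = word_map (w @ v k @ [0]) (corner (i k))"
      unfolding z_def by (simp add: v(4) gasket_map_corner_commute[of 0] del: corner_simps)
    ultimately have "z k \<in> cell_vertices (w @ v k @ [0])" "z (Suc k) \<in> cell_vertices (w @ v k @ [0])"
      unfolding cell_vertices_def using v(3)[of k] by blast+
    then show ?thesis
      unfolding a_def by (rule square_diff_le_cell_energy)
  qed
  have "ennreal ((u x - u p)\<^sup>2) \<le> 2 * ennreal ((u x - a 0)\<^sup>2) + 2 * ennreal ((u p - a 0)\<^sup>2)"
    by (rule ennreal_square_add_le)
  also have "\<dots> \<le> 2 * (ennreal (r / (r - 1)) * (\<Sum>k. ennreal (r ^ k) * ennreal (cell_energy u (w @ v k @ [0])))) +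
      2 * ennreal (cell_energy u w)"
  proof (intro add_mono mult_left_mono)
    have "ennreal ((a 0 - u x)\<^sup>2) \<le> ennreal (r / (r - 1)) * (\<Sum>k. ennreal (r ^ k) * ennreal ((a k - a (Suc k))\<^sup>2))"
      by (rule square_telescope_limit_le[OF r lim])
    also have "\<dots> \<le> ennreal (r / (r - 1)) * (\<Sum>k. ennreal (r ^ k) * ennreal (cell_energy u (w @ v k @ [0])))"
      by (intro mult_left_mono suminf_le ennreal_leI step) auto
    finally show "ennreal ((u x - a 0)\<^sup>2) \<le>
        ennreal (r / (r - 1)) * (\<Sum>k. ennreal (r ^ k) * ennreal (cell_energy u (w @ v k @ [0])))"
      by (simp add: power2_commute)
    have "z 0 \<in> cell_vertices w"
      unfolding z_def cell_vertices_eq by (simp add: v(1))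
    then show "ennreal ((u p - a 0)\<^sup>2) \<le> ennreal (cell_energy u w)"
      unfolding a_def by (intro ennreal_leI square_diff_le_cell_energy p)
  qed auto
  finally show thesis
    using v(2,5) by (intro that) (simp_all add: add.commute)
qed

subsection \<open>The double integral is bounded by the sum\<close>

text \<open>All corners are included because the one shared with an adjacent cell varies with that
  cell.\<close>

definition corner_deviation :: "(real \<times> real \<Rightarrow> real) \<Rightarrow> nat list \<Rightarrow> real \<times> real \<Rightarrow> ennreal" where
  "corner_deviation u w x = (\<Sum>p\<in>cell_vertices w. ennreal ((u x - u p)\<^sup>2))"

definition corner_variance :: "(real \<times> real \<Rightarrow> real) \<Rightarrow> nat list \<Rightarrow> ennreal" where
  "corner_variance u w = (\<integral>\<^sup>+x. indicator (cell w) x * corner_deviation u w x \<partial>gasket_measure)"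

lemma measurable_corner_deviation [measurable]:
  assumes "u \<in> borel_measurable gasket_measure"
  shows "corner_deviation u w \<in> borel_measurable gasket_measure"
proof -
  have "(\<lambda>x. ennreal ((u x - c)\<^sup>2)) \<in> borel_measurable gasket_measure" for c
    using assms by measurable
  then show ?thesis
    unfolding corner_deviation_def by (intro borel_measurable_sum)
qed

text \<open>The chain estimate with \<open>r = 2\<close>. The chain depends on \<open>x\<close>;
  summing over all words with indicators makes the bound a measurable function of \<open>x\<close>.
  There are at most three corners, with factors 2 and \<open>2 * (r / (r - 1)) = 4\<close> for
  each.\<close>

lemma corner_deviation_le:
  assumes u: "continuous_on gasket u" and w: "w \<in> words n" and x: "x \<in> cell w"
  shows "corner_deviation u w x \<le> 6 * ennreal (cell_energy u w) +
    12 * (\<Sum>k. \<Sum>v\<in>words k. ennreal (2 ^ k * cell_energy u (w @ v @ [0])) * indicator (cell (w @ v)) x)"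
    (is "_ \<le> _ + 12 * (\<Sum>k. \<Sum>v\<in>words k. ?f k v)")
proof -
  let ?B = "2 * ennreal (cell_energy u w) + 4 * (\<Sum>k. \<Sum>v\<in>words k. ?f k v)"
  have le: "ennreal ((u x - u p)\<^sup>2) \<le> ?B" if p: "p \<in> cell_vertices w" for p
  proof -
    obtain v where v: "\<And>k. v k \<in> words k" "\<And>k. x \<in> cell (w @ v k)"
      "ennreal ((u x - u p)\<^sup>2) \<le> 2 * ennreal (cell_energy u w) +
         2 * (ennreal (2 / (2 - 1)) * (\<Sum>k. ennreal (2 ^ k) * ennreal (cell_energy u (w @ v k @ [0]))))"
      by (rule square_diff_vertex_chain[OF u w x p, of 2]) auto
    note v(3)
    also have "2 * (ennreal (2 / (2 - 1)) * (\<Sum>k. ennreal (2 ^ k) * ennreal (cell_energy u (w @ v k @ [0])))) =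
        4 * (\<Sum>k. ?f k (v k))"
      using v(2) by (simp add: ennreal_mult' flip: mult.assoc)
    also have "(\<Sum>k. ?f k (v k)) \<le> (\<Sum>k. \<Sum>v\<in>words k. ?f k v)"
      using v(1) by (intro suminf_le member_le_sum) auto
    finally show ?thesis
      by (simp add: add_left_mono mult_left_mono)
  qed
  have "corner_deviation u w x \<le> of_nat (card (cell_vertices w)) * ?B"
    unfolding corner_deviation_def sum_constant[symmetric] by (intro sum_mono le)
  also have "\<dots> \<le> 3 * ?B"
  proof (rule mult_right_mono)
    have "card (cell_vertices w) \<le> card {0 :: nat, 1, 2}"
      unfolding cell_vertices_def image_image by (rule card_image_le) simp
    then have "of_nat (card (cell_vertices w)) \<le> (of_nat 3 :: ennreal)"
      unfolding of_nat_le_iff by simp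
    then show "of_nat (card (cell_vertices w)) \<le> (3 :: ennreal)"
      by simp
  qed simp
  also have "\<dots> = (3 * 2) * ennreal (cell_energy u w) + (3 * 4) * (\<Sum>k. \<Sum>v\<in>words k. ?f k v)"
    by (simp only: distrib_left mult.assoc)
  finally show ?thesis
    by simp
qed

text \<open>Integration turns each indicator into the mass 3^-(n+k), which outweighs the factor 2^k
  of the chain.\<close>

lemma corner_variance_le:
  assumes u: "continuous_on gasket u" and w: "w \<in> words n"
  shows "corner_variance u w \<le> 6 * ennreal ((1 / 3) ^ n * cell_energy u w) +
    12 * (\<Sum>k. \<Sum>v\<in>words k. ennreal (2 ^ k * ((1 / 3) ^ (n + k) * cell_energy u (w @ v @ [0]))))"
proof -
  let ?f = "\<lambda>k v x. ennreal (2 ^ k * cell_energy u (w @ v @ [0])) * indicator (cell (w @ v)) x"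
  have [measurable]: "cell w \<in> sets gasket_measure"
    using w by (rule cell_sets)
  have wv: "w @ v \<in> words (n + k)" if "v \<in> words k" for v k
    using w that by (rule words_append)
  have m: "?f k v \<in> borel_measurable gasket_measure" if "v \<in> words k" for k v
    using cell_sets[OF wv[OF that]] by measurable
  have m': "(\<lambda>x. \<Sum>k. \<Sum>v\<in>words k. ?f k v x) \<in> borel_measurable gasket_measure"
    by (intro borel_measurable_suminf_order borel_measurable_sum m)
  have "corner_variance u w \<le> (\<integral>\<^sup>+x. (6 * ennreal (cell_energy u w)) * indicator (cell w) x +
      12 * (\<Sum>k. \<Sum>v\<in>words k. ?f k v x) \<partial>gasket_measure)"
    unfolding corner_variance_def
    by (intro nn_integral_mono) (use corner_deviation_le[OF u w] in \<open>auto split: split_indicator\<close>)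
  also have "\<dots> = 6 * ennreal (cell_energy u w) * emeasure gasket_measure (cell w) +
      12 * (\<Sum>k. \<Sum>v\<in>words k. \<integral>\<^sup>+x. ?f k v x \<partial>gasket_measure)"
  proof -
    have *: "(\<integral>\<^sup>+x. a * indicator (cell w) x + b * F x \<partial>gasket_measure) =
        a * emeasure gasket_measure (cell w) + b * (\<integral>\<^sup>+x. F x \<partial>gasket_measure)"
      if "F \<in> borel_measurable gasket_measure" for F and a b :: ennreal
      using that by (simp add: nn_integral_add nn_integral_cmult nn_integral_cmult_indicator)
    show ?thesis
      unfolding *[OF m'] by (intro arg_cong2[where f = "(+)"] arg_cong2[where f = "(*)"] refl nn_integral_suminf_sum m)
  qed
  also have "(\<Sum>k. \<Sum>v\<in>words k. \<integral>\<^sup>+x. ?f k v x \<partial>gasket_measure) =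
      (\<Sum>k. \<Sum>v\<in>words k. ennreal (2 ^ k * ((1 / 3) ^ (n + k) * cell_energy u (w @ v @ [0]))))"
  proof (intro suminf_cong sum.cong refl)
    fix k v assume "v \<in> words k"
    note v = wv[OF this]
    show "(\<integral>\<^sup>+x. ?f k v x \<partial>gasket_measure) = ennreal (2 ^ k * ((1 / 3) ^ (n + k) * cell_energy u (w @ v @ [0])))"
      unfolding nn_integral_cmult_indicator[OF cell_sets[OF v]] emeasure_cell[OF v]
      by (subst ennreal_mult[symmetric]) (simp_all add: cell_energy_nonneg mult_ac)
  qed
  also have "6 * ennreal (cell_energy u w) * emeasure gasket_measure (cell w) =
      6 * ennreal ((1 / 3) ^ n * cell_energy u w)"
    by (subst ennreal_mult) (simp_all add: emeasure_cell[OF w] cell_energy_nonneg mult_ac)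
  finally show ?thesis .
qed

lemma sum_cell_energy_snoc_le: "(\<Sum>w\<in>words n. cell_energy u (w @ [0])) \<le> graph_energy (Suc n) u"
  unfolding graph_energy_eq sum_words_Suc by (intro sum_mono) (simp add: cell_energy_nonneg)

lemma sum_corner_variance_le:
  assumes u: "continuous_on gasket u"
  shows "(\<Sum>w\<in>words n. corner_variance u w) \<le> 6 * ennreal ((1 / 3) ^ n * graph_energy n u) +
    12 * (\<Sum>k. ennreal (2 ^ k) * ennreal ((1 / 3) ^ (n + k) * graph_energy (Suc (n + k)) u))"
proof -
  let ?e = "\<lambda>k w. ennreal (2 ^ k * ((1 / 3) ^ (n + k) * cell_energy u (w @ [0])))"
  have "(\<Sum>w\<in>words n. corner_variance u w) \<le> (\<Sum>w\<in>words n. 6 * ennreal ((1 / 3) ^ n * cell_energy u w) +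
      12 * (\<Sum>k. \<Sum>v\<in>words k. ?e k (w @ v)))"
    using corner_variance_le[OF u] by (intro sum_mono) simp
  also have "\<dots> = 6 * (\<Sum>w\<in>words n. ennreal ((1 / 3) ^ n * cell_energy u w)) +
      12 * (\<Sum>k. \<Sum>w\<in>words (n + k). ?e k w)"
    by (simp only: sum_distrib_left[symmetric] sum.distrib suminf_sum[OF summableI, symmetric] sum_words_append)
  also have "(\<Sum>w\<in>words n. ennreal ((1 / 3) ^ n * cell_energy u w)) = ennreal ((1 / 3) ^ n * graph_energy n u)"
    by (simp add: sum_ennreal cell_energy_nonneg graph_energy_eq sum_distrib_left)
  also have "(\<Sum>k. \<Sum>w\<in>words (n + k). ?e k w) \<le>
      (\<Sum>k. ennreal (2 ^ k) * ennreal ((1 / 3) ^ (n + k) * graph_energy (Suc (n + k)) u))"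
  proof (intro suminf_le)
    fix k
    have "(\<Sum>w\<in>words (n + k). ?e k w) =
        ennreal (2 ^ k * ((1 / 3) ^ (n + k) * (\<Sum>w\<in>words (n + k). cell_energy u (w @ [0]))))"
      by (simp add: sum_ennreal cell_energy_nonneg sum_distrib_left)
    also have "\<dots> \<le> ennreal (2 ^ k * ((1 / 3) ^ (n + k) * graph_energy (Suc (n + k)) u))"
      by (intro ennreal_leI mult_left_mono sum_cell_energy_snoc_le) auto
    finally show "(\<Sum>w\<in>words (n + k). ?e k w) \<le>
        ennreal (2 ^ k) * ennreal ((1 / 3) ^ (n + k) * graph_energy (Suc (n + k)) u)"
      by (simp add: ennreal_mult')
  qed auto
  finally show ?thesis
    by (simp add: add_left_mono mult_left_mono)
qed

text \<open>The convolution bound applies since \<open>2 < 3 < 2 powr \<beta>\<close>, where also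
  \<open>?b / (?b - 2) \<le> 3\<close>; the total is 6 * 3 + 12 * 3.\<close>

lemma suminf_corner_variance_le:
  assumes u: "continuous_on gasket u" and \<beta>: "gasket_dim < \<beta>"
  shows "(\<Sum>n. ennreal ((2 powr \<beta>) ^ n) * (\<Sum>w\<in>words n. corner_variance u w)) \<le> 54 * discrete_energy \<beta> u"
proof -
  let ?b = "2 powr \<beta>" and ?E = "discrete_energy \<beta> u"
  note b = three_less_two_powr[OF \<beta>]
  define T where "T m = ennreal ((1 / 3) ^ m * graph_energy (Suc m) u)" for m
  have "(\<Sum>n. ennreal (?b ^ n) * (\<Sum>w\<in>words n. corner_variance u w)) \<le>
      (\<Sum>n. ennreal (?b ^ n) * (6 * ennreal ((1 / 3) ^ n * graph_energy n u) +
        12 * (\<Sum>k. ennreal (2 ^ k) * T (n + k))))"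
    unfolding T_def by (intro suminf_le mult_left_mono sum_corner_variance_le u) auto
  also have "\<dots> = (\<Sum>n. 6 * ennreal ((?b / 3) ^ n * graph_energy n u) +
      12 * (\<Sum>k. ennreal (?b ^ n) * (ennreal (2 ^ k) * T (n + k))))"
  proof (rule suminf_cong)
    fix n
    have eq: "ennreal ((?b / 3) ^ n * graph_energy n u) = ennreal (?b ^ n) * ennreal ((1 / 3) ^ n * graph_energy n u)"
      by (simp add: power_divide flip: ennreal_mult')
    show "ennreal (?b ^ n) * (6 * ennreal ((1 / 3) ^ n * graph_energy n u) +
        12 * (\<Sum>k. ennreal (2 ^ k) * T (n + k))) = 6 * ennreal ((?b / 3) ^ n * graph_energy n u) +
      12 * (\<Sum>k. ennreal (?b ^ n) * (ennreal (2 ^ k) * T (n + k)))"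
      by (simp only: eq distrib_left ennreal_suminf_cmult
          mult.left_commute[of "ennreal (?b ^ n)" 6] mult.left_commute[of "ennreal (?b ^ n)" 12])
  qed
  also have "\<dots> = 6 * (\<Sum>n. ennreal ((?b / 3) ^ n * graph_energy n u)) +
      12 * (\<Sum>n. \<Sum>k. ennreal (?b ^ n) * (ennreal (2 ^ k) * T (n + k)))"
    by (simp only: suminf_add[OF summableI summableI, symmetric] ennreal_suminf_cmult)
  also have "\<dots> \<le> 6 * (3 * ?E) + 12 * (3 * ?E)"
  proof (intro add_mono mult_left_mono suminf_graph_energy_le_discrete_energy \<beta>)
    have "(\<Sum>n. \<Sum>k. ennreal (?b ^ n) * (ennreal (2 ^ k) * T (n + k))) \<le>
        ennreal (?b / (?b - 2)) * (\<Sum>m. ennreal (?b ^ m) * T m)"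
      using b by (intro suminf_convolution_le) auto
    also have "\<dots> \<le> ennreal 3 * ?E"
    proof (intro mult_mono ennreal_leI)
      show "?b / (?b - 2) \<le> 3"
        using b by (simp add: divide_le_eq)
      show "(\<Sum>m. ennreal (?b ^ m) * T m) \<le> ?E"
        unfolding discrete_energy_eq
      proof (rule suminf_le)
        fix m
        have "ennreal (?b ^ m) * T m = ennreal ((?b / 3) ^ m * graph_energy (Suc m) u)"
          unfolding T_def by (simp add: power_divide flip: ennreal_mult')
        also have "\<dots> \<le> ennreal ((?b / 3) ^ Suc m * graph_energy (Suc m) u)"
          using b by (intro ennreal_leI mult_right_mono power_increasing graph_energy_nonneg) auto
        finally show "ennreal (?b ^ m) * T m \<le> ennreal ((?b / 3) ^ Suc m * graph_energy (Suc m) u)" .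
      qed auto
    qed auto
    finally show "(\<Sum>n. \<Sum>k. ennreal (?b ^ n) * (ennreal (2 ^ k) * T (n + k))) \<le> 3 * ?E"
      by simp
  qed auto
  also have "\<dots> = (6 * 3 + 12 * 3) * ?E"
    by (simp only: distrib_right mult.assoc)
  finally show ?thesis
    by simp
qed

section \<open>Splitting the double integral by adjacent cells\<close>

text \<open>Points in adjacent cells of level \<open>n\<close> are within \<open>4 / 2 ^ n\<close>
  of each other through a common corner, so for distinct points adjacency fails at some level.
  \<open>n\<close> precedes the first failure, and the cells at level \<open>n + 1\<close> give the
  lower bound on the distance.\<close>

lemma exists_last_adjacent:
  assumes x: "x \<in> gasket" and y: "y \<in> gasket" and "x \<noteq> y"
  obtains n w v where "w \<in> words n" "v \<in> words n" "adjacent w v" "x \<in> cell w" "y \<in> cell v"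
    "(1 / 2) ^ Suc n / 2 \<le> dist x y"
proof -
  define P where "P n \<longleftrightarrow> (\<exists>w\<in>words n. \<exists>v\<in>words n. adjacent w v \<and> x \<in> cell w \<and> y \<in> cell v)" for n
  have "P 0"
    using x y by (simp add: P_def)
  have "\<exists>n. \<not> P n"
  proof -
    obtain n where n: "(1 / 2) ^ n < dist x y / 6"
      using real_arch_pow_inv[of "dist x y / 6" "1 / 2"] \<open>x \<noteq> y\<close> by auto
    have "\<not> P n"
    proof
      assume "P n"
      then obtain w v where wv: "w \<in> words n" "v \<in> words n" "adjacent w v" "x \<in> cell w" "y \<in> cell v"
        by (auto simp: P_def)
      obtain p where p: "p \<in> cell_vertices w" "p \<in> cell_vertices v"
        using adjacent_common_vertex[OF wv(1,2,3)] .
      have "dist x p \<le> 2 * (1 / 2) ^ n" "dist y p \<le> 2 * (1 / 2) ^ n"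
        using dist_cell[OF wv(4), of p] dist_cell[OF wv(5), of p] p cell_vertices_subset
        by (auto simp: length_words[OF wv(1)] length_words[OF wv(2)])
      then have "dist x y \<le> 4 * (1 / 2) ^ n"
        using dist_triangle2[of x y p] by simp
      moreover have "0 < (1 / 2 :: real) ^ n"
        by simp
      ultimately show False
        using n by linarith
    qed
    then show ?thesis
      by blast
  qed
  then obtain m where "\<not> P m"
    by blast
  define l where "l = (LEAST n. \<not> P n)"
  have "\<not> P l"
    unfolding l_def using \<open>\<not> P m\<close> by (rule LeastI)
  then obtain n where l: "l = Suc n"
    using \<open>P 0\<close> by (cases l) auto
  have "P n"
    using not_less_Least[of n "\<lambda>n. \<not> P n"] l unfolding l_def[symmetric] by simp
  then obtain w v where wv: "w \<in> words n" "v \<in> words n" "adjacent w v" "x \<in> cell w" "y \<in> cell v"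
    by (auto simp: P_def)
  obtain w' v' where w': "w' \<in> words (Suc n)" "x \<in> cell w'" and v': "v' \<in> words (Suc n)" "y \<in> cell v'"
    using x y gasket_eq_UN[of "Suc n"] by blast
  have "\<not> adjacent w' v'"
    using \<open>\<not> P l\<close> w' v' unfolding l P_def by blast
  then have "(1 / 2) ^ Suc n / 2 \<le> dist x y"
    using not_adjacent_dist[OF w'(1) v'(1) _ w'(2) v'(2)] by simp
  with wv show thesis
    by (rule that)
qed

lemma two_powr_dim_sum: "2 powr (gasket_dim + \<beta>) = 3 * 2 powr \<beta>"
  by (simp add: powr_add two_powr_gasket_dim)

lemma square_diff_adjacent_le:
  assumes wv: "w \<in> words n" "v \<in> words n" "adjacent w v"
  shows "ennreal ((u x - u y)\<^sup>2) \<le> 2 * corner_deviation u w x + 2 * corner_deviation u v y"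
proof -
  obtain p where p: "p \<in> cell_vertices w" "p \<in> cell_vertices v"
    using adjacent_common_vertex[OF wv] .
  have le: "ennreal ((u z - u p)\<^sup>2) \<le> corner_deviation u w' z" if "p \<in> cell_vertices w'" for w' z
    unfolding corner_deviation_def using that by (intro member_le_sum) auto
  have "ennreal ((u x - u y)\<^sup>2) \<le> 2 * ennreal ((u x - u p)\<^sup>2) + 2 * ennreal ((u y - u p)\<^sup>2)"
    by (rule ennreal_square_add_le)
  also have "\<dots> \<le> 2 * corner_deviation u w x + 2 * corner_deviation u v y"
    by (intro add_mono mult_left_mono le p) auto
  finally show ?thesis .
qed

definition adjacent_pairs :: "nat \<Rightarrow> (nat list \<times> nat list) set" where
  "adjacent_pairs n = (SIGMA w:words n. {v \<in> words n. adjacent w v})"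

definition pair_deviation :: "(real \<times> real \<Rightarrow> real) \<Rightarrow> nat list \<times> nat list \<Rightarrow> real \<times> real \<Rightarrow> real \<times> real \<Rightarrow> ennreal" where
  "pair_deviation u = (\<lambda>(w, v) x y. indicator (cell w) x * indicator (cell v) y *
     (2 * corner_deviation u w x + 2 * corner_deviation u v y))"

lemma adjacent_pairs_iff:
  "(w, v) \<in> adjacent_pairs n \<longleftrightarrow> w \<in> words n \<and> v \<in> words n \<and> adjacent w v"
  by (auto simp: adjacent_pairs_def)

lemma finite_adjacent_pairs [simp]: "finite (adjacent_pairs n)"
  unfolding adjacent_pairs_def by (intro finite_SigmaI) auto

text \<open>The exponent \<open>n + 2\<close> reflects
  \<open>dist x y \<ge> (1 / 2) ^ (n + 2)\<close>. One term would do for each pair of points;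
  summing over all levels and pairs removes the dependence of the choice on \<open>x\<close> and
  \<open>y\<close>. On the diagonal the quotient is \<open>0 / 0 = 0\<close>.\<close>

lemma nonlocal_integrand_le:
  assumes x: "x \<in> gasket" and y: "y \<in> gasket" and s: "0 < s"
  shows "ennreal ((u x - u y)\<^sup>2 / dist x y powr s) \<le>
    (\<Sum>n. \<Sum>q\<in>adjacent_pairs n. ennreal ((2 powr s) ^ (n + 2)) * pair_deviation u q x y)"
    (is "_ \<le> (\<Sum>n. \<Sum>q\<in>adjacent_pairs n. ?f n q)")
proof (cases "x = y")
  case False
  obtain n w v where wv: "w \<in> words n" "v \<in> words n" "adjacent w v" "x \<in> cell w" "y \<in> cell v"
    "(1 / 2) ^ Suc n / 2 \<le> dist x y"
    by (rule exists_last_adjacent[OF x y False]) blast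
  have "(1 / (2 powr s)) ^ (n + 2) = ((1 / 2) ^ (n + 2)) powr s"
    by (rule half_power_powr[symmetric])
  also have "\<dots> \<le> dist x y powr s"
    using wv(6) s by (intro powr_mono2) auto
  finally have le: "(1 / (2 powr s)) ^ (n + 2) \<le> dist x y powr s" .
  have "(u x - u y)\<^sup>2 / dist x y powr s \<le> (u x - u y)\<^sup>2 / (1 / (2 powr s)) ^ (n + 2)"
    using False by (intro divide_left_mono le mult_pos_pos) auto
  also have "\<dots> = (2 powr s) ^ (n + 2) * (u x - u y)\<^sup>2"
    by (simp add: power_divide)
  finally have "ennreal ((u x - u y)\<^sup>2 / dist x y powr s) \<le> ennreal ((2 powr s) ^ (n + 2) * (u x - u y)\<^sup>2)"
    by (rule ennreal_leI)
  also have "\<dots> = ennreal ((2 powr s) ^ (n + 2)) * ennreal ((u x - u y)\<^sup>2)"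
    by (rule ennreal_mult) auto
  also have "\<dots> \<le> ennreal ((2 powr s) ^ (n + 2)) * (2 * corner_deviation u w x + 2 * corner_deviation u v y)"
    by (intro mult_left_mono square_diff_adjacent_le[OF wv(1-3)]) auto
  also have "\<dots> = ?f n (w, v)"
    using wv(4,5) by (simp add: pair_deviation_def)
  also have "\<dots> \<le> (\<Sum>q\<in>adjacent_pairs n. ?f n q)"
    using wv(1-3) by (intro member_le_sum) (auto simp: adjacent_pairs_iff)
  also have "\<dots> \<le> (\<Sum>n. \<Sum>q\<in>adjacent_pairs n. ?f n q)"
    using sum_le_suminf[of "\<lambda>n. \<Sum>q\<in>adjacent_pairs n. ?f n q" "{n}"] by simp
  finally show ?thesis .
qed simp

text \<open>Each word has at most 7 partners, and by symmetry both summands contribute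
  equally.\<close>

lemma sum_adjacent_pairs_le:
  fixes f :: "nat list \<Rightarrow> ennreal"
  shows "(\<Sum>(w, v)\<in>adjacent_pairs n. f w + f v) \<le> 14 * (\<Sum>w\<in>words n. f w)"
proof -
  have "(\<Sum>(w, v)\<in>adjacent_pairs n. f w) = (\<Sum>w\<in>words n. \<Sum>v\<in>{v \<in> words n. adjacent w v}. f w)"
    unfolding adjacent_pairs_def by (rule sum.Sigma[symmetric]) auto
  also have "\<dots> \<le> (\<Sum>w\<in>words n. 7 * f w)"
  proof (rule sum_mono)
    fix w assume "w \<in> words n"
    then have "of_nat (card {v \<in> words n. adjacent w v}) \<le> (of_nat 7 :: ennreal)"
      unfolding of_nat_le_iff by (rule card_adjacent)
    then have "of_nat (card {v \<in> words n. adjacent w v}) * f w \<le> 7 * f w"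
      by (intro mult_right_mono) auto
    then show "(\<Sum>v\<in>{v \<in> words n. adjacent w v}. f w) \<le> 7 * f w"
      by simp
  qed
  finally have 7: "(\<Sum>(w, v)\<in>adjacent_pairs n. f w) \<le> 7 * (\<Sum>w\<in>words n. f w)"
    by (simp only: sum_distrib_left)
  have "(\<Sum>(w, v)\<in>adjacent_pairs n. f v) = (\<Sum>(w, v)\<in>adjacent_pairs n. f w)"
    by (rule sum.reindex_bij_witness[of _ prod.swap prod.swap]) (auto simp: adjacent_pairs_iff adjacent_sym)
  then have "(\<Sum>(w, v)\<in>adjacent_pairs n. f w + f v) =
      (\<Sum>(w, v)\<in>adjacent_pairs n. f w) + (\<Sum>(w, v)\<in>adjacent_pairs n. f w)"
    by (simp add: sum.distrib case_prod_unfold)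
  also have "\<dots> \<le> 7 * (\<Sum>w\<in>words n. f w) + 7 * (\<Sum>w\<in>words n. f w)"
    by (intro add_mono 7)
  also have "\<dots> = (7 + 7) * (\<Sum>w\<in>words n. f w)"
    by (simp only: distrib_right)
  finally show ?thesis
    by simp
qed

lemma measurable_pair_deviation:
  assumes u: "u \<in> borel_measurable gasket_measure" and q: "q \<in> adjacent_pairs n"
  shows "pair_deviation u q x \<in> borel_measurable gasket_measure"
    and "(\<lambda>x. \<integral>\<^sup>+y. pair_deviation u q x y \<partial>gasket_measure) \<in> borel_measurable gasket_measure"
proof -
  obtain w v where wv: "q = (w, v)" "w \<in> words n" "v \<in> words n"
    using q by (auto simp: adjacent_pairs_def)
  note [measurable] = u cell_sets[OF wv(2)] cell_sets[OF wv(3)]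
  show "pair_deviation u q x \<in> borel_measurable gasket_measure"
    unfolding pair_deviation_def wv(1) prod.case by measurable
  show "(\<lambda>x. \<integral>\<^sup>+y. pair_deviation u q x y \<partial>gasket_measure) \<in> borel_measurable gasket_measure"
    unfolding pair_deviation_def wv(1) prod.case by (rule gasket_measure.borel_measurable_nn_integral) measurable
qed

lemma nn_integral_pair_deviation:
  assumes u: "u \<in> borel_measurable gasket_measure" and w: "w \<in> words n" and v: "v \<in> words n"
  shows "(\<integral>\<^sup>+x. \<integral>\<^sup>+y. pair_deviation u (w, v) x y \<partial>gasket_measure \<partial>gasket_measure) =
    ennreal ((1 / 3) ^ n) * (2 * (corner_variance u w + corner_variance u v))"
proof -
  note [measurable] = u cell_sets[OF w] cell_sets[OF v]
  have "(\<integral>\<^sup>+y. pair_deviation u (w, v) x y \<partial>gasket_measure) =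
      2 * ennreal ((1 / 3) ^ n) * (indicator (cell w) x * corner_deviation u w x) +
      2 * corner_variance u v * indicator (cell w) x" for x
  proof -
    have "(\<integral>\<^sup>+y. pair_deviation u (w, v) x y \<partial>gasket_measure) =
      (\<integral>\<^sup>+y. 2 * (indicator (cell w) x * corner_deviation u w x) * indicator (cell v) y +
        2 * indicator (cell w) x * (indicator (cell v) y * corner_deviation u v y) \<partial>gasket_measure)"
      by (intro nn_integral_cong) (simp add: pair_deviation_def distrib_left mult_ac)
    also have "\<dots> = 2 * (indicator (cell w) x * corner_deviation u w x) * emeasure gasket_measure (cell v) +
        2 * indicator (cell w) x * corner_variance u v"
      unfolding corner_variance_def
      by (subst nn_integral_add; simp add: nn_integral_cmult nn_integral_cmult_indicator)
    finally show ?thesis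
      by (simp add: emeasure_cell[OF v] mult_ac)
  qed
  then have "(\<integral>\<^sup>+x. \<integral>\<^sup>+y. pair_deviation u (w, v) x y \<partial>gasket_measure \<partial>gasket_measure) =
     (\<integral>\<^sup>+x. 2 * ennreal ((1 / 3) ^ n) * (indicator (cell w) x * corner_deviation u w x) +
      2 * corner_variance u v * indicator (cell w) x \<partial>gasket_measure)"
    by simp
  also have "\<dots> = 2 * ennreal ((1 / 3) ^ n) * corner_variance u w +
      2 * corner_variance u v * emeasure gasket_measure (cell w)"
    unfolding corner_variance_def[of u w]
    by (subst nn_integral_add; simp add: nn_integral_cmult nn_integral_cmult_indicator)
  finally show ?thesis
    by (simp add: emeasure_cell[OF w] distrib_left mult_ac)
qed

lemma nonlocal_energy_le_corner_variance:
  assumes u: "continuous_on gasket u" and \<beta>: "gasket_dim < \<beta>"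
  shows "nonlocal_energy \<beta> u \<le> ennreal (28 * (2 powr (gasket_dim + \<beta>))\<^sup>2) *
    (\<Sum>n. ennreal ((2 powr \<beta>) ^ n) * (\<Sum>w\<in>words n. corner_variance u w))"
proof -
  let ?s = "gasket_dim + \<beta>" and ?M = gasket_measure
  let ?c = "\<lambda>n. ennreal ((2 powr ?s) ^ (n + 2))" and ?V = "\<lambda>n. \<Sum>w\<in>words n. corner_variance u w"
  note um = borel_measurable_gasket_measure[OF u]
  note m = measurable_pair_deviation[OF um]
  have fm: "(\<lambda>y. ?c n * pair_deviation u q x y) \<in> borel_measurable ?M"
    "(\<lambda>x. \<integral>\<^sup>+y. ?c n * pair_deviation u q x y \<partial>?M) \<in> borel_measurable ?M"
    if "q \<in> adjacent_pairs n" for n q x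
    using m[OF that] by (simp_all add: nn_integral_cmult)
  have s: "0 < ?s"
    using \<beta> gasket_dim_pos by simp
  have "nonlocal_energy \<beta> u \<le>
      (\<integral>\<^sup>+x. \<integral>\<^sup>+y. (\<Sum>n. \<Sum>q\<in>adjacent_pairs n. ?c n * pair_deviation u q x y) \<partial>?M \<partial>?M)"
    unfolding nonlocal_energy_def by (intro nn_integral_mono nonlocal_integrand_le s) auto
  also have "\<dots> = (\<integral>\<^sup>+x. (\<Sum>n. \<Sum>q\<in>adjacent_pairs n. \<integral>\<^sup>+y. ?c n * pair_deviation u q x y \<partial>?M) \<partial>?M)"
    by (intro nn_integral_cong nn_integral_suminf_sum fm)
  also have "\<dots> = (\<Sum>n. \<Sum>q\<in>adjacent_pairs n. \<integral>\<^sup>+x. \<integral>\<^sup>+y. ?c n * pair_deviation u q x y \<partial>?M \<partial>?M)"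
    by (intro nn_integral_suminf_sum fm)
  also have "\<dots> = (\<Sum>n. \<Sum>q\<in>adjacent_pairs n.
      ?c n * (ennreal ((1 / 3) ^ n) * (2 * (case q of (w, v) \<Rightarrow> corner_variance u w + corner_variance u v))))"
  proof (intro suminf_cong sum.cong refl)
    fix n q assume q: "q \<in> adjacent_pairs n"
    then obtain w v where wv: "q = (w, v)" "w \<in> words n" "v \<in> words n"
      by (auto simp: adjacent_pairs_def)
    show "(\<integral>\<^sup>+x. \<integral>\<^sup>+y. ?c n * pair_deviation u q x y \<partial>?M \<partial>?M) =
      ?c n * (ennreal ((1 / 3) ^ n) * (2 * (case q of (w, v) \<Rightarrow> corner_variance u w + corner_variance u v)))"
      using m[OF q] nn_integral_pair_deviation[OF um wv(2,3)] by (simp add: nn_integral_cmult wv(1))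
  qed
  also have "\<dots> = (\<Sum>n. (?c n * ennreal ((1 / 3) ^ n) * 2) *
      (\<Sum>(w, v)\<in>adjacent_pairs n. corner_variance u w + corner_variance u v))"
    by (simp only: sum_distrib_left mult.assoc)
  also have "\<dots> \<le> (\<Sum>n. (?c n * ennreal ((1 / 3) ^ n) * 2) * (14 * ?V n))"
    by (intro suminf_le mult_left_mono sum_adjacent_pairs_le) auto
  also have "\<dots> = (\<Sum>n. ennreal (28 * (2 powr ?s)\<^sup>2) * (ennreal ((2 powr \<beta>) ^ n) * ?V n))"
  proof (rule suminf_cong)
    fix n
    \<comment> \<open>The mass 3^-n of the partner cell cancels the factor 3 in
      \<open>2 powr ?s = 3 * 2 powr \<beta>\<close>; two powers remain from the exponent
      \<open>n + 2\<close>.\<close>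
    have "(2 powr ?s) ^ (n + 2) * (1 / 3) ^ n * 2 * 14 = 28 * (2 powr ?s)\<^sup>2 * (2 powr \<beta>) ^ n"
      by (simp add: power_add two_powr_dim_sum power_mult_distrib power_divide power2_eq_square)
    then have "?c n * ennreal ((1 / 3) ^ n) * ennreal 2 * ennreal 14 =
        ennreal (28 * (2 powr ?s)\<^sup>2) * ennreal ((2 powr \<beta>) ^ n)"
      by (simp only: ennreal_mult'[symmetric] zero_le_power powr_ge_zero) (simp flip: ennreal_mult' ennreal_numeral)
    then show "(?c n * ennreal ((1 / 3) ^ n) * 2) * (14 * ?V n) =
        ennreal (28 * (2 powr ?s)\<^sup>2) * (ennreal ((2 powr \<beta>) ^ n) * ?V n)"
      by (simp only: mult.assoc[symmetric] ennreal_numeral)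
  qed
  finally show ?thesis
    by simp
qed

lemma nonlocal_energy_le_discrete_energy:
  assumes "gasket_dim < \<beta>"
  obtains K where "0 < K" "\<And>u. continuous_on gasket u \<Longrightarrow> nonlocal_energy \<beta> u \<le> ennreal K * discrete_energy \<beta> u"
proof
  let ?c = "28 * (2 powr (gasket_dim + \<beta>))\<^sup>2"
  show "0 < ?c * 54"
    by simp
  fix u :: "real \<times> real \<Rightarrow> real" assume u: "continuous_on gasket u"
  have "nonlocal_energy \<beta> u \<le> ennreal ?c * (\<Sum>n. ennreal ((2 powr \<beta>) ^ n) * (\<Sum>w\<in>words n. corner_variance u w))"
    by (rule nonlocal_energy_le_corner_variance[OF u assms])
  also have "\<dots> \<le> ennreal ?c * (54 * discrete_energy \<beta> u)"
    by (intro mult_left_mono suminf_corner_variance_le u assms) auto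
  also have "\<dots> = ennreal (?c * 54) * discrete_energy \<beta> u"
    by (subst ennreal_mult') (simp_all add: mult.assoc)
  finally show "nonlocal_energy \<beta> u \<le> ennreal (?c * 54) * discrete_energy \<beta> u" .
qed

subsection \<open>The sum is bounded by the double integral\<close>

definition cell_average :: "(real \<times> real \<Rightarrow> real) \<Rightarrow> nat list \<Rightarrow> real" where
  "cell_average u w = (\<integral>x. indicator (cell w) x * u x \<partial>gasket_measure) / measure gasket_measure (cell w)"

lemma integrable_gasket_measure:
  assumes u: "continuous_on gasket u"
  shows "integrable gasket_measure (u :: _ \<Rightarrow> real)"
proof -
  have "bounded (u ` gasket)"
    using compact_continuous_image[OF u compact_gasket] by (rule compact_imp_bounded)
  then obtain B where "\<And>x. x \<in> gasket \<Longrightarrow> norm (u x) \<le> B"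
    by (auto simp: bounded_iff)
  then show ?thesis
    by (intro gasket_measure.integrable_const_bound[of _ B] borel_measurable_gasket_measure u AE_I2) auto
qed

text \<open>The tangent of the square at the average replaces Jensen's inequality.\<close>

lemma cell_average_square_le:
  assumes u: "continuous_on gasket u" and w: "w \<in> words n"
  shows "ennreal ((1 / 3) ^ n * (cell_average u w - c)\<^sup>2) \<le>
    (\<integral>\<^sup>+x. indicator (cell w) x * ennreal ((u x - c)\<^sup>2) \<partial>gasket_measure)"
proof -
  let ?M = gasket_measure and ?I = "indicator (cell w) :: _ \<Rightarrow> real"
  define A where "A = cell_average u w"
  have [measurable]: "cell w \<in> sets ?M"
    using w by (rule cell_sets)
  have m: "measure ?M (cell w) = (1 / 3) ^ n"
    using w by (rule measure_cell)
  have iu: "integrable ?M u"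
    using u by (rule integrable_gasket_measure)
  have i1: "integrable ?M (\<lambda>x. ?I x * u x)"
    using integrable_mult_indicator[OF _ iu, of "cell w"] by simp
  have i0: "integrable ?M ?I"
    by (rule gasket_measure.integrable_const_bound[of _ 1]) (auto intro!: AE_I2 simp: indicator_def)
  have i2: "integrable ?M (\<lambda>x. ?I x * (u x - c)\<^sup>2)"
  proof -
    have "integrable ?M (\<lambda>x. (u x - c)\<^sup>2)"
      by (intro integrable_gasket_measure continuous_intros u)
    then show ?thesis
      using integrable_mult_indicator[of "cell w" ?M "\<lambda>x. (u x - c)\<^sup>2"] by simp
  qed
  have eq: "?I x * ((A - c)\<^sup>2 + 2 * (A - c) * (u x - A)) =
      ((A - c)\<^sup>2 - 2 * (A - c) * A) * ?I x + 2 * (A - c) * (?I x * u x)" for x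
    by (simp add: algebra_simps)
  have "(\<integral>x. ?I x * ((A - c)\<^sup>2 + 2 * (A - c) * (u x - A)) \<partial>?M) =
      ((A - c)\<^sup>2 - 2 * (A - c) * A) * (1 / 3) ^ n + 2 * (A - c) * (\<integral>x. ?I x * u x \<partial>?M)"
    unfolding eq using i0 i1 m cell_subset[OF w] by (simp add: Int_absorb2)
  also have "(\<integral>x. ?I x * u x \<partial>?M) = (1 / 3) ^ n * A"
    by (simp add: A_def cell_average_def m)
  finally have e: "(\<integral>x. ?I x * ((A - c)\<^sup>2 + 2 * (A - c) * (u x - A)) \<partial>?M) = (1 / 3) ^ n * (A - c)\<^sup>2"
    by (simp add: algebra_simps)
  have le: "(\<integral>x. ?I x * ((A - c)\<^sup>2 + 2 * (A - c) * (u x - A)) \<partial>?M) \<le> (\<integral>x. ?I x * (u x - c)\<^sup>2 \<partial>?M)"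
  proof (rule integral_mono[OF _ i2])
    show "integrable ?M (\<lambda>x. ?I x * ((A - c)\<^sup>2 + 2 * (A - c) * (u x - A)))"
      unfolding eq using i0 i1 by simp
    fix x
    have "(u x - c)\<^sup>2 - ((A - c)\<^sup>2 + 2 * (A - c) * (u x - A)) = (u x - A)\<^sup>2"
      by (simp add: power2_eq_square algebra_simps)
    then have "(A - c)\<^sup>2 + 2 * (A - c) * (u x - A) \<le> (u x - c)\<^sup>2"
      using zero_le_power2[of "u x - A"] by linarith
    then show "?I x * ((A - c)\<^sup>2 + 2 * (A - c) * (u x - A)) \<le> ?I x * (u x - c)\<^sup>2"
      by (rule mult_left_mono) simp
  qed
  have "ennreal ((1 / 3) ^ n * (A - c)\<^sup>2) \<le> ennreal (\<integral>x. ?I x * (u x - c)\<^sup>2 \<partial>?M)"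
    using le unfolding e by (rule ennreal_leI)
  also have "\<dots> = (\<integral>\<^sup>+x. ennreal (?I x * (u x - c)\<^sup>2) \<partial>?M)"
    by (rule nn_integral_eq_integral[symmetric, OF i2]) auto
  also have "\<dots> = (\<integral>\<^sup>+x. indicator (cell w) x * ennreal ((u x - c)\<^sup>2) \<partial>?M)"
    by (intro nn_integral_cong) (simp split: split_indicator)
  finally show ?thesis
    by (simp add: A_def)
qed

definition cell_variance :: "(real \<times> real \<Rightarrow> real) \<Rightarrow> nat list \<Rightarrow> ennreal" where
  "cell_variance u w = (\<integral>\<^sup>+x. \<integral>\<^sup>+y. indicator (cell w) x * indicator (cell w) y *
     ennreal ((u x - u y)\<^sup>2) \<partial>gasket_measure \<partial>gasket_measure)"

text \<open>\<open>cell_average_square_le\<close> is used twice: on the subcell with the constant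
  \<open>?A\<close>, enlarged to the whole cell, and then for each \<open>x\<close> on the cell with
  the constant \<open>u x\<close>. The factor undoes the masses 3^-n and 3^-(n+1).\<close>

lemma cell_average_diff_le:
  assumes u: "continuous_on gasket u" and w: "w \<in> words n" and i: "i \<in> {0, 1, 2}"
  shows "ennreal ((cell_average u w - cell_average u (w @ [i]))\<^sup>2) \<le> ennreal (3 * 9 ^ n) * cell_variance u w"
proof -
  let ?M = gasket_measure and ?A = "cell_average u w" and ?B = "cell_average u (w @ [i])"
  have wi: "w @ [i] \<in> words (Suc n)"
    using w i by (auto simp: words_def)
  have [measurable]: "cell w \<in> sets ?M"
    using w by (rule cell_sets)
  note [measurable] = borel_measurable_gasket_measure[OF u]
  have "[i] \<in> words 1"
    using i by (auto simp: words_def)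
  then have sub: "cell (w @ [i]) \<subseteq> cell w"
    by (rule cell_append_subset)
  have "ennreal ((1 / 3) ^ n * ((1 / 3) ^ Suc n * (?A - ?B)\<^sup>2)) = ennreal ((1 / 3) ^ n) * ennreal ((1 / 3) ^ Suc n * (?B - ?A)\<^sup>2)"
    unfolding power2_commute[of ?B ?A] by (rule ennreal_mult') simp
  also have "\<dots> \<le> ennreal ((1 / 3) ^ n) * (\<integral>\<^sup>+x. indicator (cell (w @ [i])) x * ennreal ((u x - ?A)\<^sup>2) \<partial>?M)"
    by (intro mult_left_mono cell_average_square_le u wi) auto
  also have "\<dots> \<le> ennreal ((1 / 3) ^ n) * (\<integral>\<^sup>+x. indicator (cell w) x * ennreal ((u x - ?A)\<^sup>2) \<partial>?M)"
    using sub by (intro mult_left_mono nn_integral_mono mult_right_mono) (auto split: split_indicator)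
  also have "\<dots> = (\<integral>\<^sup>+x. indicator (cell w) x * ennreal ((1 / 3) ^ n * (?A - u x)\<^sup>2) \<partial>?M)"
    by (simp add: nn_integral_cmult[symmetric] ennreal_mult' mult_ac power2_commute)
  also have "\<dots> \<le> (\<integral>\<^sup>+x. indicator (cell w) x *
      (\<integral>\<^sup>+y. indicator (cell w) y * ennreal ((u y - u x)\<^sup>2) \<partial>?M) \<partial>?M)"
    by (intro nn_integral_mono mult_left_mono cell_average_square_le u w) auto
  also have "\<dots> = cell_variance u w"
    unfolding cell_variance_def
    by (intro nn_integral_cong) (simp add: nn_integral_cmult[symmetric] mult.assoc power2_commute)
  finally have le: "ennreal ((1 / 3) ^ n * ((1 / 3) ^ Suc n * (?A - ?B)\<^sup>2)) \<le> cell_variance u w" .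
  have "(?A - ?B)\<^sup>2 = 3 * 9 ^ n * ((1 / 3) ^ n * ((1 / 3) ^ Suc n * (?A - ?B)\<^sup>2))"
  proof -
    have "(9 :: real) ^ n * ((1 / 3) ^ n * (1 / 3) ^ n) = 1"
      unfolding power_mult_distrib[symmetric] by simp
    then show ?thesis
      by (simp add: mult_ac)
  qed
  then have "ennreal ((?A - ?B)\<^sup>2) = ennreal (3 * 9 ^ n) * ennreal ((1 / 3) ^ n * ((1 / 3) ^ Suc n * (?A - ?B)\<^sup>2))"
    by (subst ennreal_mult[symmetric]) auto
  also have "\<dots> \<le> ennreal (3 * 9 ^ n) * cell_variance u w"
    by (intro mult_left_mono le) auto
  finally show ?thesis .
qed

text \<open>Appending the letter \<open>i\<close> repeatedly shrinks the cell to the image of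
  \<open>corner i\<close>, the fixed point of \<open>gasket_map i\<close>.\<close>

lemma cell_average_tendsto:
  assumes u: "continuous_on gasket u" and w: "w \<in> words n" and i: "i \<in> {0, 1, 2}"
  shows "(\<lambda>k. cell_average u (w @ replicate k i)) \<longlonglongrightarrow> u (word_map w (corner i))"
proof (rule LIMSEQ_I)
  let ?p = "word_map w (corner i)"
  fix e :: real assume "0 < e"
  have p: "?p \<in> gasket"
    using w i by (intro word_map_mem_gasket corner_mem_gasket)
  obtain d where d: "0 < d" "\<And>y. y \<in> gasket \<Longrightarrow> dist y ?p < d \<Longrightarrow> dist (u y) (u ?p) < e / 2"
    using u p \<open>0 < e\<close> unfolding continuous_on_iff by (meson half_gt_zero)
  obtain N where N: "(1 / 2) ^ N < d / 2"
    using real_arch_pow_inv[of "d / 2" "1 / 2"] d(1) by auto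
  have "norm (cell_average u (w @ replicate k i) - u ?p) < e" if k: "N \<le> k" for k
  proof -
    let ?v = "w @ replicate k i"
    have v: "?v \<in> words (n + k)"
      using w i by (intro words_append words_replicate)
    have "word_map (replicate k i) (corner i) = corner i"
      by (induction k) (auto simp: gasket_map_corner)
    then have pv: "?p \<in> cell ?v"
      unfolding cell_def using corner_mem_gasket[OF i] by (auto intro!: image_eqI[of _ _ "corner i"])
    have near: "(u x - u ?p)\<^sup>2 \<le> (e / 2)\<^sup>2" if x: "x \<in> cell ?v" for x
    proof -
      have "dist x ?p \<le> 2 * (1 / 2) ^ (n + k)"
        using dist_cell[OF x pv] length_words[OF v] by simp
      also have "\<dots> \<le> 2 * (1 / 2) ^ N"
        using k by (intro mult_left_mono power_decreasing) auto
      also have "\<dots> < d"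
        using N by simp
      finally have "dist (u x) (u ?p) < e / 2"
        using d(2) x cell_subset[OF v] by blast
      then show ?thesis
        by (intro abs_le_square_iff[THEN iffD1]) (auto simp: dist_real_def)
    qed
    have "ennreal ((1 / 3) ^ (n + k) * (cell_average u ?v - u ?p)\<^sup>2) \<le>
        (\<integral>\<^sup>+x. indicator (cell ?v) x * ennreal ((u x - u ?p)\<^sup>2) \<partial>gasket_measure)"
      by (rule cell_average_square_le[OF u v])
    also have "\<dots> \<le> (\<integral>\<^sup>+x. ennreal ((e / 2)\<^sup>2) * indicator (cell ?v) x \<partial>gasket_measure)"
      by (intro nn_integral_mono) (auto split: split_indicator intro!: ennreal_leI near)
    also have "\<dots> = ennreal ((e / 2)\<^sup>2) * ennreal ((1 / 3) ^ (n + k))"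
      using cell_sets[OF v] by (simp add: nn_integral_cmult_indicator emeasure_cell[OF v])
    also have "\<dots> = ennreal ((1 / 3) ^ (n + k) * (e / 2)\<^sup>2)"
      by (simp add: mult.commute flip: ennreal_mult)
    finally have "(1 / 3) ^ (n + k) * (cell_average u ?v - u ?p)\<^sup>2 \<le> (1 / 3) ^ (n + k) * (e / 2)\<^sup>2"
      by (subst (asm) ennreal_le_iff) auto
    then have "(cell_average u ?v - u ?p)\<^sup>2 \<le> (e / 2)\<^sup>2"
      by simp
    then have "\<bar>cell_average u ?v - u ?p\<bar> \<le> e / 2"
      using \<open>0 < e\<close> by (simp add: abs_le_square_iff[symmetric])
    then show ?thesis
      using \<open>0 < e\<close> by simp
  qed
  then show "\<exists>N. \<forall>k\<ge>N. norm (cell_average u (w @ replicate k i) - u ?p) < e"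
    by blast
qed

lemma cell_average_vertex_le:
  assumes u: "continuous_on gasket u" and w: "w \<in> words n" and p: "p \<in> cell_vertices w" and r: "1 < r"
  shows "ennreal ((u p - cell_average u w)\<^sup>2) \<le> ennreal (r / (r - 1)) *
    (\<Sum>k. ennreal (r ^ k) * (ennreal (3 * 9 ^ (n + k)) * (\<Sum>v\<in>words k. cell_variance u (w @ v))))"
proof -
  obtain i where i: "i \<in> {0, 1, 2}" "p = word_map w (corner i)"
    using p by (auto simp: cell_vertices_def simp del: corner_simps)
  define a where "a k = cell_average u (w @ replicate k i)" for k
  have step: "ennreal ((a k - a (Suc k))\<^sup>2) \<le> ennreal (3 * 9 ^ (n + k)) * (\<Sum>v\<in>words k. cell_variance u (w @ v))" for k
  proof -
    have "w @ replicate k i \<in> words (n + k)"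
      using w i(1) by (intro words_append words_replicate)
    then have "ennreal ((a k - a (Suc k))\<^sup>2) \<le> ennreal (3 * 9 ^ (n + k)) * cell_variance u (w @ replicate k i)"
      using cell_average_diff_le[OF u _ i(1), of "w @ replicate k i" "n + k"]
      by (simp add: a_def replicate_append_same)
    \<comment> \<open>Passing to all subcells of depth \<open>k\<close> makes the bound the same for
      every corner; summed over \<open>w\<close> it becomes a full sum over level
      \<open>n + k\<close>.\<close>
    also have "cell_variance u (w @ replicate k i) \<le> (\<Sum>v\<in>words k. cell_variance u (w @ v))"
      using words_replicate[OF i(1)] by (intro member_le_sum[of _ _ "\<lambda>v. cell_variance u (w @ v)"]) auto
    finally show ?thesis
      by (simp add: mult_left_mono)
  qed
  have "ennreal ((u p - cell_average u w)\<^sup>2) = ennreal ((a 0 - u p)\<^sup>2)"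
    by (simp add: a_def power2_commute)
  also have "\<dots> \<le> ennreal (r / (r - 1)) * (\<Sum>k. ennreal (r ^ k) * ennreal ((a k - a (Suc k))\<^sup>2))"
    unfolding i(2) a_def by (intro square_telescope_limit_le r cell_average_tendsto[OF u w i(1)])
  also have "\<dots> \<le> ennreal (r / (r - 1)) *
      (\<Sum>k. ennreal (r ^ k) * (ennreal (3 * 9 ^ (n + k)) * (\<Sum>v\<in>words k. cell_variance u (w @ v))))"
    by (intro mult_left_mono suminf_le step) auto
  finally show ?thesis .
qed

text \<open>Both ends of a side are compared with the average over the cell; 24 is 2 for ordered
  pairs, times 3 sides, times 4 from splitting the square.\<close>

lemma cell_energy_le_cell_variance:
  assumes u: "continuous_on gasket u" and w: "w \<in> words n" and r: "1 < r"
  shows "ennreal (cell_energy u w) \<le> 24 * (ennreal (r / (r - 1)) *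
    (\<Sum>k. ennreal (r ^ k) * (ennreal (3 * 9 ^ (n + k)) * (\<Sum>v\<in>words k. cell_variance u (w @ v)))))"
    (is "_ \<le> 24 * ?X")
proof -
  have le: "ennreal ((u p - u q)\<^sup>2) \<le> 4 * ?X" if "p \<in> cell_vertices w" "q \<in> cell_vertices w" for p q
  proof -
    have "ennreal ((u p - u q)\<^sup>2) \<le> 2 * ennreal ((u p - cell_average u w)\<^sup>2) + 2 * ennreal ((u q - cell_average u w)\<^sup>2)"
      by (rule ennreal_square_add_le)
    also have "\<dots> \<le> 2 * ?X + 2 * ?X"
      by (intro add_mono mult_left_mono cell_average_vertex_le u w r that) auto
    also have "\<dots> = (2 + 2) * ?X"
      by (simp only: distrib_right)
    finally show ?thesis
      by simp
  qed
  let ?p = "\<lambda>i. word_map w (corner i)"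
  have "ennreal (cell_energy u w) =
      ennreal 2 * (ennreal ((u (?p 0) - u (?p 1))\<^sup>2) + ennreal ((u (?p 1) - u (?p 2))\<^sup>2) + ennreal ((u (?p 2) - u (?p 0))\<^sup>2))"
    unfolding cell_energy_corners by (simp add: ennreal_mult' ennreal_plus del: corner_simps)
  also have "\<dots> \<le> ennreal 2 * (4 * ?X + 4 * ?X + 4 * ?X)"
    by (intro mult_left_mono add_mono le) (auto simp: cell_vertices_def simp del: corner_simps)
  also have "\<dots> = (2 * (4 + 4 + 4)) * ?X"
    by (simp only: distrib_right distrib_left mult.assoc ennreal_numeral)
  finally show ?thesis
    by simp
qed

lemma graph_energy_le_cell_variance:
  assumes u: "continuous_on gasket u" and r: "1 < r"
  shows "ennreal (graph_energy n u) \<le> 24 * (ennreal (r / (r - 1)) *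
    (\<Sum>k. ennreal (r ^ k) * (ennreal (3 * 9 ^ (n + k)) * (\<Sum>v\<in>words (n + k). cell_variance u v))))"
proof -
  have "ennreal (graph_energy n u) = (\<Sum>w\<in>words n. ennreal (cell_energy u w))"
    by (simp add: graph_energy_eq sum_ennreal cell_energy_nonneg)
  also have "\<dots> \<le> (\<Sum>w\<in>words n. 24 * (ennreal (r / (r - 1)) *
    (\<Sum>k. ennreal (r ^ k) * (ennreal (3 * 9 ^ (n + k)) * (\<Sum>v\<in>words k. cell_variance u (w @ v))))))"
    by (intro sum_mono cell_energy_le_cell_variance u r)
  also have "\<dots> = 24 * (ennreal (r / (r - 1)) *
    (\<Sum>k. ennreal (r ^ k) * (ennreal (3 * 9 ^ (n + k)) * (\<Sum>w\<in>words n. \<Sum>v\<in>words k. cell_variance u (w @ v)))))"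
    by (simp only: sum_distrib_left[symmetric] suminf_sum[OF summableI, symmetric])
  finally show ?thesis
    by (simp only: sum_words_append)
qed

text \<open>At most 7 cells of level \<open>m\<close> contain \<open>x\<close>, and one containing
  \<open>y\<close> as well forces \<open>dist x y \<le> 2 * (1 / 2) ^ m\<close>. What remains is a
  finite geometric sum, dominated by its last term, which is of the order of
  \<open>1 / dist x y powr s\<close>.\<close>

lemma overlap_series_le:
  assumes x: "x \<in> gasket" and y: "y \<in> gasket" and s: "0 < s"
  defines "\<sigma> \<equiv> 2 powr s"
  shows "(\<Sum>m. \<Sum>z\<in>words m. ennreal (3 * \<sigma> ^ m) *
      (indicator (cell z) x * indicator (cell z) y * ennreal ((u x - u y)\<^sup>2))) \<le>
    ennreal (21 * \<sigma>\<^sup>2 / (\<sigma> - 1)) * ennreal ((u x - u y)\<^sup>2 / dist x y powr s)"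
proof (cases "x = y")
  case False
  have \<sigma>: "1 < \<sigma>"
    using s by (simp add: \<sigma>_def)
  define d where "d = dist x y"
  have d: "0 < d"
    using False by (simp add: d_def)
  let ?D = "(u x - u y)\<^sup>2"
  define Q where "Q m \<longleftrightarrow> d \<le> 2 * (1 / 2) ^ m" for m :: nat
  \<comment> \<open>The first level too fine for a common cell; its predecessor still satisfies
    \<open>Q\<close>, which bounds \<open>d\<close> from above in terms of \<open>l\<close>.\<close>
  define l where "l = (LEAST m. \<not> Q m)"
  obtain m0 where "(1 / 2) ^ m0 < d / 2"
    using real_arch_pow_inv[of "d / 2" "1 / 2"] d by auto
  then have "\<not> Q m0"
    by (simp add: Q_def)
  then have Ql: "\<not> Q l"
    unfolding l_def by (rule LeastI)
  have less: "m < l" if "Q m" for m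
  proof (rule ccontr)
    assume "\<not> m < l"
    then have "(1 / 2 :: real) ^ m \<le> (1 / 2) ^ l"
      by (intro power_decreasing) auto
    with that Ql show False
      by (simp add: Q_def)
  qed
  have "Q 0"
    using dist_cell[of x "[]" y] x y by (simp add: Q_def d_def)
  then obtain j where j: "l = Suc j"
    using less[of 0] by (cases l) auto
  have "Q j"
    using not_less_Least[of j "\<lambda>m. \<not> Q m"] j unfolding l_def[symmetric] by simp
  have term_le: "(\<Sum>z\<in>words m. ennreal (3 * \<sigma> ^ m) * (indicator (cell z) x * indicator (cell z) y * ennreal ?D)) \<le>
      (if m < l then ennreal (21 * \<sigma> ^ m * ?D) else 0)" for m
  proof (cases "m < l")
    case True
    have "(\<Sum>z\<in>words m. ennreal (3 * \<sigma> ^ m) * (indicator (cell z) x * indicator (cell z) y * ennreal ?D)) \<le>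
        (\<Sum>z\<in>words m. if cell z \<inter> {x} \<noteq> {} then ennreal (3 * \<sigma> ^ m * ?D) else 0)"
      using \<sigma> by (intro sum_mono) (auto split: split_indicator simp flip: ennreal_mult)
    also have "\<dots> = of_nat (card {z\<in>words m. cell z \<inter> {x} \<noteq> {}}) * ennreal (3 * \<sigma> ^ m * ?D)"
      by (simp only: sum.inter_filter[OF finite_words, symmetric] sum_constant)
    also have "\<dots> \<le> ennreal 7 * ennreal (3 * \<sigma> ^ m * ?D)"
    proof (rule mult_right_mono)
      have "of_nat (card {z\<in>words m. cell z \<inter> {x} \<noteq> {}}) \<le> (of_nat 7 :: ennreal)"
        unfolding of_nat_le_iff by (rule card_cells_near) auto
      then show "of_nat (card {z\<in>words m. cell z \<inter> {x} \<noteq> {}}) \<le> ennreal 7"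
        by simp
    qed simp
    also have "\<dots> = ennreal (21 * \<sigma> ^ m * ?D)"
      by (subst ennreal_mult'[symmetric]) (simp_all add: mult.assoc)
    finally show ?thesis
      using True by simp
  next
    case False
    have "indicator (cell z) x * indicator (cell z) y = (0 :: ennreal)" if "z \<in> words m" for z
      using dist_cell[of x z y] less[of m] False length_words[OF that]
      by (auto split: split_indicator simp: Q_def d_def)
    then show ?thesis
      using False by simp
  qed
  have "(\<Sum>m. \<Sum>z\<in>words m. ennreal (3 * \<sigma> ^ m) *
      (indicator (cell z) x * indicator (cell z) y * ennreal ?D)) \<le>
      (\<Sum>m. if m < l then ennreal (21 * \<sigma> ^ m * ?D) else 0)"
    by (intro suminf_le term_le) auto
  also have "\<dots> = (\<Sum>m<l. ennreal (21 * \<sigma> ^ m * ?D))"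
    by (subst suminf_finite[of "{..<l}"]) auto
  also have "\<dots> = ennreal (\<Sum>m<l. 21 * \<sigma> ^ m * ?D)"
    using \<sigma> by (intro sum_ennreal) auto
  also have "(\<Sum>m<l. 21 * \<sigma> ^ m * ?D) = 21 * ?D * (\<Sum>m<l. \<sigma> ^ m)"
    unfolding sum_distrib_left by (intro sum.cong) (simp_all add: mult_ac)
  also have "ennreal \<dots> \<le> ennreal (21 * \<sigma>\<^sup>2 / (\<sigma> - 1) * (?D / d powr s))"
  proof (rule ennreal_leI)
    have "(\<Sum>m<l. \<sigma> ^ m) = (\<sigma> ^ l - 1) / (\<sigma> - 1)"
      using \<sigma> by (intro geometric_sum) auto
    also have "\<dots> \<le> \<sigma> ^ l / (\<sigma> - 1)"
      using \<sigma> by (intro divide_right_mono) auto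
    also have "\<dots> \<le> (\<sigma>\<^sup>2 / d powr s) / (\<sigma> - 1)"
    proof (rule divide_right_mono)
      have "d powr s \<le> (2 * (1 / 2) ^ j) powr s"
        using \<open>Q j\<close> d s unfolding Q_def by (intro powr_mono2) auto
      also have "\<dots> = \<sigma> * (1 / \<sigma>) ^ j"
        unfolding powr_mult half_power_powr \<sigma>_def ..
      also have "\<dots> = \<sigma>\<^sup>2 / \<sigma> ^ l"
        using \<sigma> by (simp add: j power_divide power2_eq_square)
      finally have "d powr s * \<sigma> ^ l \<le> \<sigma>\<^sup>2"
        using \<sigma> by (simp add: le_divide_eq)
      then show "\<sigma> ^ l \<le> \<sigma>\<^sup>2 / d powr s"
        using d by (simp add: le_divide_eq mult.commute)
    qed (use \<sigma> in simp)
    finally have "21 * ?D * (\<Sum>m<l. \<sigma> ^ m) \<le> 21 * ?D * ((\<sigma>\<^sup>2 / d powr s) / (\<sigma> - 1))"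
      by (rule mult_left_mono) simp
    then show "21 * ?D * (\<Sum>m<l. \<sigma> ^ m) \<le> 21 * \<sigma>\<^sup>2 / (\<sigma> - 1) * (?D / d powr s)"
      by (simp add: mult_ac)
  qed
  also have "\<dots> = ennreal (21 * \<sigma>\<^sup>2 / (\<sigma> - 1)) * ennreal (?D / d powr s)"
    using \<sigma> by (intro ennreal_mult) auto
  finally show ?thesis
    by (simp only: d_def)
qed simp

lemma suminf_cell_variance_le:
  assumes u: "continuous_on gasket u" and \<beta>: "gasket_dim < \<beta>"
  shows "(\<Sum>m. ennreal ((2 powr \<beta> / 3) ^ m) * (ennreal (3 * 9 ^ m) * (\<Sum>z\<in>words m. cell_variance u z))) \<le>
    ennreal (21 * (2 powr (gasket_dim + \<beta>))\<^sup>2 / (2 powr (gasket_dim + \<beta>) - 1)) * nonlocal_energy \<beta> u"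
proof -
  let ?M = gasket_measure and ?s = "gasket_dim + \<beta>"
  define \<sigma> where "\<sigma> = 2 powr ?s"
  have s: "0 < ?s"
    using \<beta> gasket_dim_pos by simp
  note um [measurable] = borel_measurable_gasket_measure[OF u]
  define f where "f m z x y = ennreal (3 * \<sigma> ^ m) *
      (indicator (cell z) x * indicator (cell z) y * ennreal ((u x - u y)\<^sup>2))" for m z x y
  have fm: "f m z x \<in> borel_measurable ?M" "(\<lambda>x. \<integral>\<^sup>+y. f m z x y \<partial>?M) \<in> borel_measurable ?M" if "z \<in> words m" for m z x
  proof -
    note [measurable] = cell_sets[OF that]
    have [measurable]: "(\<lambda>y. ennreal ((u x - u y)\<^sup>2)) \<in> borel_measurable ?M"
    proof -
      have "(\<lambda>y. ennreal ((c - u y)\<^sup>2)) \<in> borel_measurable ?M" for c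
        by measurable
      then show ?thesis .
    qed
    show "f m z x \<in> borel_measurable ?M"
      unfolding f_def by measurable
    show "(\<lambda>x. \<integral>\<^sup>+y. f m z x y \<partial>?M) \<in> borel_measurable ?M"
      unfolding f_def by (rule gasket_measure.borel_measurable_nn_integral) measurable
  qed
  have "(\<Sum>m. ennreal ((2 powr \<beta> / 3) ^ m) * (ennreal (3 * 9 ^ m) * (\<Sum>z\<in>words m. cell_variance u z))) =
      (\<Sum>m. \<Sum>z\<in>words m. ennreal (3 * \<sigma> ^ m) * cell_variance u z)"
  proof (rule suminf_cong)
    fix m
    \<comment> \<open>The factor \<open>9 ^ m\<close> from the squared mass of the cells raises
      \<open>2 powr \<beta> / 3\<close> to \<open>3 * 2 powr \<beta> = \<sigma>\<close>, the base
      belonging to the exponent of the kernel.\<close>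
    have "(2 powr \<beta> / 3) ^ m * (3 * 9 ^ m) = 3 * \<sigma> ^ m"
    proof -
      have "(9 :: real) ^ m = 3 ^ m * 3 ^ m"
        by (simp flip: power_mult_distrib)
      then show ?thesis
        unfolding \<sigma>_def two_powr_dim_sum by (simp add: power_mult_distrib power_divide)
    qed
    moreover have "ennreal ((2 powr \<beta> / 3) ^ m * (3 * 9 ^ m)) = ennreal ((2 powr \<beta> / 3) ^ m) * ennreal (3 * 9 ^ m)"
      by (rule ennreal_mult) auto
    ultimately have "ennreal (3 * \<sigma> ^ m) = ennreal ((2 powr \<beta> / 3) ^ m) * ennreal (3 * 9 ^ m)"
      by (simp only:)
    then show "ennreal ((2 powr \<beta> / 3) ^ m) * (ennreal (3 * 9 ^ m) * (\<Sum>z\<in>words m. cell_variance u z)) =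
        (\<Sum>z\<in>words m. ennreal (3 * \<sigma> ^ m) * cell_variance u z)"
      by (simp only: sum_distrib_left mult.assoc)
  qed
  also have "\<dots> = (\<Sum>m. \<Sum>z\<in>words m. \<integral>\<^sup>+x. \<integral>\<^sup>+y. f m z x y \<partial>?M \<partial>?M)"
  proof (intro suminf_cong sum.cong refl)
    fix m z assume z: "z \<in> words m"
    note [measurable] = cell_sets[OF z]
    have 1: "(\<lambda>y. indicator (cell z) x * indicator (cell z) y * ennreal ((u x - u y)\<^sup>2)) \<in> borel_measurable ?M" for x
    proof -
      have "(\<lambda>y. b * indicator (cell z) y * ennreal ((c - u y)\<^sup>2)) \<in> borel_measurable ?M" for b :: ennreal and c
        by measurable
      then show ?thesis .
    qed
    have 2: "(\<lambda>x. \<integral>\<^sup>+y. indicator (cell z) x * indicator (cell z) y * ennreal ((u x - u y)\<^sup>2) \<partial>?M) \<in> borel_measurable ?M"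
      by (rule gasket_measure.borel_measurable_nn_integral) measurable
    show "ennreal (3 * \<sigma> ^ m) * cell_variance u z = (\<integral>\<^sup>+x. \<integral>\<^sup>+y. f m z x y \<partial>?M \<partial>?M)"
      unfolding f_def cell_variance_def by (simp only: nn_integral_cmult[OF 1] nn_integral_cmult[OF 2])
  qed
  also have "\<dots> = (\<integral>\<^sup>+x. (\<Sum>m. \<Sum>z\<in>words m. \<integral>\<^sup>+y. f m z x y \<partial>?M) \<partial>?M)"
    by (rule nn_integral_suminf_sum[symmetric]) (rule fm)
  also have "\<dots> = (\<integral>\<^sup>+x. \<integral>\<^sup>+y. (\<Sum>m. \<Sum>z\<in>words m. f m z x y) \<partial>?M \<partial>?M)"
    by (intro nn_integral_cong nn_integral_suminf_sum[symmetric] fm)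
  also have "\<dots> \<le> (\<integral>\<^sup>+x. \<integral>\<^sup>+y. ennreal (21 * \<sigma>\<^sup>2 / (\<sigma> - 1)) * ennreal ((u x - u y)\<^sup>2 / dist x y powr ?s) \<partial>?M \<partial>?M)"
    unfolding f_def \<sigma>_def by (intro nn_integral_mono overlap_series_le s) auto
  also have "\<dots> = ennreal (21 * \<sigma>\<^sup>2 / (\<sigma> - 1)) * nonlocal_energy \<beta> u"
  proof -
    have 1: "(\<lambda>y. ennreal ((u x - u y)\<^sup>2 / dist x y powr ?s)) \<in> borel_measurable ?M" for x
    proof -
      have [measurable]: "(\<lambda>y. dist x y) \<in> borel_measurable ?M"
        by (intro borel_measurable_gasket_measure continuous_intros)
      have "(\<lambda>y. ennreal ((c - u y)\<^sup>2 / dist x y powr ?s)) \<in> borel_measurable ?M" for c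
        by measurable
      then show ?thesis .
    qed
    have [measurable]: "(\<lambda>p. dist (fst p) (snd p)) \<in> borel_measurable (?M \<Otimes>\<^sub>M ?M)"
    proof -
      have id: "(\<lambda>x. x) \<in> measurable ?M borel"
        by (intro borel_measurable_gasket_measure continuous_intros)
      show ?thesis
        by (intro borel_measurable_dist measurable_compose[OF measurable_fst id] measurable_compose[OF measurable_snd id])
    qed
    have 2: "(\<lambda>x. \<integral>\<^sup>+y. ennreal ((u x - u y)\<^sup>2 / dist x y powr ?s) \<partial>?M) \<in> borel_measurable ?M"
      by (rule gasket_measure.borel_measurable_nn_integral) (simp add: case_prod_beta, measurable)
    show ?thesis
      unfolding nonlocal_energy_def by (simp only: nn_integral_cmult[OF 1] nn_integral_cmult[OF 2])
  qed
  finally show ?thesis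
    by (simp only: \<sigma>_def)
qed

lemma discrete_energy_le_nonlocal_energy:
  assumes \<beta>: "gasket_dim < \<beta>"
  obtains K where "0 < K" "\<And>u. continuous_on gasket u \<Longrightarrow> discrete_energy \<beta> u \<le> ennreal K * nonlocal_energy \<beta> u"
proof -
  define b where "b = 2 powr \<beta> / 3"
  \<comment> \<open>Telescoping needs \<open>1 < r\<close>, the convolution needs
    \<open>r < b\<close>; such a ratio exists because \<open>\<beta>\<close> exceeds
    \<open>gasket_dim\<close>.\<close>
  define r where "r = (1 + b) / 2"
  have "1 < b"
    using three_less_two_powr[OF \<beta>] by (simp add: b_def)
  then have r: "1 < r" "r < b"
    by (simp_all add: r_def)
  have "1 < 2 powr (gasket_dim + \<beta>)"
    using \<beta> gasket_dim_pos by simp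
  then obtain K' where K': "0 < K'" "K' = 21 * (2 powr (gasket_dim + \<beta>))\<^sup>2 / (2 powr (gasket_dim + \<beta>) - 1)"
    by simp
  define K where "K = 24 * (r / (r - 1)) * (b / (b - r)) * K'"
  show thesis
  proof
    show "0 < K"
      using r K'(1) by (simp add: K_def)
    fix u :: "real \<times> real \<Rightarrow> real" assume u: "continuous_on gasket u"
    define S where "S m = ennreal (3 * 9 ^ m) * (\<Sum>z\<in>words m. cell_variance u z)" for m
    let ?f = "\<lambda>n. ennreal (b ^ n * graph_energy n u)"
    have "discrete_energy \<beta> u \<le> (\<Sum>n. ?f n)"
      using suminf_offset[of ?f "Suc 0"] by (simp add: discrete_energy_eq b_def)
    also have "\<dots> = (\<Sum>n. ennreal (b ^ n) * ennreal (graph_energy n u))"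
      using \<open>1 < b\<close> by (simp add: ennreal_mult')
    also have "\<dots> \<le> (\<Sum>n. ennreal (b ^ n) * (24 * (ennreal (r / (r - 1)) * (\<Sum>k. ennreal (r ^ k) * S (n + k)))))"
      unfolding S_def by (intro suminf_le mult_left_mono graph_energy_le_cell_variance u r) auto
    also have "\<dots> = (\<Sum>n. 24 * (ennreal (r / (r - 1)) * (ennreal (b ^ n) * (\<Sum>k. ennreal (r ^ k) * S (n + k)))))"
      by (simp only: mult.left_commute[of "ennreal (b ^ n)" 24 for n]
          mult.left_commute[of "ennreal (b ^ n)" "ennreal (r / (r - 1))" for n])
    also have "\<dots> = 24 * (ennreal (r / (r - 1)) * (\<Sum>n. \<Sum>k. ennreal (b ^ n) * (ennreal (r ^ k) * S (n + k))))"
      by (simp only: ennreal_suminf_cmult)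
    also have "\<dots> \<le> 24 * (ennreal (r / (r - 1)) * (ennreal (b / (b - r)) * (\<Sum>m. ennreal (b ^ m) * S m)))"
      using r by (intro mult_left_mono suminf_convolution_le) auto
    also have "\<dots> \<le> 24 * (ennreal (r / (r - 1)) * (ennreal (b / (b - r)) * (ennreal K' * nonlocal_energy \<beta> u)))"
      unfolding S_def b_def K'(2) by (intro mult_left_mono suminf_cell_variance_le u \<beta>) auto
    also have "\<dots> = ennreal K * nonlocal_energy \<beta> u"
    proof -
      have "ennreal K = ennreal 24 * ennreal (r / (r - 1)) * ennreal (b / (b - r)) * ennreal K'"
      proof -
        have "ennreal (p * q * s * t) = ennreal p * ennreal q * ennreal s * ennreal t"
          if "0 \<le> p" "0 \<le> q" "0 \<le> s" "0 \<le> t" for p q s t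
          using that by (simp add: ennreal_mult)
        then show ?thesis
          unfolding K_def by this (use r K'(1) in auto)
      qed
      then show ?thesis
        by (simp only: mult.assoc ennreal_numeral)
    qed
    finally show "discrete_energy \<beta> u \<le> ennreal K * nonlocal_energy \<beta> u" .
  qed
qed

lemma discrete_energy_comparable:
  assumes "gasket_dim < \<beta>"
  shows "\<exists>c>0. \<exists>C>0. \<forall>u. continuous_on gasket u \<longrightarrow>
    ennreal c * nonlocal_energy \<beta> u \<le> discrete_energy \<beta> u \<and> discrete_energy \<beta> u \<le> ennreal C * nonlocal_energy \<beta> u"
proof -
  obtain K where K: "0 < K" "\<And>u. continuous_on gasket u \<Longrightarrow> nonlocal_energy \<beta> u \<le> ennreal K * discrete_energy \<beta> u"
    by (rule nonlocal_energy_le_discrete_energy[OF assms]) blast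
  obtain C where C: "0 < C" "\<And>u. continuous_on gasket u \<Longrightarrow> discrete_energy \<beta> u \<le> ennreal C * nonlocal_energy \<beta> u"
    by (rule discrete_energy_le_nonlocal_energy[OF assms]) blast
  have "ennreal (1 / K) * nonlocal_energy \<beta> u \<le> discrete_energy \<beta> u" if "continuous_on gasket u" for u
  proof -
    have "ennreal (1 / K) * nonlocal_energy \<beta> u \<le> ennreal (1 / K) * (ennreal K * discrete_energy \<beta> u)"
      by (intro mult_left_mono K(2) that) auto
    also have "\<dots> = ennreal (1 / K * K) * discrete_energy \<beta> u"
      using K(1) by (subst ennreal_mult) (auto simp: mult.assoc)
    finally show ?thesis
      using K(1) by simp
  qed
  with K(1) C show ?thesis
    by (intro exI[of _ "1 / K"] exI[of _ C] conjI allI impI) auto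
qed

section \<open>Compactness of bounded energy\<close>

lemma graph_energy_le_geometric:
  assumes \<beta>: "gasket_dim < \<beta>" and M: "0 \<le> M" "discrete_energy \<beta> u \<le> ennreal M"
  shows "graph_energy n u \<le> 3 * M * (3 / 2 powr \<beta>) ^ n"
proof -
  let ?f = "\<lambda>n. ennreal ((2 powr \<beta> / 3) ^ n * graph_energy n u)"
  have "?f n \<le> (\<Sum>n. ?f n)"
    using sum_le_suminf[of ?f "{n}"] by simp
  also have "\<dots> \<le> 3 * discrete_energy \<beta> u"
    by (rule suminf_graph_energy_le_discrete_energy[OF \<beta>])
  also have "\<dots> \<le> ennreal 3 * ennreal M"
    using M(2) by (simp add: mult_left_mono)
  also have "\<dots> = ennreal (3 * M)"
    by (rule ennreal_mult[symmetric]) (use M in auto)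
  finally have "(2 powr \<beta> / 3) ^ n * graph_energy n u \<le> 3 * M"
    using M(1) by (simp add: ennreal_le_iff)
  then show ?thesis
    by (simp add: power_divide field_simps)
qed

text \<open>\<open>q\<close> is the decay ratio of the graph energies and \<open>r\<close> the
  midpoint of 1 and \<open>1 / q\<close>, so that \<open>r * q < 1\<close>. Both 6s are a factor 2
  of the chain estimate times the 3 of \<open>graph_energy_le_geometric\<close>.\<close>

definition oscillation_const :: "real \<Rightarrow> real" where
  "oscillation_const \<beta> = (let q = 3 / 2 powr \<beta>; r = (1 + 1 / q) / 2 in 6 + 6 * (r / (r - 1)) / (1 - r * q))"

lemma energy_ratio:
  assumes "gasket_dim < \<beta>"
  shows "0 < 3 / 2 powr \<beta>" "3 / 2 powr \<beta> < 1"
  using three_less_two_powr[OF assms] by simp_all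

lemma oscillation_const_pos:
  assumes "gasket_dim < \<beta>"
  shows "0 < oscillation_const \<beta>"
proof -
  define q where "q = 3 / 2 powr \<beta>"
  have "0 < q" "q < 1"
    using energy_ratio[OF assms] by (simp_all add: q_def)
  then have "1 < (1 + 1 / q) / 2" "(1 + 1 / q) / 2 * q < 1"
    by (simp_all add: field_simps)
  then show ?thesis
    unfolding oscillation_const_def Let_def q_def[symmetric] by (intro add_pos_nonneg) auto
qed

text \<open>A Morrey-type estimate: along the chain the energies decay like the powers
  \<open>n + k\<close> of the ratio \<open>q\<close>, and the weights \<open>r ^ k\<close> with
  \<open>r * q < 1\<close> leave a convergent geometric series. The constant does not depend on
  \<open>u\<close>.\<close>

lemma square_diff_vertex_le:
  assumes \<beta>: "gasket_dim < \<beta>" and u: "continuous_on gasket u"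
    and M: "0 \<le> M" "discrete_energy \<beta> u \<le> ennreal M"
    and w: "w \<in> words n" and x: "x \<in> cell w" and p: "p \<in> cell_vertices w"
  shows "(u x - u p)\<^sup>2 \<le> oscillation_const \<beta> * M * (3 / 2 powr \<beta>) ^ n"
proof -
  define q where "q = 3 / 2 powr \<beta>"
  have q: "0 < q" "q < 1"
    using energy_ratio[OF \<beta>] by (simp_all add: q_def)
  define r where "r = (1 + 1 / q) / 2"
  have r: "1 < r" "r * q < 1"
    using q by (simp_all add: r_def field_simps)
  define C where "C = r / (r - 1)"
  have C: "0 < C"
    using r by (simp add: C_def)
  obtain v where v: "\<And>k. v k \<in> words k"
    "ennreal ((u x - u p)\<^sup>2) \<le> 2 * ennreal (cell_energy u w) +
       2 * (ennreal C * (\<Sum>k. ennreal (r ^ k) * ennreal (cell_energy u (w @ v k @ [0]))))"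
    unfolding C_def by (rule square_diff_vertex_chain[OF u w x p r(1)]) blast
  have e: "cell_energy u z \<le> 3 * M * q ^ m" if "z \<in> words m" for z m
    using cell_energy_le_graph_energy[OF that, of u] graph_energy_le_geometric[OF \<beta> M, of m]
    unfolding q_def by linarith
  define D where "D = 3 * M * q ^ n"
  have D: "0 \<le> D"
    using M q by (simp add: D_def)
  have "ennreal (r ^ k) * ennreal (cell_energy u (w @ v k @ [0])) \<le> ennreal (D * (r * q) ^ k)" for k
  proof -
    have "[0] \<in> words 1"
      by (simp add: words_def)
    then have "w @ v k @ [0] \<in> words (n + (k + 1))"
      by (intro words_append w v)
    then have "cell_energy u (w @ v k @ [0]) \<le> 3 * M * q ^ (n + (k + 1))"
      by (rule e)
    also have "\<dots> \<le> 3 * M * q ^ (n + k)"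
      using M q by (intro mult_left_mono power_decreasing) auto
    finally have "r ^ k * cell_energy u (w @ v k @ [0]) \<le> r ^ k * (3 * M * q ^ (n + k))"
      using r by (intro mult_left_mono) auto
    also have "\<dots> = D * (r * q) ^ k"
      by (simp add: D_def power_add power_mult_distrib)
    finally have "ennreal (r ^ k * cell_energy u (w @ v k @ [0])) \<le> ennreal (D * (r * q) ^ k)"
      by (rule ennreal_leI)
    then show ?thesis
      using r by (simp add: ennreal_mult')
  qed
  then have "(\<Sum>k. ennreal (r ^ k) * ennreal (cell_energy u (w @ v k @ [0]))) \<le> (\<Sum>k. ennreal (D * (r * q) ^ k))"
    by (intro suminf_le) auto
  also have "\<dots> = ennreal (D / (1 - r * q))"
    using D r q by (intro suminf_geometric_ennreal) auto
  finally have s: "(\<Sum>k. ennreal (r ^ k) * ennreal (cell_energy u (w @ v k @ [0]))) \<le> ennreal (D / (1 - r * q))" .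
  have "ennreal ((u x - u p)\<^sup>2) \<le> 2 * ennreal D + 2 * (ennreal C * ennreal (D / (1 - r * q)))"
    using s e[OF w] by (intro order_trans[OF v(2)] add_mono mult_left_mono ennreal_leI) (auto simp: D_def)
  also have "\<dots> = ennreal (2 * D + 2 * (C * (D / (1 - r * q))))"
  proof -
    have "2 * ennreal s + 2 * (ennreal C * ennreal t) = ennreal (2 * s + 2 * (C * t))" if "0 \<le> s" "0 \<le> t" for s t
      using that C by (simp add: ennreal_mult ennreal_plus)
    then show ?thesis
      by this (use D r in auto)
  qed
  also have "2 * D + 2 * (C * (D / (1 - r * q))) = oscillation_const \<beta> * M * q ^ n"
  proof -
    have "oscillation_const \<beta> = 6 + 6 * C / (1 - r * q)"
      by (simp only: oscillation_const_def Let_def C_def r_def q_def)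
    then show ?thesis
      by (simp add: D_def algebra_simps)
  qed
  finally show ?thesis
    using M q oscillation_const_pos[OF \<beta>] by (simp add: ennreal_le_iff q_def)
qed

lemma square_diff_cells_le:
  assumes \<beta>: "gasket_dim < \<beta>" and u: "continuous_on gasket u"
    and M: "0 \<le> M" "discrete_energy \<beta> u \<le> ennreal M"
    and wv: "w \<in> words n" "v \<in> words n" "adjacent w v" and x: "x \<in> cell w" and y: "y \<in> cell v"
  shows "(u x - u y)\<^sup>2 \<le> 4 * oscillation_const \<beta> * M * (3 / 2 powr \<beta>) ^ n"
proof -
  obtain p where p: "p \<in> cell_vertices w" "p \<in> cell_vertices v"
    using adjacent_common_vertex[OF wv] .
  show ?thesis
    using square_add_le[of "u x" "u y" "u p"] square_diff_vertex_le[OF \<beta> u M wv(1) x p(1)]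
      square_diff_vertex_le[OF \<beta> u M wv(2) y p(2)] by linarith
qed

text \<open>Points closer than 2^-n / 2 lie in adjacent cells of level \<open>n\<close>, between
  which \<open>u\<close> varies little; \<open>n\<close> depends on the energy bound but not on
  \<open>u\<close>.\<close>

lemma equicontinuous_discrete_energy:
  assumes \<beta>: "gasket_dim < \<beta>" and M: "0 \<le> M" and e: "0 < e"
  obtains d where "0 < d" "\<And>u x y. \<lbrakk>continuous_on gasket u; discrete_energy \<beta> u \<le> ennreal M; x \<in> gasket; y \<in> gasket;
    dist x y < d\<rbrakk> \<Longrightarrow> \<bar>u x - u y\<bar> < e"
proof -
  define K where "K = 4 * oscillation_const \<beta> * M"
  have K: "0 \<le> K"
    using oscillation_const_pos[OF \<beta>] M by (simp add: K_def)
  note q = energy_ratio[OF \<beta>]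
  \<comment> \<open>\<open>K + 1\<close> in place of \<open>K\<close> covers the case
    \<open>M = 0\<close>.\<close>
  have "0 < e\<^sup>2 / (K + 1)"
    using e K by (simp add: add_nonneg_pos)
  then obtain n where n: "(3 / 2 powr \<beta>) ^ n < e\<^sup>2 / (K + 1)"
    using real_arch_pow_inv[OF _ q(2)] by blast
  show thesis
  proof
    show "0 < (1 / 2 :: real) ^ n / 2"
      by simp
    fix u :: "real \<times> real \<Rightarrow> real" and x y
    assume u: "continuous_on gasket u" "discrete_energy \<beta> u \<le> ennreal M" and x: "x \<in> gasket" and y: "y \<in> gasket"
      and d: "dist x y < (1 / 2) ^ n / 2"
    obtain w v where w: "w \<in> words n" "x \<in> cell w" and v: "v \<in> words n" "y \<in> cell v"
      using x y gasket_eq_UN[of n] by blast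
    have "adjacent w v"
      using not_adjacent_dist[OF w(1) v(1) _ w(2) v(2)] d by linarith
    then have "(u x - u y)\<^sup>2 \<le> K * (3 / 2 powr \<beta>) ^ n"
      unfolding K_def by (intro square_diff_cells_le[OF \<beta> u(1) M u(2) w(1) v(1) _ w(2) v(2)])
    also have "\<dots> \<le> (K + 1) * (3 / 2 powr \<beta>) ^ n"
      using q by (intro mult_right_mono) auto
    also have "\<dots> < e\<^sup>2"
      using n K by (simp add: less_divide_eq add_nonneg_pos mult.commute)
    finally show "\<bar>u x - u y\<bar> < e"
      using e abs_le_square_iff[of e "u x - u y"] by (simp add: not_le[symmetric])
  qed
qed

text \<open>The cell estimate at level 0 bounds the oscillation over the whole gasket, so a bound on
  the means bounds the functions uniformly.\<close>

lemma discrete_energy_compactness: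
  fixes v :: "nat \<Rightarrow> real \<times> real \<Rightarrow> real"
  assumes \<beta>: "gasket_dim < \<beta>" and v: "\<And>n. continuous_on gasket (v n)"
    and M: "0 \<le> M" "\<And>n. discrete_energy \<beta> (v n) \<le> ennreal M"
    and B: "\<And>n. \<bar>\<integral>x. v n x \<partial>gasket_measure\<bar> \<le> B"
  obtains g \<psi> C where "continuous_on gasket g" "strict_mono \<psi>" "\<And>x. x \<in> gasket \<Longrightarrow> (\<lambda>j. v (\<psi> j) x) \<longlonglongrightarrow> g x"
    "\<And>n x. x \<in> gasket \<Longrightarrow> \<bar>v n x\<bar> \<le> C"
proof -
  define D where "D = sqrt (4 * oscillation_const \<beta> * M)"
  have osc: "\<bar>v n x - v n y\<bar> \<le> D" if "x \<in> gasket" "y \<in> gasket" for n x y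
  proof -
    have "(v n x - v n y)\<^sup>2 \<le> 4 * oscillation_const \<beta> * M"
      using square_diff_cells_le[OF \<beta> v M(1) M(2), of "[]" 0 "[]" x y] that by simp
    then show ?thesis
      unfolding D_def by (metis real_sqrt_abs real_sqrt_le_mono)
  qed
  have iv: "integrable gasket_measure (v n)" for n
    by (rule integrable_gasket_measure[OF v])
  have const: "(\<integral>x. c \<partial>gasket_measure) = c" for c :: real
    using measure_gasket by simp
  have bound: "\<bar>v n x\<bar> \<le> B + D" if x: "x \<in> gasket" for n x
  proof -
    have "(\<integral>y. v n x - D \<partial>gasket_measure) \<le> (\<integral>y. v n y \<partial>gasket_measure)"
      using osc[OF x] by (intro integral_mono iv) (auto simp: abs_le_iff algebra_simps)
    moreover have "(\<integral>y. v n y \<partial>gasket_measure) \<le> (\<integral>y. v n x + D \<partial>gasket_measure)"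
      using osc[OF x] by (intro integral_mono iv) (force simp: abs_le_iff algebra_simps)+
    ultimately show ?thesis
      using B[of n] unfolding const by linarith
  qed
  have "\<exists>g (\<psi> :: nat \<Rightarrow> nat). continuous_on gasket g \<and> strict_mono \<psi> \<and>
    (\<forall>e>0. \<exists>N. \<forall>n x. n \<ge> N \<and> x \<in> gasket \<longrightarrow> norm (v (\<psi> n) x - g x) < e)"
  proof (rule Arzela_Ascoli[OF compact_gasket, of v "B + D"])
    show "norm (v n x) \<le> B + D" if "x \<in> gasket" for n x
      using bound[OF that] by simp
    fix x e :: "real \<times> real" and e' :: real
    assume x: "x \<in> gasket" and "0 < e'"
    obtain d where "0 < d" "\<And>u x y. \<lbrakk>continuous_on gasket u; discrete_energy \<beta> u \<le> ennreal M; x \<in> gasket; y \<in> gasket;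
        dist x y < d\<rbrakk> \<Longrightarrow> \<bar>u x - u y\<bar> < e'"
      by (rule equicontinuous_discrete_energy[OF \<beta> M(1) \<open>0 < e'\<close>]) blast
    then show "\<exists>d>0. \<forall>n y. y \<in> gasket \<and> norm (x - y) < d \<longrightarrow> norm (v n x - v n y) < e'"
      using v M(2) x by (intro exI[of _ d]) (auto simp: dist_norm)
  next
    fix g :: "real \<times> real \<Rightarrow> real" and k
    assume "continuous_on gasket g" "strict_mono (k :: nat \<Rightarrow> nat)"
      "\<And>e. 0 < e \<Longrightarrow> \<exists>N. \<forall>n x. n \<ge> N \<and> x \<in> gasket \<longrightarrow> norm (v (k n) x - g x) < e"
    then show "\<exists>g (\<psi> :: nat \<Rightarrow> nat). continuous_on gasket g \<and> strict_mono \<psi> \<and>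
      (\<forall>e>0. \<exists>N. \<forall>n x. n \<ge> N \<and> x \<in> gasket \<longrightarrow> norm (v (\<psi> n) x - g x) < e)"
      by (intro exI[of _ g] exI[of _ k] conjI allI impI)
  qed
  then obtain g and \<psi> :: "nat \<Rightarrow> nat" where g: "continuous_on gasket g" "strict_mono \<psi>"
    "\<And>e. 0 < e \<Longrightarrow> \<exists>N. \<forall>n x. n \<ge> N \<and> x \<in> gasket \<longrightarrow> norm (v (\<psi> n) x - g x) < e"
    by blast
  have "(\<lambda>j. v (\<psi> j) x) \<longlonglongrightarrow> g x" if "x \<in> gasket" for x
    using g(3) that by (intro LIMSEQ_I) blast
  with g(1,2) bound show thesis
    by (intro that[of g \<psi> "B + D"])
qed

section \<open>Weak limits\<close>

lemma L2_mult_integrable: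
  assumes "f \<in> L2 M" "g \<in> L2 M"
  shows "integrable M (\<lambda>x. f x * g x)"
proof (rule Bochner_Integration.integrable_bound)
  show "integrable M (\<lambda>x. (f x)\<^sup>2 + (g x)\<^sup>2)"
    using assms by (auto simp: L2_def)
  show "(\<lambda>x. f x * g x) \<in> borel_measurable M"
    using assms by (auto simp: L2_def)
  have "norm (f x * g x) \<le> norm ((f x)\<^sup>2 + (g x)\<^sup>2)" for x
  proof -
    have "\<bar>f x\<bar> * \<bar>g x\<bar> \<le> \<bar>f x\<bar>\<^sup>2 + \<bar>g x\<bar>\<^sup>2"
      using sum_squares_bound[of "\<bar>f x\<bar>" "\<bar>g x\<bar>", unfolded mult.assoc]
        mult_nonneg_nonneg[OF abs_ge_zero abs_ge_zero, of "f x" "g x"] by linarith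
    then show ?thesis
      by (simp add: abs_mult)
  qed
  then show "AE x in M. norm (f x * g x) \<le> norm ((f x)\<^sup>2 + (g x)\<^sup>2)"
    by simp
qed

lemma L2_diff:
  assumes "f \<in> L2 M" "g \<in> L2 M"
  shows "(\<lambda>x. f x - g x) \<in> L2 M"
proof -
  have "(\<lambda>x. (f x - g x)\<^sup>2) = (\<lambda>x. (f x)\<^sup>2 + (g x)\<^sup>2 - 2 * (f x * g x))"
    by (simp add: power2_eq_square algebra_simps)
  moreover have "(\<lambda>x. f x - g x) \<in> borel_measurable M"
    using assms by (auto simp: L2_def)
  ultimately show ?thesis
    using assms L2_mult_integrable[OF assms] by (simp add: L2_def)
qed

lemma continuous_on_gasket_L2:
  assumes "continuous_on gasket f"
  shows "f \<in> L2 gasket_measure"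
  unfolding L2_def using assms
  by (auto intro!: borel_measurable_gasket_measure integrable_gasket_measure continuous_intros)

lemma L2_gasket_integrable:
  assumes "f \<in> L2 gasket_measure"
  shows "integrable gasket_measure f"
  using L2_mult_integrable[OF assms continuous_on_gasket_L2[of "\<lambda>_. 1"]] by simp

text \<open>The test function is \<open>u - g\<close> itself: weak and dominated convergence give
  two values for the same limit, and their difference is the integral of
  \<open>(u - g)\<^sup>2\<close>.\<close>

lemma weak_limit_eq_pointwise_limit:
  fixes v :: "nat \<Rightarrow> real \<times> real \<Rightarrow> real"
  assumes weak: "\<And>h. h \<in> L2 gasket_measure \<Longrightarrow> (\<lambda>j. \<integral>x. v j x * h x \<partial>gasket_measure) \<longlonglongrightarrow> (\<integral>x. u x * h x \<partial>gasket_measure)"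
    and u: "u \<in> L2 gasket_measure" and v: "\<And>j. continuous_on gasket (v j)" and g: "continuous_on gasket g"
    and lim: "\<And>x. x \<in> gasket \<Longrightarrow> (\<lambda>j. v j x) \<longlonglongrightarrow> g x"
    and bound: "\<And>j x. x \<in> gasket \<Longrightarrow> \<bar>v j x\<bar> \<le> C"
  shows "AE x in gasket_measure. u x = g x"
proof -
  let ?M = gasket_measure
  define h where "h x = u x - g x" for x
  have gL: "g \<in> L2 ?M"
    using g by (rule continuous_on_gasket_L2)
  have h: "h \<in> L2 ?M"
    unfolding h_def by (rule L2_diff[OF u gL])
  have vL: "v j \<in> L2 ?M" for j
    using v by (rule continuous_on_gasket_L2)
  have "(\<lambda>j. \<integral>x. v j x * h x \<partial>?M) \<longlonglongrightarrow> (\<integral>x. g x * h x \<partial>?M)"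
  proof (rule integral_dominated_convergence[where w = "\<lambda>x. C * \<bar>h x\<bar>"])
    show "(\<lambda>x. g x * h x) \<in> borel_measurable ?M" "(\<lambda>x. v j x * h x) \<in> borel_measurable ?M" for j
      using L2_mult_integrable[OF gL h] L2_mult_integrable[OF vL h] by auto
    show "integrable ?M (\<lambda>x. C * \<bar>h x\<bar>)"
      using L2_gasket_integrable[OF h] by simp
    show "AE x in ?M. (\<lambda>j. v j x * h x) \<longlonglongrightarrow> g x * h x"
      by (intro AE_I2 tendsto_intros lim) simp
    show "AE x in ?M. norm (v j x * h x) \<le> C * \<bar>h x\<bar>" for j
      using bound by (intro AE_I2) (auto simp: abs_mult mult_right_mono)
  qed
  then have eq: "(\<integral>x. u x * h x \<partial>?M) = (\<integral>x. g x * h x \<partial>?M)"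
    using weak[OF h] LIMSEQ_unique by blast
  have "(\<integral>x. (h x)\<^sup>2 \<partial>?M) = (\<integral>x. u x * h x - g x * h x \<partial>?M)"
    by (simp add: h_def power2_eq_square algebra_simps)
  also have "\<dots> = 0"
    using eq L2_mult_integrable[OF u h] L2_mult_integrable[OF gL h] by simp
  finally have "AE x in ?M. (h x)\<^sup>2 = 0"
    using h by (subst (asm) integral_nonneg_eq_0_iff_AE) (auto simp: L2_def)
  then show ?thesis
    by (simp add: h_def)
qed

section \<open>The limit of the renormalized energies\<close>

lemma graph_energy_cong:
  assumes "\<And>x. x \<in> gasket \<Longrightarrow> u x = v x"
  shows "graph_energy n u = graph_energy n v"
proof -
  have "p \<in> gasket" if "w \<in> words n" "p \<in> cell_vertices w" for w p
    using that cell_vertices_subset cell_subset by blast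
  then show ?thesis
    unfolding graph_energy_def using assms by (intro sum.cong refl) simp
qed

lemma local_energy_cong:
  assumes "\<And>x. x \<in> gasket \<Longrightarrow> u x = v x"
  shows "local_energy u = local_energy v"
  unfolding local_energy_def by (simp add: graph_energy_cong[OF assms])

lemma scaled_energy_tendsto:
  assumes "\<And>x. x \<in> gasket \<Longrightarrow> (\<lambda>j. v j x) \<longlonglongrightarrow> g x"
  shows "(\<lambda>j. scaled_energy n (v j)) \<longlonglongrightarrow> scaled_energy n g"
proof -
  have "p \<in> gasket" if "w \<in> words n" "p \<in> cell_vertices w" for w p
    using that cell_vertices_subset cell_subset by blast
  then show ?thesis
    unfolding scaled_energy_def graph_energy_def
    by (intro tendsto_mult tendsto_const tendsto_sum tendsto_power tendsto_diff assms)
qed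

section \<open>Continuous versions and Mosco convergence\<close>

text \<open>One version serves all functionals, so energies for different \<open>\<beta>\<close> are
  compared at the same function.\<close>

lemma extend_L2_cases:
  obtains (version) v where "continuous_version u v" "\<And>F. extend_L2 F u = F v"
  | (none) "\<And>F. extend_L2 F u = \<infinity>"
proof (cases "\<exists>v. continuous_version u v")
  case True
  then have "continuous_version u (SOME v. continuous_version u v)"
    by (rule someI_ex)
  then show ?thesis
    using True by (intro version) (auto simp: extend_L2_def)
next
  case False
  then show ?thesis
    by (intro none) (auto simp: extend_L2_def)
qed

abbreviation (input) renormalized_energy :: "real \<Rightarrow> (real \<times> real \<Rightarrow> real) \<Rightarrow> ennreal" where
  "renormalized_energy \<beta> u \<equiv> ennreal (1 - 2 powr \<beta> / 5) * extend_L2 (discrete_energy \<beta>) u"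

text \<open>The strict inequality matters: at \<open>walk_dim\<close> the coefficient is 0, and 0
  times \<infinity> is 0 in \<open>ennreal\<close>.\<close>

lemma renormalized_infinity: "\<beta> < walk_dim \<Longrightarrow> ennreal (1 - 2 powr \<beta> / 5) * \<infinity> = \<infinity>"
  using two_powr_less_5[of \<beta>] by (simp add: ennreal_mult_top)

lemma mono_renormalized: "mono_on {gasket_dim<..<walk_dim} (\<lambda>\<beta>. renormalized_energy \<beta> u)"
proof (cases u rule: extend_L2_cases)
  case (version v)
  then show ?thesis
    by (intro mono_onI) (simp add: renormalized_energy_mono)
next
  case none
  then show ?thesis
    by (intro mono_onI) (simp only: renormalized_infinity greaterThanLessThan_iff order.refl)
qed

lemma tendsto_renormalized: "((\<lambda>\<beta>. renormalized_energy \<beta> u) \<longlongrightarrow> extend_L2 local_energy u) (at_left walk_dim)"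
proof (cases u rule: extend_L2_cases)
  case (version v)
  then show ?thesis
    by (simp add: renormalized_energy_tendsto)
next
  case none
  have "\<forall>\<^sub>F \<beta> in at_left walk_dim. renormalized_energy \<beta> u = extend_L2 local_energy u"
    unfolding none by (rule eventually_at_leftI[OF _ gasket_dim_less_walk_dim])
      (simp only: renormalized_infinity greaterThanLessThan_iff)
  then show ?thesis
    by (rule tendsto_eventually)
qed

lemma renormalized_le_local: "\<beta> < walk_dim \<Longrightarrow> renormalized_energy \<beta> u \<le> extend_L2 local_energy u"
  by (cases u rule: extend_L2_cases) (auto simp: renormalized_energy_le_local_energy)

lemma renormalized_finite_version:
  assumes "renormalized_energy \<beta> u < a" "\<beta> < walk_dim"
  obtains v where "continuous_version u v" "ennreal (1 - 2 powr \<beta> / 5) * discrete_energy \<beta> v < a"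
proof (cases u rule: extend_L2_cases)
  case (version v)
  then show ?thesis
    using that assms(1) by simp
next
  case none
  then have "renormalized_energy \<beta> u = \<infinity>"
    by (simp only: renormalized_infinity[OF assms(2)])
  then show ?thesis
    using assms(1) by simp
qed

text \<open>The version picked by \<open>SOME\<close> agrees with \<open>g\<close> almost
  everywhere, hence by continuity on the whole gasket.\<close>

lemma extend_local_energy_eq:
  assumes "continuous_version u g"
  shows "extend_L2 local_energy u = local_energy g"
proof (cases u rule: extend_L2_cases)
  case (version v)
  have "AE x in gasket_measure. v x = g x"
    using version(1) assms unfolding continuous_version_def by (auto elim: eventually_elim2)
  then have "v x = g x" if "x \<in> gasket" for x
    using version(1) assms that unfolding continuous_version_def
    by (intro continuous_AE_eq_on_gasket) auto
  then show ?thesis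
    unfolding version by (rule local_energy_cong)
next
  case none
  then have False
    using assms none[of "\<lambda>_. 0"] unfolding extend_L2_def by (auto split: if_splits)
  then show ?thesis ..
qed

lemma mosco_liminf:
  fixes \<beta>s :: "nat \<Rightarrow> real"
  assumes \<beta>s: "range \<beta>s \<subseteq> {gasket_dim<..<walk_dim}" "incseq \<beta>s" "\<beta>s \<longlonglongrightarrow> walk_dim"
    and weak: "L2_weak gasket_measure us u"
  shows "extend_L2 local_energy u \<le> liminf (\<lambda>n. renormalized_energy (\<beta>s n) (us n))"
proof (rule ccontr)
  let ?F = "\<lambda>n. renormalized_energy (\<beta>s n) (us n)"
  have "\<beta>s n \<in> {gasket_dim<..<walk_dim}" for n
    using \<beta>s(1) by blast
  then have \<beta>: "gasket_dim < \<beta>s n" "\<beta>s n < walk_dim" for n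
    by auto
  assume "\<not> extend_L2 local_energy u \<le> liminf ?F"
  \<comment> \<open>The intermediate value is finite and serves as a uniform energy bound along the
    subsequence extracted next.\<close>
  then obtain a where a: "liminf ?F < a" "a < extend_L2 local_energy u"
    using dense[of "liminf ?F" "extend_L2 local_energy u"] by (auto simp: not_le)
  then have "a < top"
    using less_le_trans top_greatest by blast
  then obtain M where M: "0 \<le> M" "a = ennreal M"
    by (cases a) auto
  have inf: "infinite {n. ?F n < a}"
  proof
    assume "finite {n. ?F n < a}"
    then have "\<forall>\<^sub>F n in sequentially. \<not> ?F n < a"
      by (metis (mono_tags, lifting) MOST_iff_cofinite cofinite_eq_sequentially eventually_cofinite mem_Collect_eq not_not Collect_cong)
    then have "a \<le> liminf ?F"
      by (intro Liminf_bounded) (simp add: not_less)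
    with a(1) show False
      by simp
  qed
  obtain \<phi> :: "nat \<Rightarrow> nat" where "strict_mono \<phi> \<and> (\<forall>k. \<phi> k \<in> {n. ?F n < a})"
    using infinite_enumerate[OF inf] ..
  then have \<phi>: "strict_mono \<phi>" and less: "?F (\<phi> k) < a" for k
    by simp_all
  have "\<forall>k. \<exists>v. continuous_version (us (\<phi> k)) v \<and> ennreal (1 - 2 powr \<beta>s (\<phi> k) / 5) * discrete_energy (\<beta>s (\<phi> k)) v < a"
  proof
    show "\<exists>v. continuous_version (us (\<phi> k)) v \<and> ennreal (1 - 2 powr \<beta>s (\<phi> k) / 5) * discrete_energy (\<beta>s (\<phi> k)) v < a" for k
      by (rule renormalized_finite_version[OF less \<beta>(2)]) (intro exI conjI)
  qed
  from choice[OF this] obtain v where v: "\<And>k. continuous_version (us (\<phi> k)) (v k)"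
      "\<And>k. ennreal (1 - 2 powr \<beta>s (\<phi> k) / 5) * discrete_energy (\<beta>s (\<phi> k)) (v k) < a"
    by blast
  have vc: "continuous_on gasket (v k)" for k
    using v(1) by (simp add: continuous_version_def)
  \<comment> \<open>Monotonicity in \<open>\<beta>\<close> turns the bounds at varying exponents
    into a bound at the single exponent \<open>\<beta>s 0\<close>, where compactness
    applies.\<close>
  define c where "c = 1 - 2 powr \<beta>s 0 / 5"
  have c: "0 < c"
    using two_powr_less_5[OF \<beta>(2)[of 0]] by (simp add: c_def)
  have energy: "discrete_energy (\<beta>s 0) (v k) \<le> ennreal (M / c)" for k
  proof -
    have "ennreal c * discrete_energy (\<beta>s 0) (v k) \<le> ennreal (1 - 2 powr \<beta>s (\<phi> k) / 5) * discrete_energy (\<beta>s (\<phi> k)) (v k)"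
      unfolding c_def using \<beta>s(2) \<beta>(2) by (intro renormalized_energy_mono) (auto simp: incseq_def)
    also have "\<dots> \<le> ennreal M"
      using v(2)[of k] M(2) by simp
    finally have "ennreal (1 / c) * (ennreal c * discrete_energy (\<beta>s 0) (v k)) \<le> ennreal (1 / c) * ennreal M"
      by (rule mult_left_mono) simp
    moreover have "ennreal (1 / c) * ennreal c = 1"
      using c by (simp flip: ennreal_mult)
    moreover have "ennreal (1 / c) * ennreal M = ennreal (M / c)"
      using c M(1) by (simp flip: ennreal_mult)
    ultimately show ?thesis
      by (simp only: mult.assoc[symmetric] mult_1)
  qed
  have uL: "u \<in> L2 gasket_measure" and usL: "\<And>n. us n \<in> L2 gasket_measure"
    and wk: "\<And>h. h \<in> L2 gasket_measure \<Longrightarrow> (\<lambda>n. \<integral>x. us n x * h x \<partial>gasket_measure) \<longlonglongrightarrow> (\<integral>x. u x * h x \<partial>gasket_measure)"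
    using weak by (auto simp: L2_weak_def)
  have wkv: "(\<lambda>k. \<integral>x. v k x * h x \<partial>gasket_measure) \<longlonglongrightarrow> (\<integral>x. u x * h x \<partial>gasket_measure)" if h: "h \<in> L2 gasket_measure" for h
  proof -
    have "(\<integral>x. us (\<phi> k) x * h x \<partial>gasket_measure) = (\<integral>x. v k x * h x \<partial>gasket_measure)" for k
    proof (rule integral_cong_AE)
      show "(\<lambda>x. us (\<phi> k) x * h x) \<in> borel_measurable gasket_measure" "(\<lambda>x. v k x * h x) \<in> borel_measurable gasket_measure"
        using L2_mult_integrable[OF usL h] L2_mult_integrable[OF continuous_on_gasket_L2[OF vc] h] by auto
      show "AE x in gasket_measure. us (\<phi> k) x * h x = v k x * h x"
        using v(1)[of k] by (auto simp: continuous_version_def elim: eventually_mono)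
    qed
    then show ?thesis
      using LIMSEQ_subseq_LIMSEQ[OF wk[OF h] \<phi>] by (simp add: comp_def)
  qed
  \<comment> \<open>Weak convergence tested against the constant 1 bounds the means.\<close>
  have "Bseq (\<lambda>k. \<integral>x. v k x \<partial>gasket_measure)"
    using wkv[of "\<lambda>_. 1"] continuous_on_gasket_L2[of "\<lambda>_. 1"] by (intro convergent_imp_Bseq) (auto simp: convergent_def)
  then obtain B where "\<And>k. \<bar>\<integral>x. v k x \<partial>gasket_measure\<bar> \<le> B"
    by (auto simp: Bseq_def)
  then obtain g \<psi> C where g: "continuous_on gasket g" "strict_mono \<psi>" "\<And>x. x \<in> gasket \<Longrightarrow> (\<lambda>j. v (\<psi> j) x) \<longlonglongrightarrow> g x"
    "\<And>k x. x \<in> gasket \<Longrightarrow> \<bar>v k x\<bar> \<le> C"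
    using c M(1) by (elim discrete_energy_compactness[OF \<beta>(1)[of 0] vc _ energy, rotated]) auto
  have "AE x in gasket_measure. u x = g x"
  proof (rule weak_limit_eq_pointwise_limit[of "\<lambda>j. v (\<psi> j)" u g C])
    show "(\<lambda>j. \<integral>x. v (\<psi> j) x * h x \<partial>gasket_measure) \<longlonglongrightarrow> (\<integral>x. u x * h x \<partial>gasket_measure)" if "h \<in> L2 gasket_measure" for h
      using LIMSEQ_subseq_LIMSEQ[OF wkv[OF that] g(2)] by (simp add: comp_def)
  qed (use uL vc g in auto)
  then have "continuous_version u g"
    using g(1) by (simp add: continuous_version_def)
  then have "extend_L2 local_energy u = local_energy g"
    by (rule extend_local_energy_eq)
  also have "\<dots> \<le> ennreal M"
    unfolding local_energy_eq_SUP
  proof (rule SUP_least)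
    \<comment> \<open>With the level fixed, the limit in \<open>j\<close> is taken in a finite sum,
      and the weights tend to \<open>2 powr walk_dim / 5 = 1\<close>.\<close>
    fix m :: nat
    let ?l = "\<lambda>j. 2 powr \<beta>s (\<phi> (\<psi> j)) / 5"
    have "(\<lambda>j. \<beta>s (\<phi> (\<psi> j))) \<longlonglongrightarrow> walk_dim"
      using LIMSEQ_subseq_LIMSEQ[OF \<beta>s(3) strict_mono_o[OF \<phi> g(2)]] by (simp add: comp_def)
    then have "?l \<longlonglongrightarrow> 2 powr walk_dim / 5"
      by (intro tendsto_intros) auto
    then have "(\<lambda>j. ?l j ^ Suc m * scaled_energy (Suc m) (v (\<psi> j))) \<longlonglongrightarrow> (2 powr walk_dim / 5) ^ Suc m * scaled_energy (Suc m) g"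
      by (intro tendsto_mult tendsto_power scaled_energy_tendsto g(3))
    moreover have "?l j ^ Suc m * scaled_energy (Suc m) (v (\<psi> j)) \<le> M" for j
    proof -
      have "ennreal (?l j ^ Suc m * scaled_energy (Suc m) (v (\<psi> j))) \<le> ennreal M"
        using scaled_energy_le_renormalized_energy[OF \<beta>(2), of "\<phi> (\<psi> j)" m "v (\<psi> j)"] v(2)[of "\<psi> j"] M(2) by simp
      then show ?thesis
        using M(1) by (simp add: ennreal_le_iff)
    qed
    ultimately have "(2 powr walk_dim / 5) ^ Suc m * scaled_energy (Suc m) g \<le> M"
      by (intro LIMSEQ_le_const2[of _ _ M]) auto
    then have "scaled_energy m g \<le> M"
      using incseq_SucD[OF incseq_scaled_energy[of g], of m] by (simp add: two_powr_walk_dim)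
    then show "ennreal (scaled_energy m g) \<le> ennreal M"
      by (rule ennreal_leI)
  qed
  finally show False
    using a(2) M(2) by simp
qed

text \<open>The constant sequence is a recovery sequence, since the renormalized energies stay below
  the local energy.\<close>

lemma mosco_convergent_renormalized:
  fixes \<beta>s :: "nat \<Rightarrow> real"
  assumes \<beta>s: "range \<beta>s \<subseteq> {gasket_dim<..<walk_dim}" "incseq \<beta>s" "\<beta>s \<longlonglongrightarrow> walk_dim"
  shows "mosco_convergent gasket_measure (\<lambda>n u. renormalized_energy (\<beta>s n) u) (extend_L2 local_energy)"
  unfolding mosco_convergent_def
proof (intro conjI allI impI ballI)
  fix us u assume "L2_weak gasket_measure us u"
  then show "extend_L2 local_energy u \<le> liminf (\<lambda>n. renormalized_energy (\<beta>s n) (us n))"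
    by (rule mosco_liminf[OF \<beta>s])
next
  fix u assume u: "u \<in> L2 gasket_measure"
  have "\<beta>s n \<in> {gasket_dim<..<walk_dim}" for n
    using \<beta>s(1) by blast
  then have "\<beta>s n < walk_dim" for n
    by auto
  then have "limsup (\<lambda>n. renormalized_energy (\<beta>s n) u) \<le> extend_L2 local_energy u"
    by (intro Limsup_bounded always_eventually allI renormalized_le_local)
  moreover have "L2_strong gasket_measure (\<lambda>_. u) u"
    using u by (simp add: L2_strong_def)
  ultimately show "\<exists>us. L2_strong gasket_measure us u \<and>
      limsup (\<lambda>n. renormalized_energy (\<beta>s n) (us n)) \<le> extend_L2 local_energy u"
    by blast
qed

theorem theorem1p6:
  shows
    "(\<forall>\<beta>>gasket_dim. \<exists>c>0. \<exists>C>0. \<forall>u. continuous_on gasket u \<longrightarrow>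
        ennreal c * nonlocal_energy \<beta> u \<le> discrete_energy \<beta> u \<and>
        discrete_energy \<beta> u \<le> ennreal C * nonlocal_energy \<beta> u) \<and>
     (\<forall>u\<in>L2 gasket_measure.
        mono_on {gasket_dim<..<walk_dim}
          (\<lambda>\<beta>. ennreal (1 - 2 powr \<beta> / 5) * extend_L2 (discrete_energy \<beta>) u) \<and>
        ((\<lambda>\<beta>. ennreal (1 - 2 powr \<beta> / 5) * extend_L2 (discrete_energy \<beta>) u)
           \<longlongrightarrow> extend_L2 local_energy u) (at_left walk_dim)) \<and>
     (\<forall>\<beta>s :: nat \<Rightarrow> real.
        range \<beta>s \<subseteq> {gasket_dim<..<walk_dim} \<and> incseq \<beta>s \<and> \<beta>s \<longlonglongrightarrow> walk_dim \<longrightarrow>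
        mosco_convergent gasket_measure
          (\<lambda>n u. ennreal (1 - 2 powr \<beta>s n / 5) * extend_L2 (discrete_energy (\<beta>s n)) u)
          (extend_L2 local_energy))"
proof (intro conjI allI impI ballI)
  show "\<exists>c>0. \<exists>C>0. \<forall>u. continuous_on gasket u \<longrightarrow>
        ennreal c * nonlocal_energy \<beta> u \<le> discrete_energy \<beta> u \<and>
        discrete_energy \<beta> u \<le> ennreal C * nonlocal_energy \<beta> u" if "gasket_dim < \<beta>" for \<beta>
    using that by (rule discrete_energy_comparable)
qed (auto intro: mono_renormalized tendsto_renormalized mosco_convergent_renormalized)

end
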